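(* $$L(g,3)=\frac{\pi^{3}}{128}\,F^{1;2;2}_{1;1;1}\left[\left.\begin{matrix}\tfrac32\\ 2\end{matrix};\begin{matrix}\tfrac12,1\\ \tfrac32\end{matrix};\begin{matrix}\tfrac12,\tfrac12\\ 1\end{matrix}\right|1,1\right].$$
   Context: For $|q|<1$ let $\theta_2(q)=\sum_{n\in\mathbb Z}q^{(n+1/2)^2}$, $\theta_3(q)=\sum_{n\in\mathbb Z}q^{n^2}$, $\theta_4(q)=\sum_{n\in\mathbb Z}(-1)^nq^{n^2}$. Let $g(q)=\frac1{16}\theta_2^4(q)\theta_4^2(q^2)=\sum_{n\ge0}b_nq^n$, a cusp form of weight 3. Its $L$-function is $L(g,s)=\sum_{n\ge1}b_nn^{-s}$ (analytically continued to an entire function). $(a)_n=\Gamma(a+n)/\Gamma(a)$. The Kampé de Fériet function is $$F^{A;B;B'}_{C;D;D'}\left[\left.\begin{matrix}a_1,\dots,a_A\\ c_1,\dots,c_C\end{matrix};\begin{matrix}b_1,\dots,b_B\\ d_1,\dots,d_D\end{matrix};\begin{matrix}b'_1,\dots,b'_{B'}\\ d'_1,\dots,d'_{D'}\end{matrix}\right|x,y\right]=\sum_{m,n\ge0}\frac{\prod_i(a_i)_{m+n}\prod_i(b_i)_m\prod_i(b'_i)_n}{\prod_i(c_i)_{m+n}\prod_i(d_i)_m\prod_i(d'_i)_n}\frac{x^my^n}{m!\,n!},$$ which converges absolutely at $x=y=1$ for the parameters used here. *)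

theory Defs
  imports "HOL-Analysis.Analysis"
begin

text \<open>Jacobi theta functions for complex q with |q| < 1. Non-integer powers use the
  principal branch (powr); theta2^4 is nevertheless single-valued and analytic.\<close>

definition theta2 :: "complex \<Rightarrow> complex" where
  "theta2 q = (\<Sum>\<^sub>\<infinity>n::int. q powr (complex_of_real ((real_of_int n + 1/2)^2)))"

definition theta3 :: "complex \<Rightarrow> complex" where
  "theta3 q = (\<Sum>\<^sub>\<infinity>n::int. q ^ nat (n^2))"

definition theta4 :: "complex \<Rightarrow> complex" where
  "theta4 q = (\<Sum>\<^sub>\<infinity>n::int. (-1) powi n * q ^ nat (n^2))"

definition g :: "complex \<Rightarrow> complex" where
  "g q = (1/16) * theta2 q ^ 4 * theta4 (q^2) ^ 2"

definition b :: "nat \<Rightarrow> complex" where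
  "b n = (deriv ^^ n) g 0 / fact n"

text \<open>L(g,3) = sum_{n>=1} b_n n^(-3) (s = 3 lies in the region of absolute convergence).\<close>
definition L_g_3 :: complex where
  "L_g_3 = (\<Sum>n. b (Suc n) / of_nat (Suc n) ^ 3)"

definition KdF :: "real list \<Rightarrow> real list \<Rightarrow> real list \<Rightarrow> real list \<Rightarrow> real list \<Rightarrow> real list
    \<Rightarrow> real \<Rightarrow> real \<Rightarrow> real" where
  "KdF as cs bs ds bs' ds' x y =
     (\<Sum>\<^sub>\<infinity>(m::nat, n::nat).
        (prod_list (map (\<lambda>a. pochhammer a (m+n)) as) * prod_list (map (\<lambda>a. pochhammer a m) bs)
           * prod_list (map (\<lambda>a. pochhammer a n) bs'))
        / (prod_list (map (\<lambda>a. pochhammer a (m+n)) cs) * prod_list (map (\<lambda>a. pochhammer a m) ds)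
           * prod_list (map (\<lambda>a. pochhammer a n) ds'))
        * x^m * y^n / (fact m * fact n))"

end

theory Submission
  imports Defs "HOL-Complex_Analysis.Complex_Analysis"
begin

text \<open>
  Write $q = e^{-\pi t}$. The squares of the theta functions are sums of hyperbolic secants,
  $\theta_3^2 = S_3(t) = \sum_n \mathrm{sech}(\pi n t)$ and
  $\theta_2^2 = S_2(t) = \sum_n \mathrm{sech}(\pi (n + 1/2) t)$. Convolutions of such sums telescope,
  because $\mathrm{sech}\,x\,\mathrm{sech}\,y = (\tanh y - \tanh x)/\sinh(y - x)$; this yields the
  Lambert series of $\theta_2^2$, $\theta_2^4$ and $\theta_2^2\theta_4^4$ without modular forms.
  Every other identity between theta functions, the complete elliptic integral and the modulus
  $k = \theta_2^2/\theta_3^2$ compares two functions with the same behaviour under $t \mapsto 2t$ (Landen's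
  transformation, i.e. the arithmetic-geometric mean) and the same limit; in particular
  $\theta_3^2 = {}_2F_1(1/2,1/2;1;k^2)$, $(\log k)' = -(\pi/2)\theta_4^4$ and the inversion
  $t \mapsto 1/t$.

  The formula for $(\log k)'$ identifies $g$ with half the sum of $(x^2-y^2)q^{x^2+y^2}$ over odd $x$ and even $y$, so
  that $L(g,3)$ is an absolutely convergent lattice sum and equals
  $(\pi^3/2)\int_0^\infty t^2 g(e^{-\pi t})\,dt$. Following Rogers and Zudilin, $g$ is written as a
  product of two Lambert series, $\theta_2^4$ at $t$ and $\theta_2^2$ at $1/(2t)$, and a substitution that
  depends on the summation indices exchanges these indices. The new series sum to
  $\mathrm{artanh}\,k$ and $\theta_2^2\theta_4^4$ at $1/t$, so
  $L(g,3) = (\pi^3/64)\int_0^\infty \mathrm{artanh}\,k\;\theta_2^4\theta_4^2\,dt$. In the variable $k$ this is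
  the integral of $\mathrm{artanh}(k)\,{}_2F_1(1/2,1/2;1;k^2)\,k^2/\sqrt{1-k^2}$ against $dk/k$ up to a constant, and
  expanding both factors in powers of $k$ gives the double series.
\<close>

section \<open>Sums over the integers\<close>

text \<open>The value s = 3 lies outside the critical points 1 and 2 of a form of weight 3. What
  makes it accessible is a transfer of weight. For odd m and n the two Lambert series contribute t m
  csch(pi m t) csch(pi n/(4t)), up to sign; putting t = n/(2mu) interchanges the two arguments and
  turns the coefficient m into n^2/m. Weights 2 and 1 become 0 and 3, and the series of weight 0 is
  a logarithm, here artanh k.

  The delicate point is the interchange of sum and integral, because alternating signs exclude an
  argument by positivity. Power bounds for csch give absolute convergence on the whole half-line.
  The substitution preserves integrals of absolute values, so the new integrand is integrable as
  well; this later settles the expansion in powers of k, whose terms are nonnegative.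

  A Riemann sum for the integral of sech supplies the limit at t = 0 on which the inversion rests,
  in place of Poisson summation. The theta identities are obtained for real q only; analytic
  continuation carries the one for g to the disk, where Taylor coefficients can be read off.\<close>

lemma has_sum_prod_real:
  fixes f :: "'a \<Rightarrow> real" and g :: "'b \<Rightarrow> real"
  assumes f: "(f has_sum u) A" and g: "(g has_sum v) B"
  shows "((\<lambda>(x,y). f x * g y) has_sum (u * v)) (A \<times> B)"
proof (rule has_sum_SigmaI)
  show "((\<lambda>y. (case (x, y) of (x, y) \<Rightarrow> f x * g y)) has_sum f x * v) B" for x
    using has_sum_cmult_right[OF g, of "f x"] by simp
  show "((\<lambda>x. f x * v) has_sum u * v) A" by (rule has_sum_cmult_left[OF f])
  have nf: "(\<lambda>x. norm (f x)) summable_on A" and ng: "(\<lambda>x. norm (g x)) summable_on B"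
    using f g by (metis has_sum_imp_summable summable_on_iff_abs_summable_on_real)+
  have "(\<lambda>p. norm ((\<lambda>(x,y). f x * g y) p)) summable_on A \<times> B"
  proof (rule summable_on_SigmaI)
    show "((\<lambda>y. norm (case (x, y) of (x, y) \<Rightarrow> f x * g y)) has_sum norm (f x) * infsum (\<lambda>y. norm (g y)) B) B" for x
      using has_sum_cmult_right[OF has_sum_infsum[OF ng], of "norm (f x)"] by (simp add: abs_mult)
    show "(\<lambda>x. norm (f x) * infsum (\<lambda>y. norm (g y)) B) summable_on A"
      by (intro summable_on_cmult_left nf)
  qed auto
  thus "(\<lambda>(x,y). f x * g y) summable_on A \<times> B"
    by (rule abs_summable_summable)
qed

text \<open>The negative integers are indexed by \<open>-1 - int n\<close>, the map that also
  realises the change of sign of n + 1/2.\<close>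

lemma has_sum_int_split:
  fixes f :: "int \<Rightarrow> 'a::real_normed_vector"
  assumes "((\<lambda>n. f (int n)) has_sum x) UNIV" "((\<lambda>n. f (-1 - int n)) has_sum y) UNIV"
  shows "(f has_sum (x + y)) UNIV"
proof -
  have "(f has_sum x) {0..}"
    using assms(1) by (subst (asm) has_sum_reindex_bij_witness[where i = nat and j = int and T = "{0..}" and h = f and s' = x]) auto
  moreover have "(f has_sum y) {..<0}"
    using assms(2) by (subst (asm) has_sum_reindex_bij_witness
      [where i = "\<lambda>n. nat (-1 - n)" and j = "\<lambda>n. -1 - int n" and T = "{..<0}" and h = f and s' = y]) auto
  moreover have "{0..} \<union> {..<0} = (UNIV :: int set)" by auto
  ultimately show ?thesis using has_sum_Un_disjoint[where f = f and A = "{0..}" and B = "{..<0}" and a = x and b = y] by fastforce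
qed

lemma summable_on_int_halves:
  fixes f :: "int \<Rightarrow> real"
  assumes "f summable_on UNIV"
  shows "(\<lambda>n. f (int n)) summable_on UNIV" "(\<lambda>n. f (-1 - int n)) summable_on UNIV"
    "(\<lambda>n. f (int (Suc n))) summable_on UNIV"
proof -
  have *: "(\<lambda>n. f (h n)) summable_on UNIV" if "inj h" for h :: "nat \<Rightarrow> int"
    using summable_on_subset_banach[OF assms, of "range h"] summable_on_reindex[OF that, of f]
    by (simp add: o_def)
  show "(\<lambda>n. f (int n)) summable_on UNIV" "(\<lambda>n. f (-1 - int n)) summable_on UNIV"
    "(\<lambda>n. f (int (Suc n))) summable_on UNIV"
    by (intro *; auto simp: inj_def)+
qed

lemma has_sum_int_reflectD:
  fixes f :: "int \<Rightarrow> real"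
  assumes f: "(f has_sum S) UNIV" and sym: "\<And>n. f (-1 - n) = f n"
  shows "((\<lambda>n. f (int n)) has_sum (S/2)) UNIV"
proof -
  obtain s where s: "((\<lambda>n. f (int n)) has_sum s) UNIV"
    using summable_on_int_halves(1)[OF has_sum_imp_summable[OF f]] by (auto simp: summable_on_def)
  have "(f has_sum (s + s)) UNIV"
    by (rule has_sum_int_split[OF s]) (use s sym in simp)
  with f have "S = s + s" by (rule has_sum_unique)
  with s show ?thesis by simp
qed

lemma has_sum_nat_Suc:
  fixes f :: "nat \<Rightarrow> 'a::real_normed_vector"
  assumes "((\<lambda>n. f (Suc n)) has_sum s) UNIV"
  shows "(f has_sum (f 0 + s)) UNIV"
proof -
  have "(f has_sum s) {0<..}"
    using assms by (subst (asm) has_sum_reindex_bij_witness[where i = "\<lambda>n. n - 1" and j = Suc and T = "{0<..}" and h = f and s' = s]) auto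
  hence "(f has_sum (f 0 + s)) (insert 0 {0<..})" by (intro has_sum_insert) auto
  moreover have "insert 0 {0<..} = (UNIV :: nat set)" by auto
  ultimately show ?thesis by simp
qed

lemma has_sum_int_evenD:
  fixes f :: "int \<Rightarrow> real"
  assumes f: "(f has_sum S) UNIV" and sym: "\<And>n. f (- n) = f n"
  shows "((\<lambda>n. f (int (Suc n))) has_sum ((S - f 0)/2)) UNIV"
proof -
  obtain s where s: "((\<lambda>n. f (int (Suc n))) has_sum s) UNIV"
    using summable_on_int_halves(3)[OF has_sum_imp_summable[OF f]] by (auto simp: summable_on_def)
  have "((\<lambda>n. f (-1 - int n)) has_sum s) UNIV"
  proof -
    have "f (-1 - int n) = f (int (Suc n))" for n using sym[of "int (Suc n)"] by (simp add: algebra_simps)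
    with s show ?thesis by simp
  qed
  moreover have "((\<lambda>n. f (int n)) has_sum (f 0 + s)) UNIV"
    using has_sum_nat_Suc[OF s] by simp
  ultimately have "(f has_sum (f 0 + s + s)) UNIV" by (intro has_sum_int_split)
  with f have "S = f 0 + s + s" by (rule has_sum_unique)
  with s show ?thesis by simp
qed

lemma has_sum_int_evenI:
  fixes f :: "int \<Rightarrow> real"
  assumes s: "((\<lambda>n. f (int (Suc n))) has_sum s) UNIV" and sym: "\<And>n. f (- n) = f n"
  shows "(f has_sum (f 0 + 2 * s)) UNIV"
proof -
  have "((\<lambda>n. f (-1 - int n)) has_sum s) UNIV"
  proof -
    have "f (-1 - int n) = f (int (Suc n))" for n using sym[of "int (Suc n)"] by (simp add: algebra_simps)
    with s show ?thesis by simp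
  qed
  moreover have "((\<lambda>n. f (int n)) has_sum (f 0 + s)) UNIV"
    using has_sum_nat_Suc[OF s] by simp
  ultimately have "(f has_sum (f 0 + s + s)) UNIV" by (intro has_sum_int_split)
  thus ?thesis by (simp add: algebra_simps)
qed

text \<open>Reindexing by the reflection turns the sum S into -S. The centre c/2 is left free
  because sums over n + 1/2 are reflected with c = -1.\<close>

lemma has_sum_int_oddI:
  fixes f :: "int \<Rightarrow> real"
  assumes f: "f summable_on UNIV" and sym: "\<And>n. f (c - n) = - f n"
  shows "(f has_sum 0) UNIV"
proof -
  obtain S where S: "(f has_sum S) UNIV" using f by (auto simp: summable_on_def)
  have "((\<lambda>n. - f n) has_sum S) UNIV"
    using S by (subst has_sum_reindex_bij_witness[where i = "\<lambda>n. c - n" and j = "\<lambda>n. c - n" and T = UNIV and h = f and s' = S]) (auto simp: sym)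
  moreover have "((\<lambda>n. - f n) has_sum (- S)) UNIV" using S by (rule has_sum_uminusI)
  ultimately have "S = - S" by (rule has_sum_unique)
  with S show ?thesis by simp
qed

lemma has_sum_int_shift:
  fixes f :: "int \<Rightarrow> 'a::{comm_monoid_add,topological_space}"
  shows "((\<lambda>n. f (n + d)) has_sum S) UNIV \<longleftrightarrow> (f has_sum S) UNIV"
  by (rule has_sum_reindex_bij_witness[where i = "\<lambda>n. n - d" and j = "\<lambda>n. n + d"]) auto

text \<open>Summability is a separate assumption: the limits at both ends fix the value, but they do
  not give unconditional convergence.\<close>

lemma has_sum_int_telescope:
  fixes f :: "int \<Rightarrow> real"
  assumes sm: "(\<lambda>n. f (n + 1) - f n) summable_on UNIV"
    and u: "(\<lambda>n. f (int n)) \<longlonglongrightarrow> u" and l: "(\<lambda>n. f (- int n)) \<longlonglongrightarrow> l"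
  shows "((\<lambda>n. f (n + 1) - f n) has_sum (u - l)) UNIV"
proof -
  let ?g = "\<lambda>n. f (n + 1) - f n"
  note h = summable_on_int_halves[OF sm]
  have 1: "((\<lambda>n. ?g (int n)) has_sum (u - f 0)) UNIV"
  proof -
    have "(\<lambda>n. f (int (Suc n)) - f (int n)) sums (u - f (int 0))"
      by (rule telescope_sums[OF u])
    hence "(\<lambda>n. ?g (int n)) sums (u - f 0)" by (simp add: add.commute)
    with h(1) show ?thesis
      by (metis has_sum_imp_sums has_sum_infsum sums_unique2)
  qed
  have 2: "((\<lambda>n. ?g (-1 - int n)) has_sum (f 0 - l)) UNIV"
  proof -
    have "(\<lambda>n. f (- int n) - f (- int (Suc n))) sums (f (- int 0) - l)"
      by (rule telescope_sums'[OF l])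
    hence "(\<lambda>n. ?g (-1 - int n)) sums (f 0 - l)" by (simp add: algebra_simps)
    with h(2) show ?thesis
      by (metis has_sum_imp_sums has_sum_infsum sums_unique2)
  qed
  show ?thesis using has_sum_int_split[OF 1 2] by simp
qed

lemma has_sum_exp_nat:
  assumes "a > 0" shows "((\<lambda>n. exp (- a * real n)) has_sum (1 / (1 - exp (-a)))) UNIV"
proof -
  have "((\<lambda>n. exp (-a) ^ n) has_sum (1 / (1 - exp (-a)))) UNIV"
    by (rule norm_summable_imp_has_sum) (use assms in \<open>auto intro!: geometric_sums summable_geometric\<close>)
  thus ?thesis by (simp add: exp_of_nat_mult mult.commute flip: exp_of_nat_mult)
qed

lemma summable_exp_int:
  assumes "a > 0" shows "(\<lambda>n. exp (- a * \<bar>real_of_int n\<bar>)) summable_on UNIV"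
proof -
  let ?f = "\<lambda>n. exp (- a * \<bar>real_of_int n\<bar>)"
  have 1: "((\<lambda>n. ?f (int n)) has_sum (1 / (1 - exp (-a)))) UNIV"
    using has_sum_exp_nat[OF assms] by simp
  have 2: "((\<lambda>n. ?f (-1 - int n)) has_sum (exp (-a) * (1 / (1 - exp (-a))))) UNIV"
  proof -
    have "?f (-1 - int n) = exp (-a) * exp (- a * real n)" for n
    proof -
      have "\<bar>real_of_int (-1 - int n)\<bar> = 1 + real n" by simp
      thus ?thesis by (simp add: algebra_simps flip: exp_add)
    qed
    thus ?thesis using has_sum_cmult_right[OF has_sum_exp_nat[OF assms]] by simp
  qed
  show ?thesis using has_sum_int_split[OF 1 2] by (rule has_sum_imp_summable)
qed

section \<open>Convolutions of hyperbolic secants\<close>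

definition sech :: "real \<Rightarrow> real" where "sech x = inverse (cosh x)"
definition csch :: "real \<Rightarrow> real" where "csch x = inverse (sinh x)"

lemma sech_pos [simp]: "sech x > 0" by (simp add: sech_def)
lemma sech_minus [simp]: "sech (- x) = sech x" by (simp add: sech_def)
lemma csch_minus [simp]: "csch (- x) = - csch x" by (simp add: csch_def)
lemma sech_le_1: "sech x \<le> 1" using cosh_real_ge_1[of x] by (simp add: sech_def divide_simps)

lemma sech_le_exp: "sech x \<le> 2 * exp (- \<bar>x\<bar>)"
proof -
  have "exp \<bar>x\<bar> \<le> 2 * cosh x" by (cases "x \<ge> 0") (auto simp: cosh_def)
  moreover have "exp \<bar>x\<bar> > 0" by simp
  ultimately have "inverse (2 * cosh x) \<le> inverse (exp \<bar>x\<bar>)" by (intro le_imp_inverse_le)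
  thus ?thesis by (simp add: sech_def exp_minus field_simps)
qed

lemma sech_le_exp_shift:
  assumes "a > 0"
  shows "sech (a * (real_of_int n + x)) \<le> 2 * exp (a * \<bar>x\<bar>) * exp (- a * \<bar>real_of_int n\<bar>)"
proof -
  have "\<bar>real_of_int n\<bar> \<le> \<bar>x\<bar> + \<bar>real_of_int n + x\<bar>" by linarith
  hence "a * \<bar>real_of_int n\<bar> \<le> a * \<bar>x\<bar> + a * \<bar>real_of_int n + x\<bar>"
    using assms by (metis distrib_left mult_le_cancel_left_pos)
  hence "exp (- \<bar>a * (real_of_int n + x)\<bar>) \<le> exp (a * \<bar>x\<bar> + - a * \<bar>real_of_int n\<bar>)"
    using assms by (simp add: abs_mult)
  hence "2 * exp (- \<bar>a * (real_of_int n + x)\<bar>) \<le> 2 * exp (a * \<bar>x\<bar>) * exp (- a * \<bar>real_of_int n\<bar>)"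
    unfolding exp_add by simp
  with sech_le_exp[of "a * (real_of_int n + x)"] show ?thesis by (rule order_trans)
qed

text \<open>Periodisation of sech(a x) with period 1 in x. For a = pi t the shift x = 0 will give
  theta_3^2 and x = 1/2 will give theta_2^2.\<close>

definition Psech :: "real \<Rightarrow> real \<Rightarrow> real" where
  "Psech a x = (\<Sum>\<^sub>\<infinity>n::int. sech (a * (real_of_int n + x)))"
definition Psech2 :: "real \<Rightarrow> real \<Rightarrow> real" where
  "Psech2 a x = (\<Sum>\<^sub>\<infinity>n::int. sech (a * (real_of_int n + x)) ^ 2)"
definition Psech3 :: "real \<Rightarrow> real \<Rightarrow> real" where
  "Psech3 a x = (\<Sum>\<^sub>\<infinity>n::int. sech (a * (real_of_int n + x)) ^ 3)"

lemma summable_sech_bounded: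
  fixes h :: "int \<Rightarrow> real"
  assumes a: "a > 0" and h: "\<And>n. \<bar>h n\<bar> \<le> C * sech (a * (real_of_int n + x))" and C: "C \<ge> 0"
  shows "h summable_on UNIV"
proof (rule abs_summable_summable, rule Infinite_Sum.abs_summable_on_comparison_test')
  show "(\<lambda>n. C * (2 * exp (a * \<bar>x\<bar>)) * exp (- a * \<bar>real_of_int n\<bar>)) summable_on UNIV"
    by (intro summable_on_cmult_right summable_exp_int a)
  show "norm (h n) \<le> C * (2 * exp (a * \<bar>x\<bar>)) * exp (- a * \<bar>real_of_int n\<bar>)" for n
  proof -
    have "norm (h n) \<le> C * sech (a * (real_of_int n + x))" using h by simp
    also have "\<dots> \<le> C * (2 * exp (a * \<bar>x\<bar>) * exp (- a * \<bar>real_of_int n\<bar>))"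
      by (intro mult_left_mono sech_le_exp_shift a C)
    finally show ?thesis by (simp add: mult.assoc)
  qed
qed

lemma sech_pow_le: "sech x ^ Suc k \<le> sech x"
  using power_decreasing[of 1 "Suc k" "sech x"] sech_le_1[of x] sech_pos[of x] by (simp add: less_imp_le)

lemma has_sum_Psech:
  assumes "a > 0" shows "((\<lambda>n. sech (a * (real_of_int n + x))) has_sum Psech a x) UNIV"
  unfolding Psech_def
  by (rule has_sum_infsum, rule summable_sech_bounded[OF assms, where C = 1 and x = x]) (auto simp: less_imp_le abs_of_pos)

lemma has_sum_Psech2:
  assumes "a > 0" shows "((\<lambda>n. sech (a * (real_of_int n + x)) ^ 2) has_sum Psech2 a x) UNIV"
  unfolding Psech2_def
  by (rule has_sum_infsum, rule summable_sech_bounded[OF assms, where C = 1 and x = x])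
    (use sech_pow_le[of _ 1] in \<open>auto simp: less_imp_le abs_of_pos numeral_2_eq_2\<close>)

lemma has_sum_Psech3:
  assumes "a > 0" shows "((\<lambda>n. sech (a * (real_of_int n + x)) ^ 3) has_sum Psech3 a x) UNIV"
  unfolding Psech3_def
  by (rule has_sum_infsum, rule summable_sech_bounded[OF assms, where C = 1 and x = x])
    (use sech_pow_le[of _ 2] in \<open>auto simp: less_imp_le abs_of_pos numeral_3_eq_3 numeral_2_eq_2\<close>)

lemma sinh_diff_sech: "sinh (y - x) * (sech x * sech y) = tanh y - tanh (x::real)"
  by (simp add: sech_def tanh_def sinh_diff field_simps)

lemma summable_tanh_diff:
  assumes "a > 0"
  shows "(\<lambda>n. tanh (a * (real_of_int n + x)) - tanh (a * (real_of_int n + y))) summable_on UNIV"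
proof (rule summable_sech_bounded[OF assms, where C = "\<bar>sinh (a * (x - y))\<bar>" and x = y])
  fix n
  have e: "a * (real_of_int n + x) - a * (real_of_int n + y) = a * (x - y)" by (simp add: algebra_simps)
  show "\<bar>tanh (a * (real_of_int n + x)) - tanh (a * (real_of_int n + y))\<bar>
     \<le> \<bar>sinh (a * (x - y))\<bar> * sech (a * (real_of_int n + y))"
    unfolding sinh_diff_sech[symmetric] e abs_mult
    using sech_le_1[of "a * (real_of_int n + x)"] by (intro mult_left_mono) (auto simp: abs_of_pos mult_left_le)
qed simp

text \<open>Along the integers tanh rises from -1 to 1, so a shift by a full period contributes
  2.\<close>

lemma tanh_telescope:
  assumes "a > 0"
  shows "((\<lambda>n. tanh (a * (real_of_int n + (x + 1))) - tanh (a * (real_of_int n + x))) has_sum 2) UNIV"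
proof -
  let ?f = "\<lambda>n::int. tanh (a * (real_of_int n + x))"
  have u: "(\<lambda>n. ?f (int n)) \<longlonglongrightarrow> 1"
    by (rule filterlim_compose[OF tanh_real_at_top]) (use assms in real_asymp)
  have l: "(\<lambda>n. ?f (- int n)) \<longlonglongrightarrow> -1"
    by (rule filterlim_compose[OF tanh_real_at_bot]) (use assms in real_asymp)
  have "(\<lambda>n. ?f (n + 1) - ?f n) summable_on UNIV"
    using summable_tanh_diff[OF assms, of "x + 1" x] by (simp add: algebra_simps)
  from has_sum_int_telescope[OF this u l] show ?thesis by (simp add: algebra_simps)
qed

text \<open>Full periods account for steps of 2 in j. For j = 1, the reflection n to -n gives the
  negative of the unknown sum S for the shift by -1/2; one full period leads from there to 1/2, so S
  = 2 - S.\<close>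

lemma tanh_telescope_half_nat:
  assumes a: "a > 0"
  shows "((\<lambda>n. tanh (a * (real_of_int n + real j / 2)) - tanh (a * real_of_int n)) has_sum real j) UNIV"
proof (induction j rule: induct_nat_012)
  case 0 show ?case by simp
next
  case 1
  let ?D = "\<lambda>y n. tanh (a * (real_of_int n + y)) - tanh (a * real_of_int n)"
  obtain S where S: "(?D (1/2) has_sum S) UNIV"
    using summable_tanh_diff[OF a, of "1/2" 0] by (auto simp: summable_on_def)
  have e: "- ?D (1/2) n = ?D (- (1/2)) (- n)" for n
  proof -
    have "a * (real_of_int (- n) + - (1/2)) = - (a * (real_of_int n + 1/2))" by (simp add: algebra_simps)
    thus ?thesis by (simp del: of_int_minus add: tanh_minus) (simp add: tanh_minus)
  qed
  have "((\<lambda>n. - ?D (1/2) n) has_sum - S) UNIV" using S by (rule has_sum_uminusI)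
  hence M: "(?D (- (1/2)) has_sum - S) UNIV"
    by (subst has_sum_reindex_bij_witness[where i = uminus and j = uminus and T = UNIV
          and h = "\<lambda>n. - ?D (1/2) n" and s' = "-S"]) (auto simp only: e minus_minus UNIV_I)
  have "((\<lambda>n. ?D (- (1/2)) n + (tanh (a * (real_of_int n + (- (1/2) + 1))) - tanh (a * (real_of_int n + - (1/2)))))
         has_sum (- S + 2)) UNIV" by (intro has_sum_add M tanh_telescope a)
  hence "(?D (1/2) has_sum (- S + 2)) UNIV" by simp
  with S have "S = - S + 2" by (rule has_sum_unique)
  hence "S = 1" by simp
  with S show ?case by simp
next
  case (ge2 j)
  let ?x = "real j / 2"
  have "((\<lambda>n. (tanh (a * (real_of_int n + ?x)) - tanh (a * real_of_int n)) +
     (tanh (a * (real_of_int n + (?x + 1))) - tanh (a * (real_of_int n + ?x)))) has_sum (real j + 2)) UNIV"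
    by (intro has_sum_add ge2 tanh_telescope a)
  thus ?case by (simp add: algebra_simps add_divide_distrib)
qed

lemma tanh_telescope_half:
  assumes a: "a > 0" and j: "2 * y = real_of_int j"
  shows "((\<lambda>n. tanh (a * (real_of_int n + y)) - tanh (a * real_of_int n)) has_sum 2 * y) UNIV"
proof (cases "j \<ge> 0")
  case True
  hence "y = real (nat j) / 2" using j by simp
  thus ?thesis using tanh_telescope_half_nat[OF a, of "nat j"] by (metis mult.commute nonzero_mult_div_cancel_right times_divide_eq_right zero_neq_numeral)
next
  case False
  let ?D = "\<lambda>y n. tanh (a * (real_of_int n + y)) - tanh (a * real_of_int n)"
  have y: "- y = real (nat (- j)) / 2" using j False by simp
  have e: "?D y n = - ?D (- y) (- n)" for n
  proof -
    have "a * (real_of_int (- n) + - y) = - (a * (real_of_int n + y))" by (simp add: algebra_simps)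
    thus ?thesis by (simp del: of_int_minus add: tanh_minus) (simp add: tanh_minus)
  qed
  have "(?D (- y) has_sum (2 * (- y))) UNIV"
    using tanh_telescope_half_nat[OF a, of "nat (- j)"] unfolding y by simp
  hence "((\<lambda>n. - ?D (- y) n) has_sum (- (2 * (- y)))) UNIV" by (rule has_sum_uminusI)
  thus ?thesis
    by (subst has_sum_reindex_bij_witness[where i = uminus and j = uminus and T = UNIV
          and h = "\<lambda>n. - ?D (- y) n" and s' = "- (2 * (- y))"]) (auto simp: e)
qed

text \<open>Dividing \<open>sinh_diff_sech\<close> by sinh(ac) makes the product a difference of two
  tanh. Both arguments are half-integral shifts of the lattice, so each tanh is summed relative to
  the unshifted one; the results differ by 2c.\<close>

lemma sech_correlation:
  assumes a: "a > 0" and x: "2 * x = real_of_int i" and c: "2 * c = real_of_int j" "c \<noteq> 0"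
  shows "((\<lambda>n. sech (a * (real_of_int n + x)) * sech (a * (real_of_int n + x + c))) has_sum (2 * c * csch (a * c))) UNIV"
proof -
  have "((\<lambda>n. (tanh (a * (real_of_int n + (x + c))) - tanh (a * real_of_int n))
     + - (tanh (a * (real_of_int n + x)) - tanh (a * real_of_int n))) has_sum (2 * (x + c) + - (2 * x))) UNIV"
    by (intro has_sum_add has_sum_uminusI tanh_telescope_half[OF a, of _ "i + j"] tanh_telescope_half[OF a x])
      (use x c in simp)
  hence "((\<lambda>n. csch (a * c) * (tanh (a * (real_of_int n + x + c)) - tanh (a * (real_of_int n + x))))
     has_sum (csch (a * c) * (2 * c))) UNIV"
    by (intro has_sum_cmult_right) (simp add: algebra_simps)
  moreover have "csch (a * c) * (tanh (a * (real_of_int n + x + c)) - tanh (a * (real_of_int n + x)))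
     = sech (a * (real_of_int n + x)) * sech (a * (real_of_int n + x + c))" for n
  proof -
    have e: "a * (real_of_int n + x + c) - a * (real_of_int n + x) = a * c" by (simp add: algebra_simps)
    show ?thesis unfolding sinh_diff_sech[symmetric] e
      using a c(2) by (simp add: csch_def)
  qed
  ultimately show ?thesis by (simp add: mult_ac)
qed

text \<open>The double sum is grouped by the difference d of the two indices. Each group is a
  correlation at distance d + (y - x); distance zero leaves a sum of squared secants
  instead.\<close>

lemma Psech_mult:
  assumes a: "a > 0" and x: "2 * x = real_of_int i" and y: "2 * y = real_of_int j"
  shows "((\<lambda>d. if real_of_int d + (y - x) = 0 then Psech2 a x
            else 2 * (real_of_int d + (y - x)) * csch (a * (real_of_int d + (y - x))))
      has_sum (Psech a x * Psech a y)) UNIV"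
proof -
  let ?s = "\<lambda>x n. sech (a * (real_of_int n + x))"
  have "((\<lambda>(n,m). ?s x n * ?s y m) has_sum (Psech a x * Psech a y)) (UNIV \<times> UNIV)"
    by (intro has_sum_prod_real has_sum_Psech a)
  hence "((\<lambda>(d,n). ?s x n * ?s y (n + d)) has_sum (Psech a x * Psech a y)) (UNIV \<times> UNIV)"
    by (subst (asm) has_sum_reindex_bij_witness[where i = "\<lambda>(d,n). (n, n + d)" and j = "\<lambda>(n,m). (m - n, n)"
       and T = "UNIV \<times> UNIV" and h = "\<lambda>(d,n). ?s x n * ?s y (n + d)" and s' = "Psech a x * Psech a y"]) auto
  thus ?thesis
  proof (rule has_sum_SigmaD)
    fix d :: int
    let ?c = "real_of_int d + (y - x)"
    have e: "a * (real_of_int (n + d) + y) = a * (real_of_int n + x + ?c)" for n by (simp add: algebra_simps)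
    show "((\<lambda>n. case (d, n) of (d, n) \<Rightarrow> ?s x n * ?s y (n + d)) has_sum
        (if ?c = 0 then Psech2 a x else 2 * ?c * csch (a * ?c))) UNIV"
    proof (cases "?c = 0")
      case True
      thus ?thesis using has_sum_Psech2[OF a, of x] unfolding prod.case e by (simp add: power2_eq_square)
    next
      case False
      have "2 * ?c = real_of_int (2 * d + (j - i))" using x y by simp
      from sech_correlation[OF a x this False] False show ?thesis unfolding prod.case e by simp
    qed
  qed
qed

section \<open>Lambert series\<close>

lemma has_sum_int_parity:
  fixes f :: "int \<Rightarrow> 'a::real_normed_vector"
  assumes "((\<lambda>n. f (2 * n)) has_sum x) UNIV" "((\<lambda>n. f (2 * n + 1)) has_sum y) UNIV"
  shows "(f has_sum (x + y)) UNIV"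
proof -
  have "(f has_sum x) {n. even n}"
    using assms(1) by (subst (asm) has_sum_reindex_bij_witness
       [where i = "\<lambda>n. n div 2" and j = "\<lambda>n. 2 * n" and T = "{n. even n}" and h = f and s' = x]) auto
  moreover have "(f has_sum y) {n. odd n}"
    using assms(2) by (subst (asm) has_sum_reindex_bij_witness
       [where i = "\<lambda>n. n div 2" and j = "\<lambda>n. 2 * n + 1" and T = "{n. odd n}" and h = f and s' = y]) auto
  moreover have "{n. even n} \<union> {n. odd n} = (UNIV :: int set)" by auto
  ultimately show ?thesis
    using has_sum_Un_disjoint[where f = f and A = "{n. even n}" and B = "{n. odd n}" and a = x and b = y] by fastforce
qed

text \<open>The total S may be known for either order of summation; the disjunction lets the lemma
  carry it from rows to columns or back.\<close>

lemma has_sum_fubini: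
  fixes f :: "'a \<Rightarrow> 'b \<Rightarrow> real"
  assumes N: "\<And>x. x \<in> A \<Longrightarrow> ((\<lambda>y. \<bar>f x y\<bar>) has_sum N x) B" "N summable_on A"
    and r: "\<And>x. x \<in> A \<Longrightarrow> ((\<lambda>y. f x y) has_sum r x) B"
    and c: "\<And>y. y \<in> B \<Longrightarrow> ((\<lambda>x. f x y) has_sum c y) A"
    and S: "(r has_sum S) A \<or> (c has_sum S) B"
  shows "(r has_sum S) A \<and> (c has_sum S) B \<and> ((\<lambda>(x,y). f x y) has_sum S) (A \<times> B)"
proof -
  have "(\<lambda>p. norm ((\<lambda>(x,y). f x y) p)) summable_on A \<times> B"
    by (rule summable_on_SigmaI[where g = N]) (use N in auto)
  hence "(\<lambda>(x,y). f x y) summable_on A \<times> B" by (rule abs_summable_summable)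
  then obtain S' where S': "((\<lambda>(x,y). f x y) has_sum S') (A \<times> B)" by (auto simp: summable_on_def)
  have "(r has_sum S') A" using S' by (rule has_sum_SigmaD) (use r in simp)
  moreover have "((\<lambda>(y,x). f x y) has_sum S') (B \<times> A)"
    using S' by (subst (asm) has_sum_swap) simp
  hence "(c has_sum S') B" by (rule has_sum_SigmaD) (use c in simp)
  ultimately have *: "(r has_sum S') A" "(c has_sum S') B" by auto
  moreover have "S = S'" using S has_sum_unique[OF *(1)] has_sum_unique[OF *(2)] by metis
  ultimately have "(r has_sum S') A \<and> (c has_sum S') B" "S = S'" by auto
  with S' show ?thesis by simp
qed

section \<open>Exponential expansions of the hyperbolic functions\<close>

text \<open>The coefficients satisfy (2n+1)^2 = 8 C(n+2,2) - 8 (n+1) + 1, and the three generating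
  functions are powers of 1/(1-w). The cube arises as the Cauchy product of the other two.\<close>

lemma has_sum_triangular_geometric:
  fixes w :: real
  assumes "\<bar>w\<bar> < 1"
  shows "((\<lambda>n. (2 * real n + 1)\<^sup>2 * w ^ n) has_sum (8 / (1 - w) ^ 3 - 8 / (1 - w)\<^sup>2 + 1 / (1 - w))) UNIV"
proof -
  have tri: "(\<lambda>n. (real n + 1) * (real n + 2) / 2 * w ^ n) sums (1 / (1 - w) ^ 3)"
    if w: "\<bar>w\<bar> < 1" for w :: real
  proof -
    have s1: "(\<lambda>n. (real n + 1) * w ^ n) sums (1 / (1 - w)\<^sup>2)"
      using geometric_deriv_sums[of w] w by (simp add: add.commute)
    have s1': "summable (\<lambda>n. norm ((real n + 1) * w ^ n))"
      using geometric_deriv_sums[of "\<bar>w\<bar>"] w by (simp add: sums_iff abs_mult power_abs add.commute)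
    have s2: "(\<lambda>n. w ^ n) sums (1 / (1 - w))" using w by (intro geometric_sums) simp
    have s2': "summable (\<lambda>n. norm (w ^ n))" using w by (simp add: power_abs)
    have "(\<lambda>k. \<Sum>i\<le>k. (real i + 1) * w ^ i * w ^ (k - i)) sums (1 / (1 - w)\<^sup>2 * (1 / (1 - w)))"
      using Cauchy_product_sums[OF s1' s2'] s1 s2 by (simp add: sums_iff)
    moreover have "(\<Sum>i\<le>k. (real i + 1) * w ^ i * w ^ (k - i)) = (real k + 1) * (real k + 2) / 2 * w ^ k" for k
    proof -
      have "(\<Sum>i\<le>k. (real i + 1) * w ^ i * w ^ (k - i)) = (\<Sum>i\<le>k. (real i + 1)) * w ^ k"
        unfolding sum_distrib_right by (intro sum.cong) (auto simp: mult.assoc simp flip: power_add)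
      also have "(\<Sum>i\<le>k. (real i + 1)) = (real k + 1) * (real k + 2) / 2"
        by (induction k) (auto simp: field_simps)
      finally show ?thesis .
    qed
    ultimately show ?thesis by (simp add: power3_eq_cube power2_eq_square)
  qed
  have main: "(\<lambda>n. (2 * real n + 1)\<^sup>2 * w ^ n) sums (8 / (1 - w) ^ 3 - 8 / (1 - w)\<^sup>2 + 1 / (1 - w))"
    if w: "\<bar>w\<bar> < 1" for w :: real
  proof -
    have s1: "(\<lambda>n. (real n + 1) * w ^ n) sums (1 / (1 - w)\<^sup>2)"
      using geometric_deriv_sums[of w] w by (simp add: add.commute)
    have s2: "(\<lambda>n. w ^ n) sums (1 / (1 - w))" using w by (intro geometric_sums) simp
    have "(\<lambda>n. 8 * ((real n + 1) * (real n + 2) / 2 * w ^ n) - 8 * ((real n + 1) * w ^ n) + w ^ n)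
       sums (8 * (1 / (1 - w) ^ 3) - 8 * (1 / (1 - w)\<^sup>2) + 1 / (1 - w))"
      by (intro sums_add sums_diff sums_mult tri w s1 s2)
    moreover have "8 * ((real n + 1) * (real n + 2) / 2 * w ^ n) - 8 * ((real n + 1) * w ^ n) + w ^ n = (2 * real n + 1)\<^sup>2 * w ^ n" for n
      by (simp add: field_simps power2_eq_square)
    ultimately show ?thesis by simp
  qed
  have "summable (\<lambda>n. norm ((2 * real n + 1)\<^sup>2 * w ^ n))"
    using main[of "\<bar>w\<bar>"] assms by (simp add: sums_iff abs_mult power_abs)
  with main[OF assms] show ?thesis by (rule norm_summable_imp_has_sum[rotated])
qed

lemma exp_odd_eq: "exp (- ((2 * real n + 1) * y)) = exp (- y) * exp (- 2 * y) ^ n"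
  by (simp add: algebra_simps flip: exp_add exp_of_nat_mult)

lemma csch_has_sum:
  assumes "y > 0" shows "((\<lambda>n. exp (- ((2 * real n + 1) * y))) has_sum (csch y / 2)) UNIV"
proof -
  have *: "exp (- 2 * y) < 1" using assms by simp
  have "((\<lambda>n. exp (- 2 * y) ^ n) has_sum (1 / (1 - exp (- 2 * y)))) UNIV"
    by (rule norm_summable_imp_has_sum) (use * in \<open>auto intro!: geometric_sums summable_geometric\<close>)
  hence "((\<lambda>n. exp (- y) * exp (- 2 * y) ^ n) has_sum (exp (- y) * (1 / (1 - exp (- 2 * y))))) UNIV"
    by (rule has_sum_cmult_right)
  also have "exp (- y) * (1 / (1 - exp (- 2 * y))) = csch y / 2"
  proof -
    have "exp (- 2 * y) = exp (- y) * exp (- y)" by (simp flip: exp_add)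
    moreover have "exp (- y) < 1" using assms by simp
    hence "exp (- y) * exp (- y) < 1" by (smt (verit) exp_gt_zero mult_less_cancel_left2 mult_le_cancel_left1)
    moreover have "exp y = 1 / exp (- y)" by (simp add: exp_minus inverse_eq_divide)
    moreover have "sinh y = (1 - exp (- y) * exp (- y)) / (2 * exp (- y))"
      using \<open>exp y = 1 / exp (- y)\<close> by (simp add: sinh_def diff_divide_distrib)
    moreover have "1 - exp (- y) * exp (- y) \<noteq> 0" using \<open>exp (- y) * exp (- y) < 1\<close> by simp
    moreover have "exp (- 2 * y) = exp (- y) * exp (- y)" by fact
    ultimately show ?thesis by (simp only: csch_def) (simp add: field_simps)
  qed
  finally show ?thesis unfolding exp_odd_eq .
qed

text \<open>All are geometric series, or their derivatives, in z^2 with z = exp(-y), where sech y =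
  2z/(1+z^2). The second sum is half of sech'' = sech - 2 sech^3; the third records absolute
  convergence for later interchanges.\<close>

lemma sech_has_sum:
  assumes "y > 0"
  shows "((\<lambda>n. (-1) ^ n * exp (- ((2 * real n + 1) * y))) has_sum (sech y / 2)) UNIV" (is ?A)
    and "((\<lambda>n. (-1) ^ n * (2 * real n + 1)\<^sup>2 * exp (- ((2 * real n + 1) * y)))
          has_sum ((sech y - 2 * sech y ^ 3) / 2)) UNIV" (is ?B)
    and "(\<lambda>n. (2 * real n + 1)\<^sup>2 * exp (- ((2 * real n + 1) * y))) summable_on UNIV"
    and "((\<lambda>n. 4 * (-1) ^ n * (real n + 1) * exp (- (2 * (real n + 1) * y))) has_sum (sech y ^ 2)) UNIV" (is ?C)
proof -
  define z where "z = exp (- y)"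
  have z: "0 < z" "z < 1" using assms by (auto simp: z_def)
  have z2: "exp (- 2 * y) = z\<^sup>2" by (simp add: z_def power2_eq_square flip: exp_add)
  have z2': "z\<^sup>2 < 1" using z by (simp add: power_less_one_iff)
  hence w: "\<bar>- (z\<^sup>2)\<bar> < 1" by simp
  have se: "sech y = 2 * z / (1 + z\<^sup>2)"
  proof -
    have "exp y = 1 / z" by (simp add: exp_minus inverse_eq_divide z_def)
    hence "cosh y = (1 / z + z) / 2" by (simp add: cosh_def z_def)
    also have "\<dots> = (1 + z\<^sup>2) / (2 * z)" using z by (simp add: field_simps power2_eq_square)
    finally show ?thesis by (simp add: sech_def)
  qed
  have p: "(-1) ^ n * (z * (z\<^sup>2) ^ n) = z * (- (z\<^sup>2)) ^ n" for n
    by (simp add: power_minus[of "z\<^sup>2"])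
  have pos: "1 + z\<^sup>2 > 0" by (simp add: add_pos_nonneg)
  have "((\<lambda>n. z * (- (z\<^sup>2)) ^ n) has_sum (z * (1 / (1 - - (z\<^sup>2))))) UNIV"
    by (intro has_sum_cmult_right norm_summable_imp_has_sum geometric_sums)
      (use w in \<open>auto simp: power_abs intro!: summable_geometric\<close>)
  moreover have "2 * z / (1 + z\<^sup>2) / 2 = z * (1 / (1 - - (z\<^sup>2)))"
    using mult_divide_mult_cancel_left[of 2 z "1 + z\<^sup>2"] by (simp add: distrib_left mult.commute)
  ultimately show ?A unfolding exp_odd_eq z2 z_def[symmetric] p se by (simp only:)
  have "((\<lambda>n. z * ((2 * real n + 1)\<^sup>2 * (- (z\<^sup>2)) ^ n)) has_sum
     (z * (8 / (1 - - (z\<^sup>2)) ^ 3 - 8 / (1 - - (z\<^sup>2))\<^sup>2 + 1 / (1 - - (z\<^sup>2))))) UNIV"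
    by (intro has_sum_cmult_right has_sum_triangular_geometric w)
  moreover have "z * (8 / (1 - - (z\<^sup>2)) ^ 3 - 8 / (1 - - (z\<^sup>2))\<^sup>2 + 1 / (1 - - (z\<^sup>2)))
    = (sech y - 2 * sech y ^ 3) / 2"
  proof -
    define v where "v = 1 + z\<^sup>2"
    have v: "v > 0" "z\<^sup>2 = v - 1" "z ^ 3 = z * (v - 1)" using pos by (auto simp: v_def power3_eq_cube power2_eq_square)
    have e: "1 - - (z\<^sup>2) = v" by (simp add: v_def)
    have "z * (8 / v ^ 3 - 8 / v\<^sup>2 + 1 / v) = (2 * z / v - 2 * (2 * z / v) ^ 3) / 2"
      unfolding power_divide power_mult_distrib v(3) using v(1)
      by (simp add: field_simps power2_eq_square power3_eq_cube)
    thus ?thesis unfolding se e v_def .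
  qed
  moreover have "(-1) ^ n * (2 * real n + 1)\<^sup>2 * (z * (z\<^sup>2) ^ n) = z * ((2 * real n + 1)\<^sup>2 * (- (z\<^sup>2)) ^ n)" for n
    using p[of n] by (metis (no_types, opaque_lifting) mult.commute mult.left_commute)
  ultimately show ?B unfolding exp_odd_eq z2 z_def[symmetric] by (simp only:)
  have "((\<lambda>n. z * ((2 * real n + 1)\<^sup>2 * (z\<^sup>2) ^ n)) has_sum
     (z * (8 / (1 - (z\<^sup>2)) ^ 3 - 8 / (1 - (z\<^sup>2))\<^sup>2 + 1 / (1 - (z\<^sup>2))))) UNIV"
    by (intro has_sum_cmult_right has_sum_triangular_geometric) (use w in simp)
  thus "(\<lambda>n. (2 * real n + 1)\<^sup>2 * exp (- ((2 * real n + 1) * y))) summable_on UNIV"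
    unfolding exp_odd_eq z2 z_def[symmetric] by (auto simp: summable_on_def mult_ac)
  have sm: "summable (\<lambda>n. norm ((real n + 1) * (- (z\<^sup>2)) ^ n))"
    using geometric_deriv_sums[of "z\<^sup>2"] z2' by (simp add: sums_iff abs_mult power_abs add.commute)
  have s1: "(\<lambda>n. (real n + 1) * (- (z\<^sup>2)) ^ n) sums (1 / (1 - - (z\<^sup>2))\<^sup>2)"
    using geometric_deriv_sums[of "- (z\<^sup>2)"] w by (simp add: add.commute)
  have "((\<lambda>n. 4 * z\<^sup>2 * ((real n + 1) * (- (z\<^sup>2)) ^ n)) has_sum (4 * z\<^sup>2 * (1 / (1 - - (z\<^sup>2))\<^sup>2))) UNIV"
    by (intro has_sum_cmult_right norm_summable_imp_has_sum s1 sm)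
  moreover have "4 * z\<^sup>2 * (1 / (1 - - (z\<^sup>2))\<^sup>2) = sech y ^ 2"
    by (simp add: se power_divide power_mult_distrib)
  moreover have "4 * z\<^sup>2 * ((real n + 1) * (- (z\<^sup>2)) ^ n) = 4 * (-1) ^ n * (real n + 1) * exp (- (2 * (real n + 1) * y))" for n
  proof -
    have "exp (- (2 * (real n + 1) * y)) = exp (- 2 * y) * exp (- 2 * y) ^ n"
      by (simp add: algebra_simps flip: exp_add exp_of_nat_mult)
    thus ?thesis unfolding z2 by (simp add: power_minus[of "z\<^sup>2"] mult_ac)
  qed
  ultimately show ?C by simp
qed

lemma csch_pos: "y > 0 \<Longrightarrow> csch y > 0" by (simp add: csch_def)

lemma csch_le_exp:
  assumes "0 < y0" "y0 \<le> y"
  shows "csch y \<le> 2 / (1 - exp (- 2 * y0)) * exp (- y)"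
proof -
  have "exp (-2 * y0) < 1" using assms by simp
  have "exp (- 2 * y) \<le> exp (- 2 * y0)" using assms by simp
  hence "1 - exp (- 2 * y) \<ge> 1 - exp (- 2 * y0)" by simp
  hence "exp y * (1 - exp (- 2 * y)) \<ge> exp y * (1 - exp (- 2 * y0))" by (intro mult_left_mono) auto
  also have "exp y * (1 - exp (- 2 * y)) = 2 * sinh y"
    by (simp add: sinh_def algebra_simps flip: exp_add)
  finally have "inverse (2 * sinh y) \<le> inverse (exp y * (1 - exp (- 2 * y0)))"
    using \<open>exp (-2 * y0) < 1\<close> by (intro le_imp_inverse_le) auto
  thus ?thesis by (simp add: csch_def exp_minus field_simps)
qed

lemma summable_csch:
  assumes "y > 0"
  shows "(\<lambda>n. (2 * real n + 1)\<^sup>2 * csch ((2 * real n + 1) * y)) summable_on UNIV"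
proof (rule summable_on_comparison_test)
  show "(\<lambda>n. 2 / (1 - exp (- 2 * y)) * ((2 * real n + 1)\<^sup>2 * exp (- ((2 * real n + 1) * y)))) summable_on UNIV"
    by (intro summable_on_cmult_right sech_has_sum(3) assms)
  fix n :: nat
  have "y \<le> (2 * real n + 1) * y" using assms by simp
  hence "(2 * real n + 1)\<^sup>2 * csch ((2 * real n + 1) * y) \<le> (2 * real n + 1)\<^sup>2 * (2 / (1 - exp (- 2 * y)) * exp (- ((2 * real n + 1) * y)))"
    using assms by (intro mult_left_mono csch_le_exp) auto
  thus "(2 * real n + 1)\<^sup>2 * csch ((2 * real n + 1) * y) \<le> 2 / (1 - exp (- 2 * y)) * ((2 * real n + 1)\<^sup>2 * exp (- ((2 * real n + 1) * y)))"
    by (simp add: mult_ac)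
  show "0 \<le> (2 * real n + 1)\<^sup>2 * csch ((2 * real n + 1) * y)" using assms
    by (intro mult_nonneg_nonneg less_imp_le[OF csch_pos]) auto
qed

lemma sech_reflect_half: "sech (a * (real_of_int (-1 - n) + 1/2)) = sech (a * (real_of_int n + 1/2))"
proof -
  have "a * (real_of_int (-1 - n) + 1/2) = - (a * (real_of_int n + 1/2))" by (simp add: algebra_simps)
  thus ?thesis by (simp only: sech_minus)
qed

section \<open>Landen relations and the Lambert series of theta_2^4\<close>

text \<open>The index is split by parity. For a = pi t the first identity is theta_3^2(q) =
  theta_3^2(q^2) + theta_2^2(q^2).\<close>

lemma Psech_double:
  assumes "a > 0"
  shows "Psech a 0 = Psech (2 * a) 0 + Psech (2 * a) (1/2)"
    and "Psech2 a 0 = Psech2 (2 * a) 0 + Psech2 (2 * a) (1/2)"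
proof -
  have a2: "2 * a > 0" using assms by simp
  have "((\<lambda>n. sech (a * (real_of_int n + 0))) has_sum (Psech (2 * a) 0 + Psech (2 * a) (1/2))) UNIV"
    by (rule has_sum_int_parity) (use has_sum_Psech[OF a2, of 0] has_sum_Psech[OF a2, of "1/2"] in
        \<open>simp_all add: algebra_simps\<close>)
  with has_sum_Psech[OF assms] show "Psech a 0 = Psech (2 * a) 0 + Psech (2 * a) (1/2)" by (rule has_sum_unique)
  have "((\<lambda>n. sech (a * (real_of_int n + 0)) ^ 2) has_sum (Psech2 (2 * a) 0 + Psech2 (2 * a) (1/2))) UNIV"
    by (rule has_sum_int_parity) (use has_sum_Psech2[OF a2, of 0] has_sum_Psech2[OF a2, of "1/2"] in
        \<open>simp_all add: algebra_simps\<close>)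
  with has_sum_Psech2[OF assms] show "Psech2 a 0 = Psech2 (2 * a) 0 + Psech2 (2 * a) (1/2)" by (rule has_sum_unique)
qed

text \<open>The differences d and -d contribute equally and d = 0 is moved to the right. The series
  does not depend on x, so the shifts 0 and 1/2 can be compared; this yields
  \<open>Psech_square_diff\<close>.\<close>

lemma Psech_square:
  assumes a: "a > 0" and x: "2 * x = real_of_int i"
  shows "((\<lambda>k. 4 * (real k + 1) * csch (a * (real k + 1))) has_sum (Psech a x ^ 2 - Psech2 a x)) UNIV"
proof -
  let ?f = "\<lambda>d. if real_of_int d = 0 then Psech2 a x else 2 * real_of_int d * csch (a * real_of_int d)"
  have "(?f has_sum (Psech a x ^ 2)) UNIV"
    using Psech_mult[OF a x x] by (simp only: diff_self add_0_right power2_eq_square)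
  hence "((\<lambda>n. ?f (int (Suc n))) has_sum ((Psech a x ^ 2 - ?f 0)/2)) UNIV"
    by (rule has_sum_int_evenD) auto
  hence "((\<lambda>n. 2 * ?f (int (Suc n))) has_sum (2 * ((Psech a x ^ 2 - ?f 0)/2))) UNIV"
    by (rule has_sum_cmult_right)
  moreover have "2 * ?f (int (Suc n)) = 4 * (real n + 1) * csch (a * (real n + 1))" for n by (simp add: algebra_simps)
  moreover have "2 * ((Psech a x ^ 2 - ?f 0)/2) = Psech a x ^ 2 - Psech2 a x" by simp
  ultimately show ?thesis by (simp only:)
qed

text \<open>Each sech^2 is expanded in exponentials and the sum over n + 1/2 is taken first, which
  gives csch. The half-integral shift matters: no argument vanishes, and the reflection accounts for
  the factor between n >= 0 and all integers.\<close>

lemma Psech2_half_lambert: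
  assumes a: "a > 0"
  shows "((\<lambda>k. 4 * (-1) ^ k * (real k + 1) * csch (a * (real k + 1))) has_sum Psech2 a (1/2)) UNIV"
proof -
  let ?f = "\<lambda>k n. 4 * (-1) ^ k * (real k + 1) * exp (- (2 * (real k + 1) * (a * (real n + 1/2))))"
  have e: "exp (- (2 * (real k + 1) * (a * (real n + 1/2)))) = exp (- ((2 * real n + 1) * (a * (real k + 1))))" for k n :: nat
    by (simp add: algebra_simps)
  have cs: "((\<lambda>n. exp (- (2 * (real k + 1) * (a * (real n + 1/2))))) has_sum (csch (a * (real k + 1)) / 2)) UNIV" for k
    unfolding e by (intro csch_has_sum) (use a in simp)
  have "((\<lambda>k. 4 * (-1) ^ k * (real k + 1) * (csch (a * (real k + 1)) / 2)) has_sum (Psech2 a (1/2) / 2)) UNIV \<and>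
    ((\<lambda>n. sech (a * (real n + 1/2)) ^ 2) has_sum (Psech2 a (1/2) / 2)) UNIV \<and>
    ((\<lambda>(k,n). ?f k n) has_sum (Psech2 a (1/2) / 2)) (UNIV \<times> UNIV)"
  proof (rule has_sum_fubini)
    show "((\<lambda>n. \<bar>?f k n\<bar>) has_sum 4 * (real k + 1) * (csch (a * (real k + 1)) / 2)) UNIV" for k
      using has_sum_cmult_right[OF cs[of k], of "4 * (real k + 1)"] by (simp add: abs_mult)
    show "(\<lambda>k. 4 * (real k + 1) * (csch (a * (real k + 1)) / 2)) summable_on UNIV"
      using summable_on_cmult_right[OF has_sum_imp_summable[OF Psech_square[OF a, of 0 0]], of "1/2"]
      by (simp add: mult_ac)
    show "((\<lambda>n. ?f k n) has_sum 4 * (-1) ^ k * (real k + 1) * (csch (a * (real k + 1)) / 2)) UNIV" for k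
      by (intro has_sum_cmult_right cs)
    show "((\<lambda>k. ?f k n) has_sum sech (a * (real n + 1/2)) ^ 2) UNIV" for n
      by (rule sech_has_sum(4)) (use a in simp)
    have "((\<lambda>n. sech (a * (real_of_int (int n) + 1/2)) ^ 2) has_sum (Psech2 a (1/2) / 2)) UNIV"
    proof (rule has_sum_int_reflectD[OF has_sum_Psech2[OF a]])
      show "sech (a * (real_of_int (-1 - n) + 1/2)) ^ 2 = sech (a * (real_of_int n + 1/2)) ^ 2" for n
        by (simp only: sech_reflect_half)
    qed
    thus "((\<lambda>k. 4 * (-1) ^ k * (real k + 1) * (csch (a * (real k + 1)) / 2)) has_sum Psech2 a (1/2) / 2) UNIV \<or>
      ((\<lambda>n. sech (a * (real n + 1/2)) ^ 2) has_sum Psech2 a (1/2) / 2) UNIV" by simp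
  qed
  from has_sum_cmult_right[OF conjunct1[OF this], of 2] show ?thesis by (simp add: mult_ac)
qed

text \<open>Adding the alternating series removes the sum of squared secants and cancels every odd
  k; the surviving k = 2n carry the odd multiples of a. For a = pi t this is the Lambert series of
  theta_2^4.\<close>

lemma Psech_half_square:
  assumes a: "a > 0"
  shows "((\<lambda>n. 8 * (2 * real n + 1) * csch ((2 * real n + 1) * a)) has_sum (Psech a (1/2) ^ 2)) UNIV"
proof -
  let ?h = "\<lambda>k. 4 * (real k + 1) * csch (a * (real k + 1)) + 4 * (-1) ^ k * (real k + 1) * csch (a * (real k + 1))"
  have "(?h has_sum (Psech a (1/2) ^ 2 - Psech2 a (1/2) + Psech2 a (1/2))) UNIV"
    by (intro has_sum_add Psech_square[OF a, of _ 1] Psech2_half_lambert a) simp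
  hence "(?h has_sum (Psech a (1/2) ^ 2)) UNIV" by simp
  hence "(?h has_sum (Psech a (1/2) ^ 2)) {k. even k}"
    by (subst (asm) has_sum_cong_neutral[where T = "{k. even k}" and g = ?h]) (auto simp: algebra_simps)
  thus ?thesis
    by (subst has_sum_reindex_bij_witness[where i = "\<lambda>k. k div 2" and j = "\<lambda>n. 2 * n" and T = "{k. even k}"
       and h = ?h and s' = "Psech a (1/2) ^ 2"]) (auto simp: mult_ac)
qed

text \<open>An integral and a half-integral family have differences d + 1/2, never zero, so their
  product at 2a consists of csch terms only. Folding d onto -1 - d reproduces the series of
  \<open>Psech_half_square\<close>.\<close>

lemma Psech_half_square_eq:
  assumes a: "a > 0"
  shows "Psech a (1/2) ^ 2 = 4 * Psech (2 * a) 0 * Psech (2 * a) (1/2)"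
proof -
  have a2: "2 * a > 0" using a by simp
  have ne: "real_of_int d + 1/2 \<noteq> 0" for d
  proof
    assume "real_of_int d + 1/2 = 0"
    hence "real_of_int (2 * d + 1) = 0" by simp
    hence "2 * d + 1 = 0" by linarith
    thus False by presburger
  qed
  have "((\<lambda>d. 2 * (real_of_int d + 1/2) * csch (2 * a * (real_of_int d + 1/2))) has_sum (Psech (2 * a) 0 * Psech (2 * a) (1/2))) UNIV"
    using Psech_mult[OF a2, of 0 0 "1/2" 1] ne by simp
  hence "((\<lambda>n. 2 * (real_of_int (int n) + 1/2) * csch (2 * a * (real_of_int (int n) + 1/2))) has_sum (Psech (2 * a) 0 * Psech (2 * a) (1/2) / 2)) UNIV"
  proof (rule has_sum_int_reflectD)
    show "2 * (real_of_int (-1 - n) + 1/2) * csch (2 * a * (real_of_int (-1 - n) + 1/2)) =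
      2 * (real_of_int n + 1/2) * csch (2 * a * (real_of_int n + 1/2))" for n
    proof -
      have "real_of_int (-1 - n) + 1/2 = - (real_of_int n + 1/2)" by simp
      thus ?thesis by (simp only: mult_minus_right csch_minus minus_mult_minus)
    qed
  qed
  from has_sum_cmult_right[OF this, of 8]
  have "((\<lambda>n. 8 * (2 * real n + 1) * csch ((2 * real n + 1) * a)) has_sum (4 * Psech (2 * a) 0 * Psech (2 * a) (1/2))) UNIV"
    by (simp add: algebra_simps)
  with Psech_half_square[OF a] show ?thesis by (rule has_sum_unique)
qed

lemma Psech_square_diff:
  assumes a: "a > 0"
  shows "Psech a 0 ^ 2 - Psech a (1/2) ^ 2 = Psech2 a 0 - Psech2 a (1/2)"
  using has_sum_unique[OF Psech_square[OF a, of 0 0] Psech_square[OF a, of "1/2" 1]] by simp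

section \<open>Lambert series of theta_2^2 and theta_2^2 theta_4^4\<close>

text \<open>A partial fraction decomposition. The double pole of sech^2 x is responsible for the
  term sech x tanh x, which is odd and disappears on summation.\<close>

lemma sech_sq_sech:
  fixes x c :: real
  assumes "c \<noteq> 0"
  shows "sech x ^ 2 * sech (x + c) = cosh c / sinh c ^ 2 * sech x - 1 / sinh c ^ 2 * sech (x + c) - 1 / sinh c * (sech x * tanh x)"
proof -
  define C S K L where "C = cosh x" and "S = sinh x" and "K = cosh c" and "L = sinh c"
  have C: "C > 0" and L: "L \<noteq> 0" and S2: "S\<^sup>2 = C\<^sup>2 - 1" and L2: "L\<^sup>2 = K\<^sup>2 - 1"
    using assms by (auto simp: C_def S_def K_def L_def cosh_square_eq)
  have e: "cosh (x + c) = C * K + S * L" by (simp add: C_def S_def K_def L_def cosh_add)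
  have pos: "C * K + S * L > 0" by (metis cosh_real_pos e)
  have L2': "L\<^sup>2 = K * C * (C * K + S * L) - C\<^sup>2 - L * S * (C * K + S * L)"
  proof -
    have "K * C * (C * K + S * L) - C\<^sup>2 - L * S * (C * K + S * L) = C\<^sup>2 * K\<^sup>2 - C\<^sup>2 - L\<^sup>2 * S\<^sup>2"
      by (simp add: algebra_simps power2_eq_square)
    also have "\<dots> = L\<^sup>2" unfolding S2 L2 by (simp add: algebra_simps)
    finally show ?thesis by simp
  qed
  hence "1 / C\<^sup>2 * (1 / (C * K + S * L)) = (K * C * (C * K + S * L) - C\<^sup>2 - L * S * (C * K + S * L)) / (L\<^sup>2 * C\<^sup>2 * (C * K + S * L))"
    using C L pos L2'[symmetric] by simp
  also have "\<dots> = K / L\<^sup>2 * (1 / C) - 1 / L\<^sup>2 * (1 / (C * K + S * L)) - 1 / L * (1 / C * (S / C))"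
    using C L pos by (simp add: diff_divide_distrib power2_eq_square)
  finally show ?thesis
    by (simp add: sech_def tanh_def e inverse_eq_divide power_divide flip: C_def S_def K_def L_def)
qed

text \<open>Grouped by the index difference d, the partial fractions leave (cosh(ad) - 1)/sinh(ad)^2
  = sech(ad/2)^2/2 times \<open>Psech a (1/2)\<close>; this is why \<open>Psech2\<close> occurs at
  a/2. The group d = 0 is the sum of cubes.\<close>

lemma Psech_Psech2_half:
  assumes a: "a > 0"
  shows "Psech a (1/2) * Psech2 a (1/2) = Psech3 a (1/2) + Psech a (1/2) * (Psech2 (a/2) 0 - 1) / 2"
proof -
  let ?x = "\<lambda>n::int. a * (real_of_int n + 1/2)"
  have "((\<lambda>(n,m). sech (?x n) ^ 2 * sech (?x m)) has_sum (Psech2 a (1/2) * Psech a (1/2))) (UNIV \<times> UNIV)"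
    by (intro has_sum_prod_real[where f = "\<lambda>n. sech (?x n) ^ 2"] has_sum_Psech has_sum_Psech2 a)
  hence "((\<lambda>(d,n). sech (?x n) ^ 2 * sech (?x (n + d))) has_sum (Psech2 a (1/2) * Psech a (1/2))) (UNIV \<times> UNIV)"
    by (subst (asm) has_sum_reindex_bij_witness[where i = "\<lambda>(d,n). (n, n + d)" and j = "\<lambda>(n,m). (m - n, n)"
       and T = "UNIV \<times> UNIV" and h = "\<lambda>(d,n). sech (?x n) ^ 2 * sech (?x (n + d))" and s' = "Psech2 a (1/2) * Psech a (1/2)"]) auto
  hence 1: "((\<lambda>d. if d = 0 then Psech3 a (1/2) else Psech a (1/2) * sech (a / 2 * real_of_int d) ^ 2 / 2)
     has_sum (Psech2 a (1/2) * Psech a (1/2))) UNIV"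
  proof (rule has_sum_SigmaD)
    fix d :: int
    show "((\<lambda>n. case (d, n) of (d, n) \<Rightarrow> sech (?x n) ^ 2 * sech (?x (n + d))) has_sum
       (if d = 0 then Psech3 a (1/2) else Psech a (1/2) * sech (a / 2 * real_of_int d) ^ 2 / 2)) UNIV"
    proof (cases "d = 0")
      case True
      thus ?thesis using has_sum_Psech3[OF a, of "1/2"] by (simp add: power2_eq_square power3_eq_cube mult.assoc)
    next
      case False
      let ?c = "a * real_of_int d"
      have c: "?c \<noteq> 0" using a False by simp
      have xd: "?x (n + d) = ?x n + ?c" for n by (simp add: algebra_simps)
      \<comment> \<open>The reflection n to -1 - n changes the sign of n + 1/2, and the summand is
        odd in it.\<close>
      have t0: "((\<lambda>n. sech (?x n) * tanh (?x n)) has_sum 0) UNIV"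
      proof (rule has_sum_int_oddI[where c = "-1"])
        have tl: "\<bar>tanh y\<bar> \<le> 1" for y :: real
          using tanh_real_lt_1[of y] tanh_real_gt_neg1[of y] by linarith
        show "(\<lambda>n. sech (?x n) * tanh (?x n)) summable_on UNIV"
          by (rule summable_sech_bounded[OF a, where C = 1 and x = "1/2"])
            (use tl in \<open>auto simp: abs_mult abs_of_pos mult_left_le\<close>)
        fix n :: int
        have "?x (-1 - n) = - ?x n" by (simp add: algebra_simps)
        thus "sech (?x (-1 - n)) * tanh (?x (-1 - n)) = - (sech (?x n) * tanh (?x n))"
          by (simp only: sech_minus tanh_minus mult_minus_right)
      qed
      have s1: "((\<lambda>n. sech (?x (n + d))) has_sum Psech a (1/2)) UNIV"
        using has_sum_Psech[OF a, of "1/2"] by (subst has_sum_int_shift)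
      have "((\<lambda>n. cosh ?c / sinh ?c ^ 2 * sech (?x n) - 1 / sinh ?c ^ 2 * sech (?x (n + d)) - 1 / sinh ?c * (sech (?x n) * tanh (?x n)))
        has_sum (cosh ?c / sinh ?c ^ 2 * Psech a (1/2) - 1 / sinh ?c ^ 2 * Psech a (1/2) - 1 / sinh ?c * 0)) UNIV"
        unfolding diff_conv_add_uminus
        by (intro has_sum_add has_sum_uminusI has_sum_cmult_right has_sum_Psech a s1 t0)
      hence "((\<lambda>n. sech (?x n) ^ 2 * sech (?x (n + d))) has_sum ((cosh ?c - 1) / sinh ?c ^ 2 * Psech a (1/2))) UNIV"
        unfolding xd sech_sq_sech[OF c] by (simp add: diff_divide_distrib left_diff_distrib)
      moreover have "(cosh ?c - 1) / sinh ?c ^ 2 = sech (a / 2 * real_of_int d) ^ 2 / 2"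
      proof -
        have e: "?c = 2 * (a / 2 * real_of_int d)" by simp
        have h: "cosh ?c = 2 * cosh (a / 2 * real_of_int d) ^ 2 - 1"
          unfolding e cosh_double sinh_square_eq by simp
        have "sinh ?c ^ 2 = (cosh ?c - 1) * (cosh ?c + 1)" unfolding sinh_square_eq by (simp add: algebra_simps power2_eq_square)
        moreover have "cosh ?c - 1 \<noteq> 0" using c by (metis cosh_real_one_iff eq_iff_diff_eq_0)
        ultimately have "(cosh ?c - 1) / sinh ?c ^ 2 = 1 / (cosh ?c + 1)" by simp
        also have "cosh ?c + 1 = 2 * cosh (a / 2 * real_of_int d) ^ 2" using h by simp
        finally show ?thesis by (simp add: sech_def inverse_eq_divide power_divide)
      qed
      ultimately show ?thesis using False by (simp add: mult_ac)
    qed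
  qed
  have "((\<lambda>d. Psech a (1/2) / 2 * sech (a / 2 * real_of_int d) ^ 2) has_sum (Psech a (1/2) / 2 * Psech2 (a/2) 0)) UNIV"
    using has_sum_Psech2[of "a/2" 0] a by (intro has_sum_cmult_right) simp
  \<comment> \<open>At d = 0 the general formula would give \<open>Psech a (1/2) / 2\<close>, as
    sech 0 = 1; this correction supported at 0 exchanges it for the sum of cubes.\<close>
  moreover have "((\<lambda>d::int. if d = 0 then Psech3 a (1/2) - Psech a (1/2) / 2 else 0) has_sum (Psech3 a (1/2) - Psech a (1/2) / 2)) UNIV"
    by (rule has_sum_finite_neutralI[of "{0}"]) auto
  ultimately have "((\<lambda>d::int. Psech a (1/2) / 2 * sech (a / 2 * real_of_int d) ^ 2 + (if d = 0 then Psech3 a (1/2) - Psech a (1/2) / 2 else 0))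
    has_sum (Psech a (1/2) / 2 * Psech2 (a/2) 0 + (Psech3 a (1/2) - Psech a (1/2) / 2))) UNIV"
    by (rule has_sum_add)
  also have "(\<lambda>d::int. Psech a (1/2) / 2 * sech (a / 2 * real_of_int d) ^ 2 + (if d = 0 then Psech3 a (1/2) - Psech a (1/2) / 2 else 0))
    = (\<lambda>d. if d = 0 then Psech3 a (1/2) else Psech a (1/2) * sech (a / 2 * real_of_int d) ^ 2 / 2)"
    by (auto simp: fun_eq_iff sech_def)
  finally have "Psech2 a (1/2) * Psech a (1/2) = Psech a (1/2) / 2 * Psech2 (a/2) 0 + (Psech3 a (1/2) - Psech a (1/2) / 2)"
    using 1 has_sum_unique by blast
  thus ?thesis by (simp add: field_simps)
qed

text \<open>This turns into the Lambert series of $\theta_2^2\theta_4^4$, since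
  $\mathrm{sech} - 2\,\mathrm{sech}^3$ is the second derivative of $\mathrm{sech}$.\<close>

lemma Psech3_half_eq:
  assumes a: "a > 0"
  shows "Psech a (1/2) - 2 * Psech3 a (1/2) = Psech a (1/2) * (Psech a 0 ^ 2 - Psech a (1/2) ^ 2)"
proof -
  have "Psech2 (a/2) 0 = Psech2 a 0 + Psech2 a (1/2)" using Psech_double(2)[of "a/2"] a by simp
  thus ?thesis using Psech_Psech2_half[OF a] unfolding Psech_square_diff[OF a] by (simp add: field_simps)
qed

lemma sech_half_nat:
  assumes a: "a > 0"
  shows "((\<lambda>m. sech ((2 * real m + 1) * (a / 2))) has_sum (Psech a (1/2) / 2)) UNIV"
    "((\<lambda>m. sech ((2 * real m + 1) * (a / 2)) ^ 3) has_sum (Psech3 a (1/2) / 2)) UNIV"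
proof -
  have e: "sech (a * (real_of_int (-1 - n) + 1/2)) = sech (a * (real_of_int n + 1/2))" for n
    by (metis sech_reflect_half)
  have e2: "(2 * real m + 1) * (a / 2) = a * (real_of_int (int m) + 1/2)" for m by (simp add: algebra_simps)
  show "((\<lambda>m. sech ((2 * real m + 1) * (a / 2))) has_sum (Psech a (1/2) / 2)) UNIV"
    unfolding e2 by (rule has_sum_int_reflectD[OF has_sum_Psech[OF a]]) (rule e)
  show "((\<lambda>m. sech ((2 * real m + 1) * (a / 2)) ^ 3) has_sum (Psech3 a (1/2) / 2)) UNIV"
    unfolding e2 by (rule has_sum_int_reflectD[OF has_sum_Psech3[OF a]]) (simp only: e)
qed

text \<open>Each is one double series summed in two orders: over m it gives csch, over n it gives
  sech or its second derivative. For a = pi t these are the Lambert series of theta_2^2 and of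
  theta_2^2 theta_4^4.\<close>

lemma Psech_half_lambert:
  assumes a: "a > 0"
  shows "((\<lambda>n. 2 * (-1) ^ n * csch ((2 * real n + 1) * (a / 2))) has_sum Psech a (1/2)) UNIV"
    "((\<lambda>n. 2 * (-1) ^ n * (2 * real n + 1)\<^sup>2 * csch ((2 * real n + 1) * (a / 2)))
       has_sum (Psech a (1/2) * (Psech a 0 ^ 2 - Psech a (1/2) ^ 2))) UNIV"
proof -
  let ?E = "\<lambda>n m. exp (- ((2 * real n + 1) * ((2 * real m + 1) * (a / 2))))"
  have a2: "a / 2 > 0" using a by simp
  have cs: "((\<lambda>m. ?E n m) has_sum (csch ((2 * real n + 1) * (a / 2)) / 2)) UNIV" for n
    using csch_has_sum[of "(2 * real n + 1) * (a / 2)"] a by (simp add: mult_ac)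
  have sm: "(\<lambda>n. 4 * (2 * real n + 1)\<^sup>2 * (csch ((2 * real n + 1) * (a / 2)) / 2)) summable_on UNIV"
    using summable_on_cmult_right[OF summable_csch[OF a2], of 2] by (simp add: mult_ac)
  have pos: "csch ((2 * real n + 1) * (a / 2)) > 0" for n using a by (intro csch_pos) auto
  have "((\<lambda>n. 4 * (-1) ^ n * (csch ((2 * real n + 1) * (a / 2)) / 2)) has_sum Psech a (1/2)) UNIV \<and>
     ((\<lambda>m. 2 * sech ((2 * real m + 1) * (a / 2))) has_sum Psech a (1/2)) UNIV \<and>
     ((\<lambda>(n,m). 4 * (-1) ^ n * ?E n m) has_sum Psech a (1/2)) (UNIV \<times> UNIV)"
  proof (rule has_sum_fubini)
    show "((\<lambda>m. \<bar>4 * (-1) ^ n * ?E n m\<bar>) has_sum 4 * (csch ((2 * real n + 1) * (a / 2)) / 2)) UNIV" for n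
      using has_sum_cmult_right[OF cs[of n], of 4] by (simp add: abs_mult)
    show "(\<lambda>n. 4 * (csch ((2 * real n + 1) * (a / 2)) / 2)) summable_on UNIV"
    proof (rule summable_on_comparison_test[OF sm])
      fix n :: nat
      have "1 \<le> (2 * real n + 1)\<^sup>2" by simp
      thus "4 * (csch ((2 * real n + 1) * (a / 2)) / 2) \<le> 4 * (2 * real n + 1)\<^sup>2 * (csch ((2 * real n + 1) * (a / 2)) / 2)"
        using pos[of n] by (metis (no_types, opaque_lifting) half_gt_zero less_imp_le mult.assoc mult_le_cancel_right1 mult_left_mono not_less zero_le_numeral)
    qed (use pos in \<open>auto intro: less_imp_le\<close>)
    show "((\<lambda>m. 4 * (-1) ^ n * ?E n m) has_sum 4 * (-1) ^ n * (csch ((2 * real n + 1) * (a / 2)) / 2)) UNIV" for n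
      by (intro has_sum_cmult_right cs)
    show "((\<lambda>n. 4 * (-1) ^ n * ?E n m) has_sum 2 * sech ((2 * real m + 1) * (a / 2))) UNIV" for m
      using has_sum_cmult_right[OF sech_has_sum(1)[of "(2 * real m + 1) * (a / 2)"], of 4] a by (simp add: mult.assoc)
    show "((\<lambda>n. 4 * (-1) ^ n * (csch ((2 * real n + 1) * (a / 2)) / 2)) has_sum Psech a (1/2)) UNIV \<or>
      ((\<lambda>m. 2 * sech ((2 * real m + 1) * (a / 2))) has_sum Psech a (1/2)) UNIV"
      using has_sum_cmult_right[OF sech_half_nat(1)[OF a], of 2] by simp
  qed
  thus "((\<lambda>n. 2 * (-1) ^ n * csch ((2 * real n + 1) * (a / 2))) has_sum Psech a (1/2)) UNIV"
    by (simp add: mult_ac)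
  let ?T = "Psech a (1/2) - 2 * Psech3 a (1/2)"
  let ?s = "\<lambda>m. sech ((2 * real m + 1) * (a / 2))"
  have "((\<lambda>n. 4 * (-1) ^ n * (2 * real n + 1)\<^sup>2 * (csch ((2 * real n + 1) * (a / 2)) / 2)) has_sum ?T) UNIV \<and>
     ((\<lambda>m. 2 * (?s m - 2 * ?s m ^ 3)) has_sum ?T) UNIV \<and>
     ((\<lambda>(n,m). 4 * (-1) ^ n * (2 * real n + 1)\<^sup>2 * ?E n m) has_sum ?T) (UNIV \<times> UNIV)"
  proof (rule has_sum_fubini)
    show "((\<lambda>m. \<bar>4 * (-1) ^ n * (2 * real n + 1)\<^sup>2 * ?E n m\<bar>) has_sum 4 * (2 * real n + 1)\<^sup>2 * (csch ((2 * real n + 1) * (a / 2)) / 2)) UNIV" for n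
      using has_sum_cmult_right[OF cs[of n], of "4 * (2 * real n + 1)\<^sup>2"] by (simp add: abs_mult)
    show "(\<lambda>n. 4 * (2 * real n + 1)\<^sup>2 * (csch ((2 * real n + 1) * (a / 2)) / 2)) summable_on UNIV" by (rule sm)
    show "((\<lambda>m. 4 * (-1) ^ n * (2 * real n + 1)\<^sup>2 * ?E n m) has_sum 4 * (-1) ^ n * (2 * real n + 1)\<^sup>2 * (csch ((2 * real n + 1) * (a / 2)) / 2)) UNIV" for n
      by (intro has_sum_cmult_right cs)
    show "((\<lambda>n. 4 * (-1) ^ n * (2 * real n + 1)\<^sup>2 * ?E n m) has_sum 2 * (?s m - 2 * ?s m ^ 3)) UNIV" for m
      using has_sum_cmult_right[OF sech_has_sum(2)[of "(2 * real m + 1) * (a / 2)"], of 4] a by (simp add: mult.assoc diff_divide_distrib)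
    have "((\<lambda>m. 2 * (?s m + - (2 * ?s m ^ 3))) has_sum (2 * (Psech a (1/2) / 2 + - (2 * (Psech3 a (1/2) / 2))))) UNIV"
      by (intro has_sum_cmult_right has_sum_add has_sum_uminusI sech_half_nat a)
    thus "((\<lambda>n. 4 * (-1) ^ n * (2 * real n + 1)\<^sup>2 * (csch ((2 * real n + 1) * (a / 2)) / 2)) has_sum ?T) UNIV \<or>
      ((\<lambda>m. 2 * (?s m - 2 * ?s m ^ 3)) has_sum ?T) UNIV" by simp
  qed
  thus "((\<lambda>n. 2 * (-1) ^ n * (2 * real n + 1)\<^sup>2 * csch ((2 * real n + 1) * (a / 2)))
       has_sum (Psech a (1/2) * (Psech a 0 ^ 2 - Psech a (1/2) ^ 2))) UNIV"
    unfolding Psech3_half_eq[OF a] by (simp add: mult_ac)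
qed

section \<open>Landen recursion and theta functions\<close>

text \<open>The recursion satisfied by $(\theta_3^2, \theta_2^2)$ under $t \mapsto 2t$. It determines both functions
  because it halves distances between logarithms of moduli $v/u$ at each step, going down from infinity.\<close>

definition landen_pair :: "(real \<Rightarrow> real) \<Rightarrow> (real \<Rightarrow> real) \<Rightarrow> bool" where
  "landen_pair u v \<longleftrightarrow> (\<forall>t>0. u t > 0 \<and> v t > 0 \<and> u t = u (2 * t) + v (2 * t) \<and> v t ^ 2 = 4 * u (2 * t) * v (2 * t)) \<and>
     (u \<longlongrightarrow> 1) at_top \<and>
     (\<exists>c C. c > 0 \<and> (\<forall>t\<ge>1. c * exp (- pi * t / 2) \<le> v t \<and> v t \<le> C * exp (- pi * t / 2)))"

lemma landen_pairD:
  assumes "landen_pair u v"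
  shows "t > 0 \<Longrightarrow> u t > 0" "t > 0 \<Longrightarrow> v t > 0" "t > 0 \<Longrightarrow> u t = u (2 * t) + v (2 * t)"
    "t > 0 \<Longrightarrow> v t ^ 2 = 4 * u (2 * t) * v (2 * t)" "(u \<longlongrightarrow> 1) at_top"
    "\<exists>c C. c > 0 \<and> (\<forall>t\<ge>1. c * exp (- pi * t / 2) \<le> v t \<and> v t \<le> C * exp (- pi * t / 2))"
  using assms unfolding landen_pair_def by blast+

text \<open>With respect to ln x, the logarithm of 2 sqrt x/(1 + x) has derivative 1/2 - x/(1 + x),
  of absolute value below 1/2. The same is expressed here by monotonicity of ln(1 + x) and of ln x -
  ln(1 + x).\<close>

lemma landen_contraction:
  fixes x y :: real
  assumes "x > 0" "y > 0"
  shows "\<bar>ln (2 * sqrt x / (1 + x)) - ln (2 * sqrt y / (1 + y))\<bar> \<le> \<bar>ln x - ln y\<bar> / 2"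
proof -
  have *: "\<bar>ln (2 * sqrt x / (1 + x)) - ln (2 * sqrt y / (1 + y))\<bar> \<le> \<bar>ln x - ln y\<bar> / 2"
    if "x \<le> y" "x > 0" for x y :: real
  proof -
    have y: "y > 0" using that by linarith
    have 1: "ln (2 * sqrt z / (1 + z)) = ln 2 + ln z / 2 - ln (1 + z)" if "z > 0" for z :: real
      using that by (simp add: ln_div ln_mult ln_sqrt)
    have "ln (1 + x) \<le> ln (1 + y)" using that by simp
    moreover have "ln (1 + y) + ln x \<le> ln (1 + x) + ln y"
    proof -
      have "ln ((1 + y) * x) \<le> ln ((1 + x) * y)" using that y by (subst ln_le_cancel_iff) (auto simp: algebra_simps intro!: add_pos_pos mult_pos_pos)
      thus ?thesis using that y by (simp add: ln_mult)
    qed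
    moreover have "ln x \<le> ln y" using that y by simp
    ultimately show ?thesis unfolding 1[OF that(2)] 1[OF y] by (auto simp: abs_if)
  qed
  show ?thesis using *[of x y] *[of y x] assms by (cases "x \<le> y") (auto simp: abs_minus_commute)
qed

text \<open>The modulus at t is a function of the modulus at 2t alone, so information flows from
  infinity towards 0.\<close>

lemma landen_pair_modulus:
  assumes "landen_pair u v" "t > 0"
  shows "v t / u t = 2 * sqrt (v (2*t) / u (2*t)) / (1 + v (2*t) / u (2*t))" "v t / u t > 0"
    "u t = u (2*t) * (1 + v (2*t) / u (2*t))"
proof -
  define U V where "U = u (2*t)" and "V = v (2*t)"
  have U: "U > 0" "V > 0" "u t = U + V" "v t ^ 2 = 4 * U * V" "v t > 0" "u t > 0"
    using landen_pairD(1-4)[OF assms(1), of t] landen_pairD(1,2)[OF assms(1), of "2 * t"] assms(2) by (auto simp: U_def V_def)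
  have "v t = sqrt (4 * U * V)" using U by (metis less_imp_le real_sqrt_unique)
  also have "\<dots> = 2 * U * sqrt (V / U)"
  proof -
    have "4 * U * V = (2 * U)\<^sup>2 * (V / U)" using U by (simp add: power2_eq_square)
    also have "sqrt \<dots> = 2 * U * sqrt (V / U)"
      unfolding real_sqrt_mult[of "(2 * U)\<^sup>2"] real_sqrt_abs using U by simp
    finally show ?thesis .
  qed
  finally show "v t / u t = 2 * sqrt (v (2*t) / u (2*t)) / (1 + v (2*t) / u (2*t))"
    unfolding U_def[symmetric] V_def[symmetric] U(3) using U by (simp add: field_simps)
  show "v t / u t > 0" using U by simp
  show "u t = u (2*t) * (1 + v (2*t) / u (2*t))" unfolding U_def[symmetric] V_def[symmetric] U(3) using U by (simp add: field_simps)
qed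

lemma filterlim_doubling:
  assumes "(t::real) > 0" shows "filterlim (\<lambda>n. 2 ^ n * t) at_top sequentially"
  using assms by real_asymp

text \<open>The exponential bounds keep ln(v/u) within bounded distance of -pi t/2, so the
  logarithmic moduli of the two pairs differ by a bounded amount near infinity; n contractions from
  2^n t down to t divide this by 2^n. Once the moduli agree, u/u' is invariant under doubling and
  tends to 1.\<close>

lemma landen_pair_unique:
  assumes 1: "landen_pair u v" and 2: "landen_pair u' v'" and t: "t > 0"
  shows "u t = u' t" "v t = v' t"
proof -
  let ?k = "\<lambda>t. v t / u t" and ?k' = "\<lambda>t. v' t / u' t"
  let ?d = "\<lambda>t. \<bar>ln (?k t) - ln (?k' t)\<bar>"
  have half: "?d t \<le> ?d (2 * t) / 2" if "t > 0" for t
    unfolding landen_pair_modulus(1)[OF 1 that] landen_pair_modulus(1)[OF 2 that]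
    by (rule landen_contraction) (use landen_pair_modulus(2)[OF 1, of "2*t"] landen_pair_modulus(2)[OF 2, of "2*t"] that in simp_all)
  have iter: "?d t \<le> ?d (2 ^ n * t) / 2 ^ n" if "t > 0" for t n
  proof (induction n)
    case (Suc n)
    have "?d (2 ^ n * t) / 2 ^ n \<le> ?d (2 * (2 ^ n * t)) / 2 / 2 ^ n"
      by (intro divide_right_mono half) (use that in auto)
    with Suc show ?case by (simp add: mult_ac)
  qed simp
  have lb: "\<exists>B. \<forall>\<^sub>F t in at_top. \<bar>ln (v t / u t) + pi * t / 2\<bar> \<le> B" if l: "landen_pair u v" for u v
  proof -
    obtain c C where c: "c > 0" "\<And>t. t \<ge> 1 \<Longrightarrow> c * exp (- pi * t / 2) \<le> v t \<and> v t \<le> C * exp (- pi * t / 2)"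
      using landen_pairD(6)[OF l] by blast
    have "c * exp (- pi * 1 / 2) \<le> C * exp (- pi * 1 / 2)" using c(2)[of 1] by linarith
    hence C: "C > 0" using c(1) by (smt (verit) exp_gt_zero mult_le_cancel_right)
    have "\<forall>\<^sub>F t in at_top. u t > 1/2" "\<forall>\<^sub>F t in at_top. u t < 2"
      using landen_pairD(5)[OF l] by (rule order_tendstoD; simp)+
    hence "\<forall>\<^sub>F t in at_top. \<bar>ln (v t / u t) + pi * t / 2\<bar> \<le> \<bar>ln c\<bar> + \<bar>ln C\<bar> + ln 2"
      using eventually_ge_at_top[of 1]
    proof eventually_elim
      case (elim t)
      have v: "v t > 0" using landen_pairD(2)[OF l] elim by auto
      have "ln (c * exp (- pi * t / 2)) \<le> ln (v t)" "ln (v t) \<le> ln (C * exp (- pi * t / 2))"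
        using c(2)[OF elim(3)] v c(1) C by (subst ln_le_cancel_iff; simp)+
      hence "ln c - pi * t / 2 \<le> ln (v t)" "ln (v t) \<le> ln C - pi * t / 2"
        using c(1) C by (simp_all add: ln_mult)
      moreover have "ln (u t) \<le> ln 2" "ln (1/2) \<le> ln (u t)" using elim by (subst ln_le_cancel_iff; simp)+
      moreover have "ln (1/2::real) = - ln 2" by (simp add: ln_div)
      moreover have "ln (v t / u t) = ln (v t) - ln (u t)" using v elim by (simp add: ln_div)
      ultimately show ?case by linarith
    qed
    thus ?thesis by blast
  qed
  obtain B where B: "\<forall>\<^sub>F t in at_top. \<bar>ln (?k t) + pi * t / 2\<bar> \<le> B" using lb[OF 1] by blast
  obtain B' where B': "\<forall>\<^sub>F t in at_top. \<bar>ln (?k' t) + pi * t / 2\<bar> \<le> B'" using lb[OF 2] by blast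
  have bd: "\<forall>\<^sub>F t in at_top. ?d t \<le> B + B'" using B B' by eventually_elim linarith
  have keq: "?k t = ?k' t" if t: "t > 0" for t
  proof -
    have ev: "\<forall>\<^sub>F n in sequentially. ?d t \<le> (B + B') / 2 ^ n"
    proof -
      have "\<forall>\<^sub>F n in sequentially. ?d (2 ^ n * t) \<le> B + B'"
        by (rule eventually_compose_filterlim[OF bd filterlim_doubling[OF t]])
      thus ?thesis
      proof eventually_elim
        case (elim n)
        have "?d t \<le> ?d (2 ^ n * t) / 2 ^ n" by (rule iter[OF t])
        also have "\<dots> \<le> (B + B') / 2 ^ n" by (intro divide_right_mono elim) simp
        finally show ?case .
      qed
    qed
    have "(\<lambda>n. (B + B') / 2 ^ n) \<longlonglongrightarrow> 0" by real_asymp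
    from tendsto_lowerbound[OF this ev] have "?d t \<le> 0" by simp
    hence "ln (?k t) = ln (?k' t)" by simp
    thus ?thesis using landen_pair_modulus(2)[OF 1 t] landen_pair_modulus(2)[OF 2 t] by (metis exp_ln)
  qed
  have pos: "u t > 0" "u' t > 0" if "t > 0" for t using landen_pairD(1)[OF 1] landen_pairD(1)[OF 2] that by auto
  have r: "u (2 ^ n * t) / u' (2 ^ n * t) = u t / u' t" for n
  proof (induction n)
    case (Suc n)
    let ?t = "2 ^ n * t"
    have t': "?t > 0" "2 * ?t > 0" using t by auto
    have "u ?t / u' ?t = u (2 * ?t) / u' (2 * ?t)"
      unfolding landen_pair_modulus(3)[OF 1 t'(1)] landen_pair_modulus(3)[OF 2 t'(1)] keq[OF t'(2)]
      using landen_pair_modulus(2)[OF 2 t'(2)] by simp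
    with Suc show ?case by (simp add: mult_ac)
  qed simp
  have "((\<lambda>t. u t / u' t) \<longlongrightarrow> 1 / 1) at_top"
    by (intro tendsto_divide landen_pairD(5)[OF 1] landen_pairD(5)[OF 2]) simp
  from filterlim_compose[OF this filterlim_doubling[OF t]] have "(\<lambda>n. u t / u' t) \<longlonglongrightarrow> 1"
    by (simp add: r)
  hence "u t / u' t = 1" by (simp add: LIMSEQ_const_iff)
  thus uu: "u t = u' t" using pos[OF t] by (simp add: field_simps)
  thus "v t = v' t" using keq[OF t] pos[OF t] by simp
qed

lemma has_sum_int_near_one:
  fixes f :: "int \<Rightarrow> real"
  assumes f: "(f has_sum S) UNIV" and c: "c > 0" and f0: "f 0 = 1" and nn: "\<And>n. f n \<ge> 0"
    and le: "\<And>n. f n \<le> C * exp (- c * \<bar>real_of_int n\<bar>)"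
  shows "1 \<le> S" "S \<le> 1 + 2 * C * exp (- c) / (1 - exp (- c))"
proof -
  show "1 \<le> S" using finite_sum_le_has_sum[OF f, of "{0}"] nn f0 by simp
  let ?h = "\<lambda>n::int. if n = 0 then 1 else C * exp (- c * \<bar>real_of_int n\<bar>)"
  have "((\<lambda>n. C * exp (- c) * exp (- c * real n)) has_sum (C * exp (- c) * (1 / (1 - exp (- c))))) UNIV"
    by (intro has_sum_cmult_right has_sum_exp_nat c)
  hence "((\<lambda>n. ?h (int (Suc n))) has_sum (C * exp (- c) * (1 / (1 - exp (- c))))) UNIV"
    by (simp add: algebra_simps exp_diff exp_minus divide_inverse)
  hence "(?h has_sum (?h 0 + 2 * (C * exp (- c) * (1 / (1 - exp (- c)))))) UNIV"
    by (rule has_sum_int_evenI) simp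
  moreover have "f n \<le> ?h n" for n using le f0 by simp
  ultimately have "S \<le> ?h 0 + 2 * (C * exp (- c) * (1 / (1 - exp (- c))))" using has_sum_mono[OF f] by blast
  thus "S \<le> 1 + 2 * C * exp (- c) / (1 - exp (- c))" by (simp add: mult.assoc)
qed

lemma has_sum_int_half_bounds:
  fixes f :: "int \<Rightarrow> real"
  assumes f: "(f has_sum S) UNIV" and c: "c > 0" and sym: "\<And>n. f (-1 - n) = f n" and nn: "\<And>n. f n \<ge> 0"
    and le: "\<And>n. f (int n) \<le> U * exp (- c * real n)"
  shows "2 * f 0 \<le> S" "S \<le> 2 * U / (1 - exp (- c))"
proof -
  note h = has_sum_int_reflectD[OF f sym]
  have "f (int 0) \<le> S / 2" using finite_sum_le_has_sum[OF h, of "{0}"] nn by simp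
  thus "2 * f 0 \<le> S" by simp
  have "S / 2 \<le> U * (1 / (1 - exp (- c)))"
    by (rule has_sum_mono[OF h has_sum_cmult_right[OF has_sum_exp_nat[OF c]]]) (use le in auto)
  thus "S \<le> 2 * U / (1 - exp (- c))" by (simp add: mult.commute)
qed

lemma exp_neg_pi_le: "t \<ge> 1 \<Longrightarrow> 1 / (1 - exp (- (pi * t))) \<le> 2"
proof -
  assume t: "t \<ge> 1"
  have "1 \<le> pi * t" using t pi_gt3 by (smt (verit) mult_less_cancel_left2)
  hence "2 \<le> exp (pi * t)" using exp_ge_add_one_self[of "pi * t"] by linarith
  hence "exp (- (pi * t)) \<le> 1/2" by (simp add: exp_minus field_simps)
  hence "1/2 \<le> 1 - exp (- (pi * t))" by simp
  from frac_le[OF _ _ _ this, of 1 1] show ?thesis by simp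
qed

section \<open>Secant sums and Gaussian sums as two models of the squared theta functions\<close>

definition S3 :: "real \<Rightarrow> real" where "S3 t = Psech (pi * t) 0"
definition S2 :: "real \<Rightarrow> real" where "S2 t = Psech (pi * t) (1/2)"

lemma S3_bounds:
  assumes "t > 0"
  shows "1 \<le> S3 t" "S3 t \<le> 1 + 4 * exp (- pi * t) / (1 - exp (- pi * t))"
proof -
  have a: "pi * t > 0" using assms by simp
  have le: "sech (pi * t * (real_of_int n + 0)) \<le> 2 * exp (- (pi * t) * \<bar>real_of_int n\<bar>)" for n
    using sech_le_exp_shift[OF a, of n 0] by simp
  show "1 \<le> S3 t" "S3 t \<le> 1 + 4 * exp (- pi * t) / (1 - exp (- pi * t))"
    unfolding S3_def using has_sum_int_near_one[OF has_sum_Psech[OF a] a _ _ le] by (auto simp: sech_def)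
qed

lemma S2_bounds:
  assumes "t > 0"
  shows "2 * exp (- pi * t / 2) \<le> S2 t" "S2 t \<le> 4 * exp (- pi * t / 2) * (1 / (1 - exp (- pi * t)))"
proof -
  have a: "pi * t > 0" using assms by simp
  have "sech (pi * t * (real_of_int (int n) + 1/2)) \<le> 2 * exp (- pi * t / 2) * exp (- (pi * t) * real n)" for n
  proof -
    have "\<bar>pi * t * (real n + 1/2)\<bar> = pi * t / 2 + pi * t * real n"
      using assms by (simp add: abs_mult algebra_simps)
    moreover have "exp (- (pi * t / 2 + pi * t * real n)) = exp (- pi * t / 2) * exp (- (pi * t) * real n)"
      by (simp add: algebra_simps flip: exp_add)
    ultimately show ?thesis using sech_le_exp[of "pi * t * (real n + 1/2)"] by (simp only: mult.assoc of_int_of_nat_eq)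
  qed
  note B = has_sum_int_half_bounds[OF has_sum_Psech[OF a] a sech_reflect_half less_imp_le[OF sech_pos] this]
  have "exp (- pi * t / 2) \<le> sech (pi * t * (real_of_int 0 + 1/2))"
  proof -
    have "cosh y \<le> exp y" if "y \<ge> 0" for y :: real using that by (simp add: cosh_def)
    hence "inverse (exp (pi * t / 2)) \<le> inverse (cosh (pi * t / 2))" using a by (intro le_imp_inverse_le) auto
    thus ?thesis by (simp add: sech_def exp_minus)
  qed
  thus "2 * exp (- pi * t / 2) \<le> S2 t" "S2 t \<le> 4 * exp (- pi * t / 2) * (1 / (1 - exp (- pi * t)))"
    unfolding S2_def using B by auto
qed

lemma tendsto_1_of_bounds:
  fixes f :: "real \<Rightarrow> real"
  assumes "\<And>t. t > 0 \<Longrightarrow> 1 \<le> f t" "\<And>t. t > 0 \<Longrightarrow> f t \<le> 1 + C * exp (- pi * t) / (1 - exp (- pi * t))"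
  shows "(f \<longlongrightarrow> 1) at_top"
proof (rule tendsto_sandwich)
  show "\<forall>\<^sub>F t in at_top. 1 \<le> f t" using eventually_gt_at_top[of 0] by eventually_elim (use assms in auto)
  show "\<forall>\<^sub>F t in at_top. f t \<le> 1 + C * exp (- pi * t) / (1 - exp (- pi * t))"
    using eventually_gt_at_top[of 0] by eventually_elim (use assms in auto)
  show "((\<lambda>t. 1 + C * exp (- pi * t) / (1 - exp (- pi * t))) \<longlongrightarrow> 1) at_top" by real_asymp
qed simp

lemma landen_pair_S: "landen_pair S3 S2"
  unfolding landen_pair_def
proof (intro conjI allI impI exI)
  fix t :: real assume t: "t > 0"
  hence a: "pi * t > 0" by simp
  show "S3 t > 0" using S3_bounds[OF t] by linarith
  show "S2 t > 0" using S2_bounds(1)[OF t] by (smt (verit) exp_gt_zero)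
  show "S3 t = S3 (2 * t) + S2 (2 * t)" using Psech_double(1)[OF a] by (simp add: S3_def S2_def mult_ac)
  show "S2 t ^ 2 = 4 * S3 (2 * t) * S2 (2 * t)" using Psech_half_square_eq[OF a] by (simp add: S3_def S2_def mult_ac)
next
  show "(S3 \<longlongrightarrow> 1) at_top" by (rule tendsto_1_of_bounds[OF S3_bounds])
  show "(0::real) < 2" by simp
  fix t :: real assume t: "t \<ge> 1"
  show "2 * exp (- pi * t / 2) \<le> S2 t" using S2_bounds t by simp
  have "S2 t \<le> 4 * exp (- pi * t / 2) * (1 / (1 - exp (- pi * t)))" using S2_bounds t by simp
  also have "\<dots> \<le> 4 * exp (- pi * t / 2) * 2" using exp_neg_pi_le[OF t] by (intro mult_left_mono) auto
  finally show "S2 t \<le> 8 * exp (- pi * t / 2)" by simp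
qed

text \<open>With $c = \pi t$, \<open>gauss c 0\<close>, \<open>gauss c (1/2)\<close> and \<open>gauss4 c\<close> are $\theta_3$, $\theta_2$ and $\theta_4$.\<close>

definition gauss :: "real \<Rightarrow> real \<Rightarrow> real" where
  "gauss c x = (\<Sum>\<^sub>\<infinity>n::int. exp (- c * (real_of_int n + x) ^ 2))"
definition gauss4 :: "real \<Rightarrow> real" where
  "gauss4 c = (\<Sum>\<^sub>\<infinity>n::int. (if even n then 1 else -1) * exp (- c * (real_of_int n) ^ 2))"

lemma gauss_le_exp:
  assumes "c > 0"
  shows "exp (- c * (real_of_int n + x) ^ 2) \<le> exp (c * (\<bar>x\<bar> + 1/4)) * exp (- c * \<bar>real_of_int n\<bar>)"
proof -
  have "(\<bar>real_of_int n + x\<bar> - 1/2) ^ 2 \<ge> 0" by simp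
  hence "(real_of_int n + x) ^ 2 \<ge> \<bar>real_of_int n + x\<bar> - 1/4"
    unfolding power2_diff by (simp add: power2_eq_square)
  hence "\<bar>real_of_int n\<bar> - \<bar>x\<bar> - 1/4 \<le> (real_of_int n + x) ^ 2" by linarith
  hence "c * (\<bar>real_of_int n\<bar> - \<bar>x\<bar> - 1/4) \<le> c * (real_of_int n + x) ^ 2" using assms by simp
  thus ?thesis by (simp add: algebra_simps flip: exp_add)
qed

lemma has_sum_gauss:
  assumes "c > 0" shows "((\<lambda>n. exp (- c * (real_of_int n + x) ^ 2)) has_sum gauss c x) UNIV"
  unfolding gauss_def
proof (rule has_sum_infsum, rule summable_on_comparison_test)
  show "(\<lambda>n. exp (c * (\<bar>x\<bar> + 1/4)) * exp (- c * \<bar>real_of_int n\<bar>)) summable_on UNIV"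
    by (intro summable_on_cmult_right summable_exp_int assms)
qed (use gauss_le_exp[OF assms] in auto)

lemma has_sum_gauss4:
  assumes "c > 0" shows "((\<lambda>n::int. (if even n then 1 else -1) * exp (- c * (real_of_int n) ^ 2)) has_sum gauss4 c) UNIV"
  unfolding gauss4_def
proof (rule has_sum_infsum, rule abs_summable_summable)
  have "(\<lambda>n::int. norm ((if even n then 1 else -1) * exp (- c * (real_of_int n) ^ 2))) = (\<lambda>n. exp (- c * (real_of_int n + 0) ^ 2))"
    by (auto simp: fun_eq_iff)
  thus "(\<lambda>n::int. norm ((if even n then 1 else -1) * exp (- c * (real_of_int n) ^ 2))) summable_on UNIV"
    using has_sum_imp_summable[OF has_sum_gauss[OF assms, of 0]] by simp
qed

text \<open>Pairs are sorted by the parity of p + q and rotated by 45 degrees, so that a sum of two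
  squares becomes twice a sum of two squares.\<close>

lemma has_sum_lattice_split:
  fixes f :: "int \<times> int \<Rightarrow> real"
  assumes "((\<lambda>(u,v). f (u + v, u - v)) has_sum x) (UNIV \<times> UNIV)"
    and "((\<lambda>(u,v). f (u + v + 1, u - v)) has_sum y) (UNIV \<times> UNIV)"
  shows "(f has_sum (x + y)) (UNIV \<times> UNIV)"
proof -
  have e: "(p + q) div 2 + (p - q) div 2 = p" "(p + q) div 2 - (p - q) div 2 = q" if "even (p + q)" for p q :: int
    using that by presburger+
  have o: "(p + q - 1) div 2 + (p - q - 1) div 2 + 1 = p" "(p + q - 1) div 2 - (p - q - 1) div 2 = q" if "odd (p + q)" for p q :: int
    using that by presburger+
  have p: "even (u + v + (u - v))" "odd (u + v + 1 + (u - v))" for u v :: int by presburger+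
  have d: "(u + v + (u - v)) div 2 = u" "(u + v - (u - v)) div 2 = v"
     "(u + v + 1 + (u - v) - 1) div 2 = u" "(u + v + 1 - (u - v) - 1) div 2 = v" for u v :: int by presburger+
  have 1: "(f has_sum x) {(p,q). even (p + q)}"
    using assms(1) by (subst (asm) has_sum_reindex_bij_witness
       [where i = "\<lambda>(p,q). ((p + q) div 2, (p - q) div 2)" and j = "\<lambda>(u,v). (u + v, u - v)" and T = "{(p,q). even (p + q)}" and h = f and s' = x])
      (auto simp only: e p d split_beta fst_conv snd_conv mem_Collect_eq mem_Times_iff UNIV_I prod.collapse)
  have 2: "(f has_sum y) {(p,q). odd (p + q)}"
    using assms(2) by (subst (asm) has_sum_reindex_bij_witness
       [where i = "\<lambda>(p,q). ((p + q - 1) div 2, (p - q - 1) div 2)" and j = "\<lambda>(u,v). (u + v + 1, u - v)" and T = "{(p,q). odd (p + q)}" and h = f and s' = y])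
      (auto simp only: not_False_eq_True o p d split_beta fst_conv snd_conv mem_Collect_eq mem_Times_iff UNIV_I prod.collapse)
  have "{(p,q). even (p + q)} \<union> {(p,q). odd (p + q)} = (UNIV \<times> UNIV :: (int \<times> int) set)" by auto
  with has_sum_Un_disjoint[OF 1 2] show ?thesis by auto
qed

text \<open>The rotation doubles c. From shift 0 the odd class acquires the shifts 1/2 and 1/2, and
  for theta_4 the sign -1. From shift 1/2 the even class acquires 1/2 and 0, the odd class 1 and
  1/2.\<close>

lemma gauss_double:
  assumes c: "c > 0"
  shows "gauss c 0 ^ 2 = gauss (2 * c) 0 ^ 2 + gauss (2 * c) (1/2) ^ 2"
    and "gauss4 c ^ 2 = gauss (2 * c) 0 ^ 2 - gauss (2 * c) (1/2) ^ 2"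
    and "gauss c (1/2) ^ 2 = 2 * gauss (2 * c) 0 * gauss (2 * c) (1/2)"
proof -
  have c2: "2 * c > 0" using c by simp
  let ?G = "\<lambda>(x,y). \<lambda>(u::int,v::int). exp (- (2 * c) * (real_of_int u + x) ^ 2) * exp (- (2 * c) * (real_of_int v + y) ^ 2)"
  have G: "(?G (x,y) has_sum (gauss (2 * c) x * gauss (2 * c) y)) (UNIV \<times> UNIV)" for x y
    using has_sum_prod_real[OF has_sum_gauss[OF c2, of x] has_sum_gauss[OF c2, of y]] by simp
  let ?F = "\<lambda>x. \<lambda>(p::int,q::int). exp (- c * (real_of_int p + x) ^ 2) * exp (- c * (real_of_int q + x) ^ 2)"
  have F: "(?F x has_sum (gauss c x ^ 2)) (UNIV \<times> UNIV)" for x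
    using has_sum_prod_real[OF has_sum_gauss[OF c, of x] has_sum_gauss[OF c, of x]] by (simp add: power2_eq_square)
  have 1: "(\<lambda>(u,v). ?F 0 (u + v, u - v)) = ?G (0,0)" "(\<lambda>(u,v). ?F 0 (u + v + 1, u - v)) = ?G (1/2,1/2)"
    by (auto simp: fun_eq_iff power2_eq_square algebra_simps simp flip: exp_add)
  have "(?F 0 has_sum (gauss (2 * c) 0 * gauss (2 * c) 0 + gauss (2 * c) (1/2) * gauss (2 * c) (1/2))) (UNIV \<times> UNIV)"
    by (rule has_sum_lattice_split; unfold 1; rule G)
  from has_sum_unique[OF F[of 0] this] show "gauss c 0 ^ 2 = gauss (2 * c) 0 ^ 2 + gauss (2 * c) (1/2) ^ 2"
    by (simp add: power2_eq_square)
  let ?s = "\<lambda>n::int. if even n then 1 else - 1 :: real"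
  let ?H = "\<lambda>(p::int,q::int). (?s p * exp (- c * (real_of_int p) ^ 2)) * (?s q * exp (- c * (real_of_int q) ^ 2))"
  have RZ: "(?H has_sum (gauss4 c ^ 2)) (UNIV \<times> UNIV)"
    using has_sum_prod_real[OF has_sum_gauss4[OF c] has_sum_gauss4[OF c]] by (simp add: power2_eq_square)
  have 2: "(\<lambda>(u,v). ?H (u + v, u - v)) = ?G (0,0)" "(\<lambda>(u,v). ?H (u + v + 1, u - v)) = (\<lambda>p. - ?G (1/2,1/2) p)"
    by (auto simp: fun_eq_iff power2_eq_square algebra_simps simp flip: exp_add)
  have "(?H has_sum (gauss (2 * c) 0 * gauss (2 * c) 0 + - (gauss (2 * c) (1/2) * gauss (2 * c) (1/2)))) (UNIV \<times> UNIV)"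
    by (rule has_sum_lattice_split; unfold 2; (rule G | rule has_sum_uminusI[OF G]))
  from has_sum_unique[OF RZ this] show "gauss4 c ^ 2 = gauss (2 * c) 0 ^ 2 - gauss (2 * c) (1/2) ^ 2"
    by (simp add: power2_eq_square)
  have 3: "(\<lambda>(u,v). ?F (1/2) (u + v, u - v)) = ?G (1/2,0)" "(\<lambda>(u,v). ?F (1/2) (u + v + 1, u - v)) = ?G (1,1/2)"
    by (auto simp: fun_eq_iff power2_eq_square algebra_simps simp flip: exp_add)
  \<comment> \<open>The odd class has shifted u by a full period.\<close>
  have gauss_1: "gauss (2 * c) 1 = gauss (2 * c) 0"
  proof -
    have "((\<lambda>n. exp (- (2 * c) * (real_of_int (n + 1) + 0) ^ 2)) has_sum gauss (2 * c) 0) UNIV"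
      using has_sum_gauss[OF c2, of 0] by (subst has_sum_int_shift[of "\<lambda>n. exp (- (2 * c) * (real_of_int n + 0) ^ 2)"])
    hence "((\<lambda>n. exp (- (2 * c) * (real_of_int n + 1) ^ 2)) has_sum gauss (2 * c) 0) UNIV" by simp
    with has_sum_gauss[OF c2, of 1] show ?thesis by (rule has_sum_unique)
  qed
  have "(?F (1/2) has_sum (gauss (2 * c) (1/2) * gauss (2 * c) 0 + gauss (2 * c) 1 * gauss (2 * c) (1/2))) (UNIV \<times> UNIV)"
    by (rule has_sum_lattice_split; unfold 3; rule G)
  from has_sum_unique[OF F[of "1/2"] this] gauss_1 show "gauss c (1/2) ^ 2 = 2 * gauss (2 * c) 0 * gauss (2 * c) (1/2)"
    by simp
qed

lemma gauss0_bounds: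
  assumes "c > 0" shows "1 \<le> gauss c 0" "gauss c 0 \<le> 1 + 2 * exp (- c) / (1 - exp (- c))"
proof -
  have le: "exp (- c * (real_of_int n + 0) ^ 2) \<le> 1 * exp (- c * \<bar>real_of_int n\<bar>)" for n
  proof -
    have "\<bar>n\<bar> \<le> n ^ 2"
    proof (cases "n = 0")
      case False
      hence "\<bar>n\<bar> * 1 \<le> \<bar>n\<bar> * \<bar>n\<bar>" by (intro mult_left_mono) auto
      thus ?thesis by (simp add: power2_eq_square)
    qed simp
    hence "\<bar>real_of_int n\<bar> \<le> (real_of_int n) ^ 2" by (metis of_int_abs of_int_le_iff of_int_power)
    thus ?thesis using assms by simp
  qed
  show "1 \<le> gauss c 0" "gauss c 0 \<le> 1 + 2 * exp (- c) / (1 - exp (- c))"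
    using has_sum_int_near_one[OF has_sum_gauss[OF assms] assms _ _ le] by auto
qed

lemma gauss_half_bounds:
  assumes "c > 0" shows "2 * exp (- c / 4) \<le> gauss c (1/2)" "gauss c (1/2) \<le> 2 * exp (- c / 4) * (1 / (1 - exp (- c)))"
proof -
  have le: "exp (- c * (real_of_int (int n) + 1/2) ^ 2) \<le> exp (- c / 4) * exp (- c * real n)" for n
  proof -
    have "real n + 1/4 \<le> (real n + 1/2) ^ 2" by (simp add: power2_eq_square algebra_simps)
    hence "c * (real n + 1/4) \<le> c * (real n + 1/2) ^ 2" using assms by simp
    thus ?thesis by (simp add: algebra_simps flip: exp_add)
  qed
  have sym: "exp (- c * (real_of_int (-1 - n) + 1/2) ^ 2) = exp (- c * (real_of_int n + 1/2) ^ 2)" for n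
    by (simp add: power2_eq_square algebra_simps)
  note B = has_sum_int_half_bounds[OF has_sum_gauss[OF assms] assms sym _ le]
  show "2 * exp (- c / 4) \<le> gauss c (1/2)" "gauss c (1/2) \<le> 2 * exp (- c / 4) * (1 / (1 - exp (- c)))"
    using B by (auto simp: power2_eq_square)
qed

lemma landen_pair_gauss: "landen_pair (\<lambda>t. gauss (pi * t) 0 ^ 2) (\<lambda>t. gauss (pi * t) (1/2) ^ 2)"
  unfolding landen_pair_def
proof (intro conjI allI impI exI)
  fix t :: real assume t: "t > 0"
  hence a: "pi * t > 0" by simp
  show "gauss (pi * t) 0 ^ 2 > 0" using gauss0_bounds[OF a] by simp
  show "gauss (pi * t) (1/2) ^ 2 > 0" using gauss_half_bounds(1)[OF a] by (smt (verit) exp_gt_zero zero_less_power)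
  have e: "2 * (pi * t) = pi * (2 * t)" by simp
  show "gauss (pi * t) 0 ^ 2 = gauss (pi * (2 * t)) 0 ^ 2 + gauss (pi * (2 * t)) (1/2) ^ 2" using gauss_double(1)[OF a] unfolding e .
  show "(gauss (pi * t) (1/2) ^ 2) ^ 2 = 4 * (gauss (pi * (2 * t)) 0)\<^sup>2 * (gauss (pi * (2 * t)) (1/2)) ^ 2"
    unfolding gauss_double(3)[OF a] e by (simp add: power2_eq_square)
next
  have "((\<lambda>t. gauss (pi * t) 0) \<longlongrightarrow> 1) at_top"
    by (rule tendsto_1_of_bounds[where C = 2]) (use gauss0_bounds[of "pi * _"] in \<open>simp_all\<close>)
  from tendsto_power[OF this, of 2] show "((\<lambda>t. gauss (pi * t) 0 ^ 2) \<longlongrightarrow> 1) at_top" by simp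
  show "(0::real) < 4" by simp
  fix t :: real assume t: "t \<ge> 1"
  hence a: "pi * t > 0" by simp
  have e: "exp (- pi * t / 2) = exp (- (pi * t) / 4) ^ 2" by (simp flip: exp_of_nat_mult)
  have "(2 * exp (- (pi * t) / 4)) ^ 2 \<le> gauss (pi * t) (1/2) ^ 2"
    by (intro power_mono gauss_half_bounds a) simp
  thus "4 * exp (- pi * t / 2) \<le> gauss (pi * t) (1/2) ^ 2" unfolding e power_mult_distrib by simp
  have "gauss (pi * t) (1/2) \<le> 2 * exp (- (pi * t) / 4) * (1 / (1 - exp (- (pi * t))))" by (rule gauss_half_bounds[OF a])
  also have "\<dots> \<le> 2 * exp (- (pi * t) / 4) * 2" by (intro mult_left_mono exp_neg_pi_le t) simp
  finally have "gauss (pi * t) (1/2) ^ 2 \<le> (2 * exp (- (pi * t) / 4) * 2) ^ 2"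
    using gauss_half_bounds(1)[OF a] exp_ge_zero[of "- (pi * t) / 4"] by (intro power_mono) linarith+
  thus "gauss (pi * t) (1/2) ^ 2 \<le> 16 * exp (- pi * t / 2)" unfolding e power_mult_distrib by simp
qed

text \<open>This is $\theta_4^2$; the definition avoids alternating series.\<close>

definition S4 :: "real \<Rightarrow> real" where "S4 t = S3 (2 * t) - S2 (2 * t)"

text \<open>Jacobi's two-square theorem in analytic form. Both pairs satisfy the Landen recursion
  with the same behaviour at infinity, so uniqueness applies; theta_4^2 then follows from the
  doubling formula.\<close>

lemma S_eq_gauss:
  assumes "t > 0"
  shows "S3 t = gauss (pi * t) 0 ^ 2" "S2 t = gauss (pi * t) (1/2) ^ 2" "S4 t = gauss4 (pi * t) ^ 2"
proof -
  have *: "S3 t = gauss (pi * t) 0 ^ 2" "S2 t = gauss (pi * t) (1/2) ^ 2" if "t > 0" for t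
    by (rule landen_pair_unique[OF landen_pair_S landen_pair_gauss that])+
  have t2: "2 * t > 0" and a: "pi * t > 0" using assms by auto
  show "S4 t = gauss4 (pi * t) ^ 2" using gauss_double(2)[OF a] unfolding S4_def *[OF t2] by (simp add: mult_ac)
  show "S3 t = gauss (pi * t) 0 ^ 2" "S2 t = gauss (pi * t) (1/2) ^ 2" by (rule *[OF assms])+
qed

lemma S_pos: assumes "t > 0" shows "S3 t > 0" "S2 t > 0"
  using landen_pairD(1,2)[OF landen_pair_S assms] by auto

text \<open>The last two are theta_3^2 theta_4^2(q) = theta_4^4(q^2) and Jacobi's theta_3^4 =
  theta_2^4 + theta_4^4. Both reduce to algebra in the values at the doubled argument.\<close>

lemma S_double:
  assumes "t > 0"
  shows "S3 t = S3 (2 * t) + S2 (2 * t)" "S2 t ^ 2 = 4 * S3 (2 * t) * S2 (2 * t)" "S4 t = S3 (2 * t) - S2 (2 * t)"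
    "S3 t * S4 t = S4 (2 * t) ^ 2" "S3 t ^ 2 = S2 t ^ 2 + S4 t ^ 2"
proof -
  have 1: "S3 t = S3 (2 * t) + S2 (2 * t)" "S2 t ^ 2 = 4 * S3 (2 * t) * S2 (2 * t)" "S4 t = S3 (2 * t) - S2 (2 * t)"
    if "t > 0" for t by (rule landen_pairD(3,4)[OF landen_pair_S that])+ (rule S4_def)
  have 2: "S3 t ^ 2 = S2 t ^ 2 + S4 t ^ 2" if "t > 0" for t
    unfolding 1(2)[OF that] unfolding 1(1,3)[OF that] by (simp add: power2_eq_square algebra_simps)
  have "2 * t > 0" using assms by simp
  from 2[OF this] show "S3 t * S4 t = S4 (2 * t) ^ 2" unfolding 1(1,3)[OF assms] by (simp add: power2_eq_square algebra_simps)
  show "S3 t = S3 (2 * t) + S2 (2 * t)" "S2 t ^ 2 = 4 * S3 (2 * t) * S2 (2 * t)" "S4 t = S3 (2 * t) - S2 (2 * t)"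
    "S3 t ^ 2 = S2 t ^ 2 + S4 t ^ 2" by (rule 1[OF assms] 2[OF assms])+
qed

text \<open>A zero at t would propagate to all 2^n t by S3 S4 = S4(2t)^2, hence S3 = S2 at
  arbitrarily large arguments. But S3 is at least 1 and S2 tends to 0.\<close>

lemma S4_pos: assumes "t > 0" shows "S4 t > 0"
proof -
  have nn: "S4 t \<ge> 0" if "t > 0" for t unfolding S_eq_gauss(3)[OF that] by simp
  have "S4 t \<noteq> 0"
  proof
    assume z: "S4 t = 0"
    have "S4 (2 ^ n * t) = 0" for n
    proof (induction n)
      case (Suc n)
      thus ?case using S_double(4)[of "2 ^ n * t"] assms by (simp add: mult_ac)
    qed (use z in simp)
    hence eq: "S3 (2 * (2 ^ n * t)) = S2 (2 * (2 ^ n * t))" for n by (simp add: S4_def)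
    have "((\<lambda>t. 4 * exp (- pi * t / 2) * (1 / (1 - exp (- pi * t)))) \<longlongrightarrow> 0) at_top" by real_asymp
    from order_tendstoD(2)[OF this, of 1] have "\<forall>\<^sub>F t in at_top. 4 * exp (- pi * t / 2) * (1 / (1 - exp (- pi * t))) < 1" by simp
    hence "\<forall>\<^sub>F t in at_top. S2 t < S3 t" using eventually_gt_at_top[of 0]
    proof eventually_elim
      case (elim t)
      thus ?case using S2_bounds(2)[OF elim(2)] S3_bounds(1)[OF elim(2)] by linarith
    qed
    hence "\<forall>\<^sub>F n in sequentially. S2 (2 ^ n * (2 * t)) < S3 (2 ^ n * (2 * t))"
      by (rule eventually_compose_filterlim[OF _ filterlim_doubling]) (use assms in simp)
    then obtain n where "S2 (2 ^ n * (2 * t)) < S3 (2 ^ n * (2 * t))"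
      using eventually_happens'[OF sequentially_bot] by blast
    with eq[of n] show False by (simp add: mult_ac)
  qed
  with nn[OF assms] show ?thesis by simp
qed

section \<open>The complete elliptic integral and the inversion of the theta functions\<close>

text \<open>The normalised central binomial coefficients C(2n,n)/4^n: Taylor coefficients of
  (1-z)^(-1/2), mean values of cos^(2n) and, squared, coefficients of the elliptic integral.\<close>

definition cb :: "nat \<Rightarrow> real" where "cb n = pochhammer (1/2) n / fact n"

lemma cb_0 [simp]: "cb 0 = 1" by (simp add: cb_def)

lemma cb_Suc: "cb (Suc n) = (2 * real n + 1) / (2 * real n + 2) * cb n"
  by (simp add: cb_def pochhammer_Suc field_simps)

lemma cb_pos: "cb n > 0" by (simp add: cb_def pochhammer_pos)

lemma cb_le_1: "cb n \<le> 1"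
proof (induction n)
  case (Suc n)
  have "(2 * real n + 1) / (2 * real n + 2) * cb n \<le> 1 * 1"
    by (intro mult_mono Suc less_imp_le[OF cb_pos]) (auto simp: field_simps)
  thus ?case by (simp add: cb_Suc)
qed simp

text \<open>Only squares of the sum are recorded, as these do not involve the branch of the square
  root.\<close>

lemma cb_complex_sums:
  fixes z :: complex
  assumes z: "norm z < 1"
  shows "summable (\<lambda>n. norm (complex_of_real (cb n) * z ^ n))"
    and "norm (\<Sum>n. complex_of_real (cb n) * z ^ n) ^ 2 = 1 / norm (1 - z)"
    and "(\<Sum>n. complex_of_real (cb n) * z ^ n) ^ 2 = 1 / (1 - z)"
proof -
  show "summable (\<lambda>n. norm (complex_of_real (cb n) * z ^ n))"
  proof (rule summable_comparison_test[OF _ summable_geometric[of "norm z"]])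
    have "norm (norm (complex_of_real (cb n) * z ^ n)) \<le> norm z ^ n" for n
    proof -
      have "norm (norm (complex_of_real (cb n) * z ^ n)) = cb n * norm z ^ n"
        by (simp only: norm_mult norm_power norm_of_real real_norm_def abs_of_pos[OF cb_pos] abs_norm_cancel abs_mult power_abs)
      also have "\<dots> \<le> 1 * norm z ^ n" by (rule mult_right_mono[OF cb_le_1]) simp
      finally show ?thesis by simp
    qed
    thus "\<exists>N. \<forall>n\<ge>N. norm (norm (complex_of_real (cb n) * z ^ n)) \<le> norm z ^ n" by (intro exI allI impI)
  qed (use z in simp)
  have "(\<lambda>n. (-1/2 gchoose n) * (- z) ^ n) sums (1 + - z) powr (-1/2)"
    by (rule gen_binomial_complex) (use z in simp)
  moreover have "(-1/2 gchoose n) * (- z) ^ n = complex_of_real (cb n) * z ^ n" for n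
  proof -
    have "pochhammer (1/2 :: complex) n = of_real (pochhammer (1/2) n)" by (simp flip: pochhammer_of_real)
    moreover have "(-1/2 gchoose n) = (-1) ^ n * pochhammer (1/2 :: complex) n / fact n"
      by (simp add: gbinomial_pochhammer)
    moreover have "(-1) ^ n * (- z) ^ n = z ^ n" by (simp flip: power_mult_distrib)
    ultimately show ?thesis unfolding cb_def of_real_divide of_real_fact
      by (metis (no_types, opaque_lifting) mult.commute mult.left_commute times_divide_eq_left)
  qed
  ultimately have u: "(\<Sum>n. complex_of_real (cb n) * z ^ n) = (1 - z) powr (-1/2)" by (simp add: sums_iff)
  have ne: "1 - z \<noteq> 0" using z by auto
  show sq: "(\<Sum>n. complex_of_real (cb n) * z ^ n) ^ 2 = 1 / (1 - z)"
  proof -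
    have "((1 - z) powr (-1/2)) ^ 2 = (1 - z) powr (-1/2 + -1/2)"
      unfolding power2_eq_square powr_add ..
    also have "\<dots> = 1 / (1 - z)" using ne by (simp add: powr_minus inverse_eq_divide)
    finally show ?thesis using u by simp
  qed
  show "norm (\<Sum>n. complex_of_real (cb n) * z ^ n) ^ 2 = 1 / norm (1 - z)"
    using sq by (metis norm_divide norm_one norm_power)
qed

lemma cb_real_sums:
  fixes y :: real
  assumes y: "0 \<le> y" "y < 1"
  shows "(\<lambda>n. cb n * y ^ n) sums (1 / sqrt (1 - y))"
proof -
  let ?z = "complex_of_real y"
  have z: "norm ?z < 1" using y by simp
  have s: "summable (\<lambda>n. cb n * y ^ n)"
    using cb_complex_sums(1)[OF z] y cb_pos by (simp add: norm_mult norm_power abs_of_pos)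
  have e: "(\<Sum>n. complex_of_real (cb n) * ?z ^ n) = complex_of_real (\<Sum>n. cb n * y ^ n)"
    using suminf_of_real[OF s, where 'a = complex] by simp
  have "complex_of_real ((\<Sum>n. cb n * y ^ n) ^ 2) = complex_of_real (1 / (1 - y))"
    using cb_complex_sums(3)[OF z] unfolding e by simp
  hence "(\<Sum>n. cb n * y ^ n) ^ 2 = 1 / (1 - y)" by (simp only: of_real_eq_iff)
  moreover have "(\<Sum>n. cb n * y ^ n) \<ge> 0"
    by (intro suminf_nonneg s) (use y in \<open>auto intro!: mult_nonneg_nonneg less_imp_le[OF cb_pos]\<close>)
  ultimately have "(\<Sum>n. cb n * y ^ n) = sqrt (1 / (1 - y))" by (metis real_sqrt_unique)
  with s show ?thesis by (simp add: sums_iff real_sqrt_divide)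
qed

text \<open>The Wallis recursion: sin p cos^(2n+1) p vanishes at both ends, and its derivative
  combines two consecutive moments.\<close>

lemma wallis_cos: "((\<lambda>p. cos p ^ (2 * n)) has_integral (pi / 2 * cb n)) {0..pi/2}"
proof (induction n)
  case 0
  show ?case using has_integral_const_real[of "1::real" 0 "pi/2"] by simp
next
  case (Suc n)
  let ?d = "\<lambda>p::real. (2 * real n + 2) * cos p ^ (2 * Suc n) - (2 * real n + 1) * cos p ^ (2 * n)"
  have "(?d has_integral (sin (pi/2) * cos (pi/2) ^ (2 * n + 1) - sin 0 * cos 0 ^ (2 * n + 1))) {0..pi/2}"
  proof (rule fundamental_theorem_of_calculus)
    fix p :: real
    have "((\<lambda>p. sin p * cos p ^ (2 * n + 1)) has_real_derivative
        (cos p * cos p ^ (2 * n + 1) + sin p * (real (2 * n + 1) * cos p ^ (2 * n) * - sin p))) (at p within {0..pi/2})"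
    proof -
      have "((\<lambda>p. cos p ^ (2 * n + 1)) has_real_derivative real (2 * n + 1) * (- sin p * cos p ^ (2 * n))) (at p within {0..pi/2})"
        using DERIV_power[OF has_field_derivative_at_within[OF DERIV_cos, of p "{0..pi/2}"], of "2 * n + 1"] by simp
      from DERIV_mult[OF has_field_derivative_at_within[OF DERIV_sin] this]
      show ?thesis by (rule DERIV_cong) (simp only: mult_ac)
    qed
    moreover have "cos p * cos p ^ (2 * n + 1) + sin p * (real (2 * n + 1) * cos p ^ (2 * n) * - sin p) = ?d p"
    proof -
      define C where "C = (cos p)\<^sup>2"
      have S: "(sin p)\<^sup>2 = 1 - C" by (simp add: C_def sin_squared_eq)
      have 1: "sin p * (real (2 * n + 1) * cos p ^ (2 * n) * - sin p) = - (real (2 * n + 1) * cos p ^ (2 * n) * (1 - C))"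
        unfolding S[symmetric] by (simp add: power2_eq_square)
      have 2: "cos p ^ (2 * Suc n) = C * cos p ^ (2 * n)" "cos p * cos p ^ (2 * n + 1) = C * cos p ^ (2 * n)"
        unfolding C_def by (simp_all add: power2_eq_square)
      show ?thesis unfolding 1 2 by (simp add: algebra_simps)
    qed
    ultimately show "((\<lambda>p. sin p * cos p ^ (2 * n + 1)) has_vector_derivative ?d p) (at p within {0..pi/2})"
      by (simp only: has_real_derivative_iff_has_vector_derivative)
  qed simp
  hence "(?d has_integral 0) {0..pi/2}" by simp
  from has_integral_add[OF this has_integral_mult_right[OF Suc, of "2 * real n + 1"]]
  have "((\<lambda>p. (2 * real n + 2) * cos p ^ (2 * Suc n)) has_integral ((2 * real n + 1) * (pi / 2 * cb n))) {0..pi/2}"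
    by simp
  from has_integral_mult_right[OF this, of "1 / (2 * real n + 2)"]
  have "((\<lambda>p. cos p ^ (2 * Suc n)) has_integral (1 / (2 * real n + 2) * ((2 * real n + 1) * (pi / 2 * cb n)))) {0..pi/2}"
    by simp
  also have "1 / (2 * real n + 2) * ((2 * real n + 1) * (pi / 2 * cb n)) = pi / 2 * cb (Suc n)"
    by (simp add: cb_Suc)
  finally show ?case .
qed

text \<open>Termwise integration by the Weierstrass M-test. The value J stays existential; it is
  identified afterwards from the series of integrals, by uniqueness of sums.\<close>

lemma has_integral_sums_real:
  fixes f :: "nat \<Rightarrow> real \<Rightarrow> real"
  assumes c: "\<And>n. continuous_on {l..u} (f n)" and M: "\<And>n x. x \<in> {l..u} \<Longrightarrow> \<bar>f n x\<bar> \<le> M n" "summable M"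
    and I: "\<And>n. (f n has_integral I n) {l..u}" and G: "\<And>x. x \<in> {l..u} \<Longrightarrow> (\<lambda>n. f n x) sums G x"
  shows "\<exists>J. (G has_integral J) {l..u} \<and> I sums J"
proof -
  have "uniform_limit {l..u} (\<lambda>n x. \<Sum>i<n. f i x) (\<lambda>x. \<Sum>i. f i x) sequentially"
    by (rule Weierstrass_m_test) (use M in auto)
  from uniform_limit_integral[OF this] obtain I' J where
    *: "\<And>n. ((\<lambda>x. \<Sum>i<n. f i x) has_integral I' n) {l..u}" "((\<lambda>x. \<Sum>i. f i x) has_integral J) {l..u}" "I' \<longlonglongrightarrow> J"
    using c by (auto intro!: continuous_on_sum)
  have "I' n = (\<Sum>i<n. I i)" for n
    using *(1)[of n] has_integral_sum[of "{..<n}" f I "{l..u}"] I by (auto intro: has_integral_unique)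
  hence "I' = (\<lambda>n. \<Sum>i<n. I i)" by (rule ext)
  with *(3) have "I sums J" unfolding sums_def by (simp only:)
  moreover have "(G has_integral J) {l..u}"
    using *(2) by (rule has_integral_eq[rotated]) (use G in \<open>auto simp: sums_iff\<close>)
  ultimately show ?thesis by blast
qed

text \<open>$(2/\pi) K(k)$ with $y = k^2$.\<close>

definition ell :: "real \<Rightarrow> real" where "ell y = (\<Sum>n. cb n ^ 2 * y ^ n)"

lemma ell_sums: assumes "0 \<le> y" "y < 1" shows "(\<lambda>n. cb n ^ 2 * y ^ n) sums ell y"
  unfolding ell_def
proof (rule summable_sums, rule summable_comparison_test[OF _ summable_geometric[of y]])
  have "cb n ^ 2 \<le> 1" for n using cb_le_1[of n] less_imp_le[OF cb_pos[of n]] by (simp add: power_le_one)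
  thus "\<exists>N. \<forall>n\<ge>N. norm (cb n ^ 2 * y ^ n) \<le> y ^ n"
    using assms by (auto simp: abs_mult intro!: mult_left_le_one_le)
qed (use assms in simp)

lemma cos_multiple_integral:
  "((\<lambda>p. cos (2 * real_of_int m * p)) has_integral (if m = 0 then pi / 2 else 0)) {0..pi/2}"
proof (cases "m = 0")
  case True
  thus ?thesis using has_integral_const_real[of "1::real" 0 "pi/2"] by simp
next
  case False
  have "((\<lambda>p. cos (2 * real_of_int m * p)) has_integral
     (sin (2 * real_of_int m * (pi/2)) / (2 * real_of_int m) - sin (2 * real_of_int m * 0) / (2 * real_of_int m))) {0..pi/2}"
    by (rule fundamental_theorem_of_calculus)
      (use False in \<open>auto intro!: derivative_eq_intros simp flip: has_real_derivative_iff_has_vector_derivative\<close>)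
  moreover have "sin (2 * real_of_int m * (pi/2)) = 0" by (simp add: sin_zero_iff_int2)
  ultimately show ?thesis using False by simp
qed

lemma sum_if_double: "(\<Sum>i\<le>(n::nat). if 2 * i = n then f i else 0) = (if even n then f (n div 2) else (0::real))"
proof (cases "even n")
  case True
  then obtain m where m: "n = 2 * m" by (elim evenE)
  have "(\<Sum>i\<le>n. if 2 * i = n then f i else 0) = (\<Sum>i\<le>n. if i = m then f i else 0)"
    by (intro sum.cong) (auto simp: m)
  also have "\<dots> = f m" by (subst sum.delta) (auto simp: m)
  finally show ?thesis using m by simp
next
  case False
  hence "(\<Sum>i\<le>n. if 2 * i = n then f i else 0) = 0" by (intro sum.neutral) auto
  with False show ?thesis by simp
qed

text \<open>Parseval for $(1-z)^{-1/2}$ on the circle $|z| = x$. The integrand is also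
  $(1+x)^{-1} (1 - m \cos^2 p)^{-1/2}$ with $m = 4x/(1+x)^2$, which gives Landen's transformation.\<close>

lemma ell_parseval:
  assumes x: "0 \<le> x" "x < 1"
  shows "((\<lambda>p. 1 / cmod (1 - of_real x * cis (2 * p))) has_integral (pi / 2 * ell (x ^ 2))) {0..pi/2}"
proof -
  let ?I = "\<lambda>n. if even n then pi / 2 * (cb (n div 2) ^ 2 * x ^ n) else 0"
  \<comment> \<open>Terms of the Cauchy product of the series at z and at its conjugate, by total
    degree n. The index i carries the frequency 2i - n, so only 2i = n survives integration.\<close>
  let ?f = "\<lambda>n p. \<Sum>i\<le>n. cb i * cb (n - i) * x ^ n * cos (2 * real_of_int (2 * int i - int n) * p)"
  have "\<exists>J. ((\<lambda>p. 1 / cmod (1 - of_real x * cis (2 * p))) has_integral J) {0..pi/2} \<and> ?I sums J"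
  proof (rule has_integral_sums_real[where f = ?f and M = "\<lambda>n. real (Suc n) * x ^ n"])
    show "continuous_on {0..pi/2} (?f n)" for n by (intro continuous_intros)
    show "summable (\<lambda>n. real (Suc n) * x ^ n)" using geometric_deriv_sums[of x] x by (simp add: sums_iff)
    show "\<bar>?f n p\<bar> \<le> real (Suc n) * x ^ n" for n p
    proof -
      have "\<bar>?f n p\<bar> \<le> (\<Sum>i\<le>n. x ^ n)"
      proof (rule order_trans[OF sum_abs sum_mono])
        fix i
        have "cb i * cb (n - i) * x ^ n * \<bar>cos (2 * real_of_int (2 * int i - int n) * p)\<bar> \<le> 1 * 1 * x ^ n * 1"
          by (intro mult_mono mult_nonneg_nonneg cb_le_1 less_imp_le[OF cb_pos]) (use x in auto)
        thus "\<bar>cb i * cb (n - i) * x ^ n * cos (2 * real_of_int (2 * int i - int n) * p)\<bar> \<le> x ^ n"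
          using x by (simp add: abs_mult abs_of_pos cb_pos)
      qed
      thus ?thesis by simp
    qed
    show "(?f n has_integral ?I n) {0..pi/2}" for n
    proof -
      have "(?f n has_integral (\<Sum>i\<le>n. cb i * cb (n - i) * x ^ n * (if 2 * int i - int n = 0 then pi / 2 else 0))) {0..pi/2}"
        by (intro has_integral_sum has_integral_mult_right cos_multiple_integral) simp
      also have "(\<Sum>i\<le>n. cb i * cb (n - i) * x ^ n * (if 2 * int i - int n = 0 then pi / 2 else 0))
         = (\<Sum>i\<le>n. if 2 * i = n then pi / 2 * (cb i ^ 2 * x ^ n) else 0)"
        by (intro sum.cong) (auto simp: power2_eq_square)
      finally show ?thesis unfolding sum_if_double .
    qed
    fix p :: real
    let ?z = "of_real x * cis (2 * p)"
    have z: "norm ?z < 1" using x by (simp add: norm_mult)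
    have zc: "norm (cnj ?z) < 1" using z by (simp only: complex_mod_cnj)
    let ?u = "\<lambda>z. \<Sum>n. complex_of_real (cb n) * z ^ n"
    have cj: "?u (cnj ?z) = cnj (?u ?z)"
    proof -
      have "(\<lambda>n. complex_of_real (cb n) * ?z ^ n) sums ?u ?z"
        by (intro summable_sums summable_norm_cancel[OF cb_complex_sums(1)[OF z]])
      hence "(\<lambda>n. cnj (complex_of_real (cb n) * ?z ^ n)) sums cnj (?u ?z)" by (simp only: sums_cnj)
      thus ?thesis by (simp add: sums_iff)
    qed
    have "(\<lambda>n. \<Sum>i\<le>n. (complex_of_real (cb i) * ?z ^ i) * (complex_of_real (cb (n - i)) * cnj ?z ^ (n - i))) sums (?u ?z * ?u (cnj ?z))"
      by (rule Cauchy_product_sums[OF cb_complex_sums(1)[OF z] cb_complex_sums(1)[OF zc]])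
    hence "(\<lambda>n. Re (\<Sum>i\<le>n. (complex_of_real (cb i) * ?z ^ i) * (complex_of_real (cb (n - i)) * cnj ?z ^ (n - i)))) sums Re (?u ?z * ?u (cnj ?z))"
      by (rule sums_Re)
    moreover have "Re (?u ?z * ?u (cnj ?z)) = 1 / cmod (1 - ?z)"
      unfolding cj cb_complex_sums(2)[OF z, symmetric] by (simp flip: complex_norm_square)
    moreover have "Re (\<Sum>i\<le>n. (complex_of_real (cb i) * ?z ^ i) * (complex_of_real (cb (n - i)) * cnj ?z ^ (n - i))) = ?f n p" for n
    proof -
      have "Re ((complex_of_real (cb i) * ?z ^ i) * (complex_of_real (cb (n - i)) * cnj ?z ^ (n - i)))
        = cb i * cb (n - i) * x ^ n * cos (2 * real_of_int (2 * int i - int n) * p)" if "i \<le> n" for i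
      proof -
        have "(complex_of_real (cb i) * ?z ^ i) * (complex_of_real (cb (n - i)) * cnj ?z ^ (n - i))
          = of_real (cb i * cb (n - i) * (x ^ i * x ^ (n - i))) * (cis (2 * p) ^ i * cis (- (2 * p)) ^ (n - i))"
          by (simp add: power_mult_distrib cis_cnj)
        also have "x ^ i * x ^ (n - i) = x ^ n" using that by (simp flip: power_add)
        also have "cis (2 * p) ^ i * cis (- (2 * p)) ^ (n - i) = cis (2 * real_of_int (2 * int i - int n) * p)"
        proof -
          have "real i * (2 * p) + real (n - i) * - (2 * p) = 2 * real_of_int (2 * int i - int n) * p"
            using that by (simp add: of_nat_diff algebra_simps)
          moreover have "cis (2 * p) ^ i * cis (- (2 * p)) ^ (n - i) = cis (real i * (2 * p) + real (n - i) * - (2 * p))"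
            by (simp only: Complex.DeMoivre cis_mult)
          ultimately show ?thesis by simp
        qed
        finally have E: "(complex_of_real (cb i) * ?z ^ i) * (complex_of_real (cb (n - i)) * cnj ?z ^ (n - i))
          = of_real (cb i * cb (n - i) * x ^ n) * cis (2 * real_of_int (2 * int i - int n) * p)" .
        show ?thesis unfolding E by simp
      qed
      thus ?thesis unfolding Re_sum by (intro sum.cong) auto
    qed
    ultimately show "(\<lambda>n. ?f n p) sums (1 / cmod (1 - ?z))" by simp
  qed
  then obtain J where J: "((\<lambda>p. 1 / cmod (1 - of_real x * cis (2 * p))) has_integral J) {0..pi/2}" "?I sums J" by blast
  have "x ^ 2 < 1" using x by (simp add: power_less_one_iff)
  hence "(\<lambda>m. pi / 2 * (cb m ^ 2 * (x ^ 2) ^ m)) sums (pi / 2 * ell (x ^ 2))"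
    by (intro sums_mult ell_sums) simp
  also have "(\<lambda>m. pi / 2 * (cb m ^ 2 * (x ^ 2) ^ m)) = (\<lambda>m. ?I (2 * m))" by (simp add: power_mult)
  also have "\<dots> sums (pi / 2 * ell (x ^ 2)) \<longleftrightarrow> ?I sums (pi / 2 * ell (x ^ 2))"
    by (rule sums_mono_reindex) (auto simp: strict_mono_def elim!: evenE)
  finally have "?I sums (pi / 2 * ell (x ^ 2))" .
  with J(2) have "J = pi / 2 * ell (x ^ 2)" by (rule sums_unique2)
  with J(1) show ?thesis by simp
qed

text \<open>One integral computed twice: expanding 1/sqrt(1 - m cos^2 p) with the Wallis moments
  gives the left side, Parseval the right side.\<close>

lemma ell_landen:
  assumes x: "0 \<le> x" "x < 1"
  shows "ell (4 * x / (1 + x) ^ 2) = (1 + x) * ell (x ^ 2)"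
proof -
  let ?m = "4 * x / (1 + x) ^ 2"
  have m: "0 \<le> ?m" "?m < 1"
  proof -
    have "(1 - x) ^ 2 > 0" using x by simp
    hence "4 * x < (1 + x) ^ 2" by (simp add: power2_eq_square algebra_simps)
    thus "?m < 1" using x by (simp add: divide_less_eq)
  qed (use x in simp)
  have "\<exists>J. ((\<lambda>p. 1 / sqrt (1 - ?m * cos p ^ 2)) has_integral J) {0..pi/2} \<and> (\<lambda>n. cb n * ?m ^ n * (pi / 2 * cb n)) sums J"
  proof (rule has_integral_sums_real[where f = "\<lambda>n p. cb n * ?m ^ n * cos p ^ (2 * n)" and M = "\<lambda>n. ?m ^ n"])
    show "continuous_on {0..pi/2} (\<lambda>p. cb n * ?m ^ n * cos p ^ (2 * n))" for n by (intro continuous_intros)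
    show "summable (\<lambda>n. ?m ^ n)" using m by (intro summable_geometric) simp
    show "((\<lambda>p. cb n * ?m ^ n * cos p ^ (2 * n)) has_integral cb n * ?m ^ n * (pi / 2 * cb n)) {0..pi/2}" for n
      by (intro has_integral_mult_right wallis_cos)
    fix p :: real
    have c: "cos p ^ 2 \<le> 1" by (simp add: abs_square_le_1)
    show "\<bar>cb n * ?m ^ n * cos p ^ (2 * n)\<bar> \<le> ?m ^ n" for n
    proof -
      have "cb n * ?m ^ n * (cos p ^ 2) ^ n \<le> 1 * ?m ^ n * 1"
        by (intro mult_mono cb_le_1 power_le_one c) (use m in \<open>auto intro!: mult_nonneg_nonneg less_imp_le[OF cb_pos]\<close>)
      moreover have "\<bar>cb n * ?m ^ n * cos p ^ (2 * n)\<bar> = cb n * ?m ^ n * (cos p ^ 2) ^ n"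
        unfolding power_mult using m cb_pos[of n] by (simp only: abs_mult abs_of_pos power_abs[symmetric]) simp
      ultimately show ?thesis by simp
    qed
    have "0 \<le> ?m * cos p ^ 2" "?m * cos p ^ 2 < 1"
    proof -
      have "?m * cos p ^ 2 \<le> ?m * 1" by (intro mult_left_mono c m)
      thus "?m * cos p ^ 2 < 1" using m by linarith
      show "0 \<le> ?m * cos p ^ 2" by (rule mult_nonneg_nonneg[OF m(1)]) simp
    qed
    from cb_real_sums[OF this]
    show "(\<lambda>n. cb n * ?m ^ n * cos p ^ (2 * n)) sums (1 / sqrt (1 - ?m * (cos p)\<^sup>2))"
      by (simp only: power_mult_distrib power_mult mult.assoc)
  qed
  then obtain J where J: "((\<lambda>p. 1 / sqrt (1 - ?m * cos p ^ 2)) has_integral J) {0..pi/2}"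
    "(\<lambda>n. cb n * ?m ^ n * (pi / 2 * cb n)) sums J" by blast
  have "(\<lambda>n. pi / 2 * (cb n ^ 2 * ?m ^ n)) sums (pi / 2 * ell ?m)" by (intro sums_mult ell_sums m)
  hence "(\<lambda>n. cb n * ?m ^ n * (pi / 2 * cb n)) sums (pi / 2 * ell ?m)" by (simp only: power2_eq_square mult_ac)
  with J(2) have J': "J = pi / 2 * ell ?m" by (rule sums_unique2)
  have "1 / cmod (1 - of_real x * cis (2 * p)) = 1 / (1 + x) * (1 / sqrt (1 - ?m * cos p ^ 2))" for p
  proof -
    have "cmod (1 - of_real x * cis (2 * p)) = sqrt ((1 + x) ^ 2 * (1 - ?m * cos p ^ 2))"
    proof -
      have "(1 - x * cos (2 * p)) ^ 2 + (x * sin (2 * p)) ^ 2 = 1 - 2 * x * cos (2 * p) + x ^ 2 * ((cos (2 * p)) ^ 2 + (sin (2 * p)) ^ 2)"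
        unfolding power2_diff power_mult_distrib distrib_left one_power2 mult_1_right mult.assoc by linarith
      also have "\<dots> = 1 - 2 * x * (2 * cos p ^ 2 - 1) + x ^ 2" unfolding sin_cos_squared_add2 unfolding cos_double_cos by simp
      also have "\<dots> = (1 + x) ^ 2 - 4 * x * cos p ^ 2" by (simp add: power2_eq_square algebra_simps)
      also have "\<dots> = (1 + x) ^ 2 * (1 - ?m * cos p ^ 2)" using x by (simp add: right_diff_distrib)
      finally show ?thesis by (simp add: cmod_def)
    qed
    also have "\<dots> = (1 + x) * sqrt (1 - ?m * cos p ^ 2)" using x by (simp add: real_sqrt_mult)
    finally show ?thesis by simp
  qed
  hence "((\<lambda>p. 1 / (1 + x) * (1 / sqrt (1 - ?m * cos p ^ 2))) has_integral (pi / 2 * ell (x ^ 2))) {0..pi/2}"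
    using ell_parseval[OF x] by simp
  with has_integral_mult_right[OF J(1), of "1 / (1 + x)"]
  have "1 / (1 + x) * J = pi / 2 * ell (x ^ 2)" by (rule has_integral_unique)
  hence "pi / 2 * ell ?m = pi / 2 * ((1 + x) * ell (x ^ 2))" unfolding J' using x by (simp add: divide_eq_eq mult_ac)
  thus ?thesis by (simp only: mult_cancel_left) simp
qed

lemma ell_bounds: assumes "0 \<le> y" "y < 1" shows "1 \<le> ell y" "ell y \<le> 1 / (1 - y)"
proof -
  have c: "cb n ^ 2 \<le> 1" for n using cb_le_1[of n] less_imp_le[OF cb_pos[of n]] by (simp add: power_le_one)
  have "(\<lambda>n. y ^ n) sums (1 / (1 - y))" using assms by (intro geometric_sums) simp
  moreover have "cb n ^ 2 * y ^ n \<le> y ^ n" for n using c[of n] assms by (intro mult_left_le_one_le) auto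
  ultimately show "ell y \<le> 1 / (1 - y)" using sums_le[OF _ ell_sums[OF assms]] by blast
  have "sum (\<lambda>n. cb n ^ 2 * y ^ n) {..<1} \<le> ell y"
    unfolding ell_def by (rule sum_le_suminf) (use ell_sums[OF assms] assms in \<open>auto simp: sums_iff\<close>)
  thus "1 \<le> ell y" by simp
qed

lemma ell_strict_mono: assumes "0 \<le> x" "x < y" "y < 1" shows "ell x < ell y"
proof -
  have s: "summable (\<lambda>n. cb n ^ 2 * x ^ n)" "summable (\<lambda>n. cb n ^ 2 * y ^ n)"
    using ell_sums[of x] ell_sums[of y] assms by (auto simp: sums_iff)
  have "0 < (\<Sum>n. cb n ^ 2 * y ^ n - cb n ^ 2 * x ^ n)"
  proof (rule suminf_pos2[where i = 1])
    show "summable (\<lambda>n. cb n ^ 2 * y ^ n - cb n ^ 2 * x ^ n)" by (intro summable_diff s)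
    show "0 \<le> cb n ^ 2 * y ^ n - cb n ^ 2 * x ^ n" for n using assms by (simp add: mult_left_mono power_mono)
    show "0 < cb 1 ^ 2 * y ^ 1 - cb 1 ^ 2 * x ^ 1" using assms cb_pos[of 1] by simp
  qed
  thus ?thesis unfolding ell_def by (simp add: suminf_diff[OF s(2,1), symmetric])
qed

lemma ell_tendsto: assumes "(f \<longlongrightarrow> 0) F" "\<forall>\<^sub>F t in F. 0 \<le> f t \<and> f t < 1"
  shows "((\<lambda>t. ell (f t)) \<longlongrightarrow> 1) F"
proof (rule tendsto_sandwich[of "\<lambda>_. 1" _ _ "\<lambda>t. 1 / (1 - f t)"])
  show "\<forall>\<^sub>F t in F. 1 \<le> ell (f t)" "\<forall>\<^sub>F t in F. ell (f t) \<le> 1 / (1 - f t)"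
    using assms(2) by (eventually_elim; use ell_bounds in auto)+
  show "((\<lambda>t. 1 / (1 - f t)) \<longlongrightarrow> 1) F" using assms(1) by (auto intro!: tendsto_eq_intros)
qed simp

section \<open>Moduli, their limits and the inversion\<close>

text \<open>The sequence 2^n t reaches infinity without changing the value. \<open>S3_eq_ell\<close>
  and \<open>Dk_eq\<close> are proved by exhibiting such an invariant quotient.\<close>

lemma doubling_invariant_at_top:
  fixes h :: "real \<Rightarrow> real"
  assumes "\<And>t. t > 0 \<Longrightarrow> h (2 * t) = h t" "(h \<longlongrightarrow> l) at_top" "t > 0"
  shows "h t = l"
proof -
  have "h (2 ^ n * t) = h t" for n
    by (induction n) (use assms(1)[of "2 ^ _ * t"] assms(3) in \<open>auto simp: mult.assoc\<close>)
  with filterlim_compose[OF assms(2) filterlim_doubling[OF assms(3)]] show ?thesis by (simp add: LIMSEQ_const_iff)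
qed

text \<open>The counterpart for quotients whose limit is known at 0, as happens for the
  complementary modulus.\<close>

lemma doubling_invariant_at_0:
  fixes h :: "real \<Rightarrow> real"
  assumes "\<And>t. t > 0 \<Longrightarrow> h (2 * t) = h t" "(h \<longlongrightarrow> l) (at_right 0)" "t > 0"
  shows "h t = l"
proof -
  have "h (t / 2 ^ n) = h t" for n
  proof (induction n)
    case (Suc n)
    have "2 * (t / 2 ^ Suc n) = t / 2 ^ n" by simp
    with Suc show ?case using assms(1)[of "t / 2 ^ Suc n"] assms(3) by (simp del: power_Suc)
  qed simp
  moreover have "filterlim (\<lambda>n. t / 2 ^ n) (at_right 0) sequentially" using assms(3) by real_asymp
  from filterlim_compose[OF assms(2) this] have "(\<lambda>n. h (t / 2 ^ n)) \<longlonglongrightarrow> l" .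
  ultimately show ?thesis by (simp add: LIMSEQ_const_iff)
qed

text \<open>The modulus $k$ and the complementary modulus.\<close>

definition km :: "real \<Rightarrow> real" where "km t = S2 t / S3 t"
definition kc :: "real \<Rightarrow> real" where "kc t = S4 t / S3 t"

text \<open>The Landen formulas run in opposite directions: k(t) is obtained from k(2t), but the
  complementary modulus at 2t from that at t. Hence t to 0 does for \<open>kc\<close> what t to
  infinity does for \<open>km\<close>.\<close>

lemma km_kc:
  assumes "t > 0"
  shows "km t > 0" "kc t > 0" "km t ^ 2 + kc t ^ 2 = 1" "km t < 1" "kc t < 1"
    "km t ^ 2 = 4 * km (2 * t) / (1 + km (2 * t)) ^ 2" "S3 t = S3 (2 * t) * (1 + km (2 * t))"
    "kc (2 * t) ^ 2 = 4 * kc t / (1 + kc t) ^ 2" "S3 (2 * t) = S3 t * (1 + kc t) / 2"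
proof -
  note p = S_pos[OF assms] S4_pos[OF assms] S_pos[of "2 * t"] S4_pos[of "2 * t"]
  show pos: "km t > 0" "kc t > 0" using p by (auto simp: km_def kc_def)
  show sq: "km t ^ 2 + kc t ^ 2 = 1"
    using p S_double(5)[OF assms] by (simp add: km_def kc_def power_divide flip: add_divide_distrib)
  show "km t < 1" using sq pos by (smt (verit) one_le_power zero_less_power)
  show "kc t < 1" using sq pos by (smt (verit) one_le_power zero_less_power)
  have q: "S3 (2 * t) > 0" "S2 (2 * t) > 0" using S_pos[of "2 * t"] assms by auto
  show e: "S3 t = S3 (2 * t) * (1 + km (2 * t))"
    unfolding S_double(1)[OF assms] km_def using q by (simp add: field_simps)
  have "km t ^ 2 = S2 t ^ 2 / S3 t ^ 2" by (simp add: km_def power_divide)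
  also have "\<dots> = 4 * km (2 * t) / (1 + km (2 * t)) ^ 2"
    unfolding e S_double(2)[OF assms] using q by (simp add: km_def power_mult_distrib power2_eq_square)
  finally show "km t ^ 2 = 4 * km (2 * t) / (1 + km (2 * t)) ^ 2" .
  have "S3 (2 * t) = (S3 t + S4 t) / 2" using S_double(1,3)[OF assms] by simp
  also have "\<dots> = S3 t * (1 + kc t) / 2" using p by (simp add: kc_def field_simps)
  finally show f: "S3 (2 * t) = S3 t * (1 + kc t) / 2" .
  have "kc (2 * t) ^ 2 = S4 (2 * t) ^ 2 / S3 (2 * t) ^ 2" by (simp add: kc_def power_divide)
  also have "\<dots> = S3 t * S4 t / (S3 t * (1 + kc t) / 2) ^ 2" unfolding f S_double(4)[OF assms] ..
  also have "\<dots> = 4 * (S4 t / S3 t) / (1 + kc t) ^ 2"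
    using p by (simp add: power2_eq_square mult_ac)
  also have "S4 t / S3 t = kc t" by (simp add: kc_def)
  finally show "kc (2 * t) ^ 2 = 4 * kc t / (1 + kc t) ^ 2" .
qed

lemma S3_tendsto: "(S3 \<longlongrightarrow> 1) at_top" by (rule tendsto_1_of_bounds[OF S3_bounds])

lemma S2_tendsto: "(S2 \<longlongrightarrow> 0) at_top"
proof (rule tendsto_sandwich)
  show "\<forall>\<^sub>F t in at_top. 0 \<le> S2 t" using eventually_gt_at_top[of 0] by eventually_elim (simp add: less_imp_le S_pos)
  show "\<forall>\<^sub>F t in at_top. S2 t \<le> 4 * exp (- pi * t / 2) * (1 / (1 - exp (- pi * t)))"
    using eventually_gt_at_top[of 0] by eventually_elim (rule S2_bounds)
  show "((\<lambda>t. 4 * exp (- pi * t / 2) * (1 / (1 - exp (- pi * t)))) \<longlongrightarrow> 0) at_top" by real_asymp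
qed simp

lemma km_tendsto: "(km \<longlongrightarrow> 0) at_top"
  using tendsto_divide[OF S2_tendsto S3_tendsto] by (simp add: km_def[abs_def])

text \<open>By Landen's transformation with x = k(2t), S3(t) and ell(k(t)^2) both exceed their
  values at 2t by the factor 1 + k(2t). The quotient is doubling invariant with limit 1 at
  infinity.\<close>

lemma S3_eq_ell: assumes "t > 0" shows "S3 t = ell (km t ^ 2)"
proof -
  have "S3 t / ell (km t ^ 2) = 1"
  proof (rule doubling_invariant_at_top[where h = "\<lambda>t. S3 t / ell (km t ^ 2)"])
    fix t :: real assume t: "t > 0"
    have t2: "2 * t > 0" using t by simp
    have "S3 t / ell (km t ^ 2) = S3 (2 * t) * (1 + km (2 * t)) / ((1 + km (2 * t)) * ell (km (2 * t) ^ 2))"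
      unfolding km_kc(6)[OF t] ell_landen[OF less_imp_le[OF km_kc(1)[OF t2]] km_kc(4)[OF t2]] km_kc(7)[OF t] ..
    also have "\<dots> = S3 (2 * t) / ell (km (2 * t) ^ 2)" using km_kc(1)[OF t2] by simp
    finally show "S3 (2 * t) / ell (km (2 * t) ^ 2) = S3 t / ell (km t ^ 2)" ..
  next
    have "((\<lambda>t. ell (km t ^ 2)) \<longlongrightarrow> 1) at_top"
    proof (rule ell_tendsto)
      show "((\<lambda>t. km t ^ 2) \<longlongrightarrow> 0) at_top" using tendsto_power[OF km_tendsto, of 2] by simp
      show "\<forall>\<^sub>F t in at_top. 0 \<le> km t ^ 2 \<and> km t ^ 2 < 1"
        using eventually_gt_at_top[of 0]
      proof eventually_elim
        case (elim t) thus ?case using km_kc(1,4)[OF elim] by (auto simp: power_less_one_iff)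
      qed
    qed
    from tendsto_divide[OF S3_tendsto this] show "((\<lambda>t. S3 t / ell (km t ^ 2)) \<longlongrightarrow> 1) at_top" by simp
  qed (rule assms)
  moreover have "ell (km t ^ 2) \<ge> 1" using ell_bounds(1)[of "km t ^ 2"] km_kc(1,4)[OF assms] by (simp add: power_less_one_iff)
  ultimately show ?thesis by (simp add: field_simps)
qed

text \<open>For a = pi t, the sum of a sech(an) over the integers is a Riemann sum for the integral
  of sech over the line, which is pi. Monotonicity on the half-line bounds the error by one term;
  arctan(sinh y) is the antiderivative.\<close>

lemma S3_riemann: assumes t: "t > 0" shows "1 - t \<le> t * S3 t" "t * S3 t \<le> 1 + t"
proof -
  define a where "a = pi * t"
  have a: "a > 0" using t by (simp add: a_def)
  define G where "G = (\<lambda>y::real. arctan (sinh y))"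
  have dG: "(G has_real_derivative sech y) (at y)" for y
    unfolding G_def
  proof -
    have "1 + sinh y ^ 2 = cosh y ^ 2" by (simp add: cosh_square_eq)
    thus "((\<lambda>y. arctan (sinh y)) has_real_derivative sech y) (at y)"
      by (auto intro!: derivative_eq_intros simp: sech_def inverse_eq_divide power2_eq_square)
  qed
  have le: "a * sech (a * real (Suc n)) \<le> G (a * real (Suc n)) - G (a * real n)" and
    ge: "G (a * real (Suc n)) - G (a * real n) \<le> a * sech (a * real n)" for n
  proof -
    have "a * real n < a * real (Suc n)" using a by simp
    from MVT2[OF this, of G sech] dG obtain z where
      z: "a * real n < z" "z < a * real (Suc n)" "G (a * real (Suc n)) - G (a * real n) = (a * real (Suc n) - a * real n) * sech z"
      by blast
    have d: "a * real (Suc n) - a * real n = a" by (simp add: algebra_simps)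
    have z0: "0 \<le> a * real n" using a by simp
    have zz: "0 \<le> z" using z z0 by linarith
    have m: "sech v \<le> sech u" if "0 \<le> u" "u \<le> v" for u v
      unfolding sech_def using that by (intro le_imp_inverse_le) (auto simp: cosh_real_nonneg_le_iff)
    show "a * sech (a * real (Suc n)) \<le> G (a * real (Suc n)) - G (a * real n)"
      unfolding z(3) d using a z z0 zz by (intro mult_left_mono m) auto
    show "G (a * real (Suc n)) - G (a * real n) \<le> a * sech (a * real n)"
      unfolding z(3) d using a z z0 zz by (intro mult_left_mono m) auto
  qed
  have "(\<lambda>n. G (a * real n)) \<longlonglongrightarrow> pi / 2"
    unfolding G_def
    by (rule filterlim_compose[OF tendsto_arctan_at_top], rule filterlim_compose[OF sinh_real_at_top]) (use a in real_asymp)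
  from telescope_sums[OF this] have T: "(\<lambda>n. G (a * real (Suc n)) - G (a * real n)) sums (pi / 2)" by (simp add: G_def)
  have "((\<lambda>n. sech (a * (real_of_int (int (Suc n)) + 0))) has_sum ((Psech a 0 - sech (a * (real_of_int 0 + 0))) / 2)) UNIV"
    by (rule has_sum_int_evenD[OF has_sum_Psech[OF a]]) simp
  hence s1: "(\<lambda>n. sech (a * real (Suc n))) sums ((S3 t - 1) / 2)"
    by (drule_tac has_sum_imp_sums) (simp add: S3_def a_def sech_def)
  hence s0: "(\<lambda>n. sech (a * real n)) sums ((S3 t - 1) / 2 + 1)"
    using sums_Suc[of "\<lambda>n. sech (a * real n)"] by (simp add: sech_def)
  have "a * ((S3 t - 1) / 2) \<le> pi / 2" by (rule sums_le[OF le sums_mult[OF s1] T])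
  moreover have "pi / 2 \<le> a * ((S3 t - 1) / 2 + 1)" by (rule sums_le[OF ge T sums_mult[OF s0]])
  ultimately have "pi * (t * S3 t) \<le> pi * (1 + t)" "pi * (1 - t) \<le> pi * (t * S3 t)"
    by (auto simp: a_def field_simps)
  thus "1 - t \<le> t * S3 t" "t * S3 t \<le> 1 + t" by simp_all
qed

lemma S3_at_0: "((\<lambda>t. t * S3 t) \<longlongrightarrow> 1) (at_right 0)"
proof (rule tendsto_sandwich)
  show "\<forall>\<^sub>F t in at_right 0. 1 - t \<le> t * S3 t" "\<forall>\<^sub>F t in at_right 0. t * S3 t \<le> 1 + t"
    by (auto simp: eventually_at_right_field S3_riemann intro!: exI[of _ 1])
  show "((\<lambda>t::real. 1 - t) \<longlongrightarrow> 1) (at_right 0)" "((\<lambda>t::real. 1 + t) \<longlongrightarrow> 1) (at_right 0)" by real_asymp+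
qed

text \<open>Since S4(t) = 2 S3(2t) - S3(t), and t S3(t) has the same limit along t and along 2t, t
  S4(t) tends to 0.\<close>

lemma kc_at_0: "(kc \<longlongrightarrow> 0) (at_right 0)"
proof -
  have "filterlim (\<lambda>t::real. 2 * t) (at_right 0) (at_right 0)" by real_asymp
  from filterlim_compose[OF S3_at_0 this] have "((\<lambda>t. 2 * t * S3 (2 * t)) \<longlongrightarrow> 1) (at_right 0)" by simp
  from tendsto_divide[OF tendsto_diff[OF this S3_at_0] S3_at_0]
  have "((\<lambda>t. (2 * t * S3 (2 * t) - t * S3 t) / (t * S3 t)) \<longlongrightarrow> 0) (at_right 0)" by simp
  moreover have "\<forall>\<^sub>F t in at_right 0. (2 * t * S3 (2 * t) - t * S3 t) / (t * S3 t) = kc t"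
    unfolding eventually_at_right_field
  proof (intro exI[of _ 1] conjI allI impI)
    fix t :: real assume "0 < t" "t < 1"
    hence "S4 t = 2 * S3 (2 * t) - S3 t" using S_double(1,3)[of t] by simp
    hence "2 * t * S3 (2 * t) - t * S3 t = t * S4 t" by (simp only: right_diff_distrib)
    with \<open>0 < t\<close> show "(2 * t * S3 (2 * t) - t * S3 t) / (t * S3 t) = kc t" by (simp add: kc_def)
  qed simp
  ultimately show ?thesis by (rule Lim_transform_eventually)
qed

text \<open>The mirror image of \<open>S3_eq_ell\<close>, with x = kc(t) in Landen's transformation
  and the limit taken at 0. Together the two say that t = K'/K.\<close>

lemma tS3_eq_ell: assumes "t > 0" shows "t * S3 t = ell (kc t ^ 2)"
proof -
  have "t * S3 t / ell (kc t ^ 2) = 1"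
  proof (rule doubling_invariant_at_0[where h = "\<lambda>t. t * S3 t / ell (kc t ^ 2)"])
    fix t :: real assume t: "t > 0"
    have "2 * t * S3 (2 * t) / ell (kc (2 * t) ^ 2) = t * (S3 t * (1 + kc t)) / ((1 + kc t) * ell (kc t ^ 2))"
      unfolding km_kc(8)[OF t] ell_landen[OF less_imp_le[OF km_kc(2)[OF t]] km_kc(5)[OF t]] km_kc(9)[OF t] by simp
    also have "\<dots> = t * S3 t / ell (kc t ^ 2)" using km_kc(2)[OF t] by simp
    finally show "2 * t * S3 (2 * t) / ell (kc (2 * t) ^ 2) = t * S3 t / ell (kc t ^ 2)" .
  next
    have "((\<lambda>t. ell (kc t ^ 2)) \<longlongrightarrow> 1) (at_right 0)"
    proof (rule ell_tendsto)
      show "((\<lambda>t. kc t ^ 2) \<longlongrightarrow> 0) (at_right 0)" using tendsto_power[OF kc_at_0, of 2] by simp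
      show "\<forall>\<^sub>F t in at_right 0. 0 \<le> kc t ^ 2 \<and> kc t ^ 2 < 1"
        unfolding eventually_at_right_field
        using km_kc(2,5) by (intro exI[of _ 1]) (auto simp: power_less_one_iff less_imp_le)
    qed
    from tendsto_divide[OF S3_at_0 this] show "((\<lambda>t. t * S3 t / ell (kc t ^ 2)) \<longlongrightarrow> 1) (at_right 0)" by simp
  qed (rule assms)
  moreover have "ell (kc t ^ 2) \<ge> 1" using ell_bounds(1)[of "kc t ^ 2"] km_kc(2,5)[OF assms] by (simp add: power_less_one_iff)
  ultimately show ?thesis by (simp add: field_simps)
qed

text \<open>The two expressions for S3 read t = ell(1 - m)/ell(m) with m = k^2. As ell is strictly
  increasing, t determines m, and passing to 1/t exchanges m and 1 - m; so k and the complementary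
  modulus trade places.\<close>

lemma S_inversion:
  assumes t: "t > 0"
  shows "S3 (1/t) = t * S3 t" "S2 (1/t) = t * S4 t" "S4 (1/t) = t * S2 t"
proof -
  have t': "1 / t > 0" using t by simp
  define m m' where "m = km t ^ 2" and "m' = km (1/t) ^ 2"
  have m: "0 < m" "m < 1" "0 < m'" "m' < 1"
    using km_kc(1,4)[OF t] km_kc(1,4)[OF t'] by (auto simp: m_def m'_def power_less_one_iff)
  have c: "kc t ^ 2 = 1 - m" "kc (1/t) ^ 2 = 1 - m'"
    using km_kc(3)[OF t] km_kc(3)[OF t'] by (auto simp: m_def m'_def)
  have e: "t * ell m = ell (1 - m)" "ell m' = t * ell (1 - m')"
    using S3_eq_ell[OF t] tS3_eq_ell[OF t] S3_eq_ell[OF t'] tS3_eq_ell[OF t'] t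
    unfolding c m_def[symmetric] m'_def[symmetric] by (auto simp: field_simps)
  have "m' = 1 - m"
  proof (rule ccontr)
    assume "m' \<noteq> 1 - m"
    then consider "m' < 1 - m" | "1 - m < m'" by linarith
    thus False
    proof cases
      case 1
      hence "ell m' < ell (1 - m)" "ell m < ell (1 - m')" using m by (auto intro!: ell_strict_mono)
      hence "ell m' < ell (1 - m)" "t * ell m < t * ell (1 - m')" using t by auto
      thus False using e by linarith
    next
      case 2
      hence "ell (1 - m) < ell m'" "ell (1 - m') < ell m" using m by (auto intro!: ell_strict_mono)
      hence "ell (1 - m) < ell m'" "t * ell (1 - m') < t * ell m" using t by auto
      thus False using e by linarith
    qed
  qed
  hence k: "km (1/t) = kc t" "kc (1/t) = km t"
    using c m_def m'_def km_kc(1,2)[OF t] km_kc(1,2)[OF t'] by (auto intro: power2_eq_imp_eq)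
  show S3: "S3 (1/t) = t * S3 t"
    unfolding S3_eq_ell[OF t'] k tS3_eq_ell[OF t] ..
  have "S2 (1/t) = km (1/t) * S3 (1/t)" using S_pos[OF t'] by (simp add: km_def)
  also have "\<dots> = t * S4 t" unfolding k S3 using S_pos[OF t] by (simp add: kc_def)
  finally show "S2 (1/t) = t * S4 t" .
  have "S4 (1/t) = kc (1/t) * S3 (1/t)" using S_pos[OF t'] by (simp add: kc_def)
  also have "\<dots> = t * S2 t" unfolding k S3 using S_pos[OF t] by (simp add: km_def)
  finally show "S4 (1/t) = t * S2 t" .
qed

section \<open>The derivative of the modulus\<close>

lemma exp_second_order: "\<bar>exp u - 1 - u\<bar> \<le> u\<^sup>2 * exp \<bar>u\<bar>" for u :: real
proof -
  have 1: "exp u - 1 - u \<ge> 0" using exp_ge_add_one_self[of u] by linarith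
  have "1 - u \<le> exp (- u)" using exp_ge_add_one_self[of "- u"] by simp
  hence "(1 - u) * exp u \<le> exp (- u) * exp u" by (intro mult_right_mono) auto
  moreover have "exp (- u) * exp u = 1" by (simp flip: exp_add)
  ultimately have 2: "exp u - 1 \<le> u * exp u" by (simp add: left_diff_distrib)
  have "exp u - 1 - u \<le> u * (exp u - 1)" using 2 by (simp add: algebra_simps)
  also have "\<dots> \<le> u\<^sup>2 * exp \<bar>u\<bar>"
  proof (cases "u \<ge> 0")
    case True
    hence "u * (exp u - 1) \<le> u * (u * exp u)" using 2 by (intro mult_left_mono) auto
    thus ?thesis using True by (simp add: power2_eq_square mult.assoc)
  next
    case False
    have "u \<le> exp u - 1" using exp_ge_add_one_self[of u] by linarith
    hence "u * (exp u - 1) \<le> u * u" using False by (intro mult_left_mono_neg) auto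
    also have "\<dots> \<le> u * u * exp \<bar>u\<bar>" using mult_left_mono[of 1 "exp \<bar>u\<bar>" "u * u"] by simp
    also have "\<dots> = u\<^sup>2 * exp \<bar>u\<bar>" by (simp add: power2_eq_square)
    finally show ?thesis .
  qed
  finally show ?thesis using 1 by simp
qed

text \<open>Termwise differentiation of a generalised Dirichlet series. Summability for every
  positive c leaves room to absorb powers of l: the second-order remainder at c is controlled by the
  series at c/2.\<close>

lemma dirichlet_deriv:
  fixes a l :: "'i \<Rightarrow> real"
  assumes sm: "\<And>c. c > 0 \<Longrightarrow> (\<lambda>i. \<bar>a i\<bar> * exp (- c * l i)) summable_on A"
    and l: "\<And>i. i \<in> A \<Longrightarrow> l i \<ge> 0" and c: "c > 0"
  shows "(\<lambda>i. a i * l i * exp (- c * l i)) summable_on A"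
    and "((\<lambda>c. \<Sum>\<^sub>\<infinity>i\<in>A. a i * exp (- c * l i)) has_real_derivative - (\<Sum>\<^sub>\<infinity>i\<in>A. a i * l i * exp (- c * l i))) (at c)"
proof -
  have lin: "l i \<le> 2 / c * exp (c / 2 * l i)" for i
  proof -
    have "c / 2 * l i \<le> exp (c / 2 * l i)" using exp_ge_add_one_self[of "c / 2 * l i"] by linarith
    hence "2 / c * (c / 2 * l i) \<le> 2 / c * exp (c / 2 * l i)" using c by (intro mult_left_mono) auto
    thus ?thesis using c by simp
  qed
  have b1: "norm (a i * l i * exp (- c * l i)) \<le> 2 / c * (\<bar>a i\<bar> * exp (- (c/2) * l i))" if i: "i \<in> A" for i
  proof -
    have "l i * exp (- c * l i) \<le> 2 / c * exp (c / 2 * l i) * exp (- c * l i)" by (intro mult_right_mono lin) simp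
    also have "\<dots> = 2 / c * exp (- (c/2) * l i)"
      unfolding mult.assoc exp_add[symmetric] by (rule arg_cong[of _ _ "\<lambda>x. 2 / c * exp x"]) (simp add: algebra_simps)
    finally have "\<bar>a i\<bar> * (l i * exp (- c * l i)) \<le> \<bar>a i\<bar> * (2 / c * exp (- (c/2) * l i))" by (intro mult_left_mono) auto
    thus ?thesis using l[OF i] by (simp add: abs_mult mult_ac)
  qed
  show s1: "(\<lambda>i. a i * l i * exp (- c * l i)) summable_on A"
    by (rule abs_summable_summable, rule Infinite_Sum.abs_summable_on_comparison_test'[OF _ b1])
      (intro summable_on_cmult_right sm; use c in simp)
  have s0: "(\<lambda>i. a i * exp (- c * l i)) summable_on A" if "c > 0" for c
    by (rule abs_summable_summable) (use sm[OF that] in \<open>simp add: abs_mult\<close>)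
  let ?F = "\<lambda>c. \<Sum>\<^sub>\<infinity>i\<in>A. a i * exp (- c * l i)" and ?G = "\<Sum>\<^sub>\<infinity>i\<in>A. a i * l i * exp (- c * l i)"
  \<comment> \<open>From (c l/4)^2/2 <= exp(c l/4) follows l^2 <= (32/c^2) exp(c l/4).\<close>
  define K where "K = 32 / c\<^sup>2"
  define M where "M = K * (\<Sum>\<^sub>\<infinity>i\<in>A. \<bar>a i\<bar> * exp (- (c/2) * l i))"
  \<comment> \<open>One quarter of the decay rate c is spent on l^2 and another on exp |h l|; the
    rate c/2 remains.\<close>
  have bound: "\<bar>?F (c + h) - ?F c + h * ?G\<bar> \<le> M * h\<^sup>2" if h: "\<bar>h\<bar> \<le> c / 4" for h
  proof -
    have ch: "c + h > 0" using h c by linarith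
    let ?t = "\<lambda>i. a i * exp (- (c + h) * l i) + - (a i * exp (- c * l i)) + h * (a i * l i * exp (- c * l i))"
    have "(?t has_sum (?F (c + h) + - ?F c + h * ?G)) A"
      by (intro has_sum_add has_sum_uminusI has_sum_cmult_right has_sum_infsum s0 s1 ch c)
    moreover have "((\<lambda>i. h\<^sup>2 * K * (\<bar>a i\<bar> * exp (- (c/2) * l i))) has_sum (h\<^sup>2 * K * (\<Sum>\<^sub>\<infinity>i\<in>A. \<bar>a i\<bar> * exp (- (c/2) * l i)))) A"
      by (intro has_sum_cmult_right has_sum_infsum sm) (use c in simp)
    moreover have "norm (?t i) \<le> h\<^sup>2 * K * (\<bar>a i\<bar> * exp (- (c/2) * l i))" if i: "i \<in> A" for i
    proof -
      define u where "u = - h * l i"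
      have e: "exp (- (c + h) * l i) = exp (- c * l i) * exp u" by (simp add: u_def left_diff_distrib distrib_right flip: exp_add)
      have "?t i = a i * exp (- c * l i) * (exp u - 1 - u)" unfolding e by (simp add: u_def algebra_simps)
      hence "norm (?t i) = \<bar>a i\<bar> * exp (- c * l i) * \<bar>exp u - 1 - u\<bar>" by (simp add: abs_mult)
      also have "\<dots> \<le> \<bar>a i\<bar> * exp (- c * l i) * (u\<^sup>2 * exp \<bar>u\<bar>)" by (intro mult_left_mono exp_second_order) auto
      also have "\<dots> \<le> \<bar>a i\<bar> * exp (- c * l i) * (h\<^sup>2 * (K * exp (c/4 * l i)) * exp (c/4 * l i))"
      proof (intro mult_left_mono mult_mono)
        have "(c/4 * l i)\<^sup>2 / 2 \<le> exp (c/4 * l i)"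
        proof -
          have "0 \<le> c/4 * l i" using c l[OF i] by simp
          from exp_lower_Taylor_quadratic[OF this] this show ?thesis by linarith
        qed
        hence "K * ((c/4 * l i)\<^sup>2 / 2) \<le> K * exp (c/4 * l i)" by (intro mult_left_mono) (simp_all add: K_def)
        moreover have "K * ((c/4 * l i)\<^sup>2 / 2) = (l i)\<^sup>2" using c by (simp add: K_def power2_eq_square)
        ultimately have "(l i)\<^sup>2 \<le> K * exp (c/4 * l i)" by simp
        thus "u\<^sup>2 \<le> h\<^sup>2 * (K * exp (c/4 * l i))" unfolding u_def by (simp add: power_mult_distrib mult_left_mono)
        have "\<bar>h\<bar> * l i \<le> c/4 * l i" using h l[OF i] by (intro mult_right_mono)
        thus "exp \<bar>u\<bar> \<le> exp (c/4 * l i)" using l[OF i] by (simp add: u_def abs_mult)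
      qed (use c in \<open>auto simp: K_def\<close>)
      also have "\<dots> = h\<^sup>2 * K * (\<bar>a i\<bar> * (exp (- c * l i) * exp (c/4 * l i) * exp (c/4 * l i)))" by (simp only: mult_ac)
      also have "exp (- c * l i) * exp (c/4 * l i) * exp (c/4 * l i) = exp (- (c/2) * l i)"
        unfolding exp_add[symmetric] by (rule arg_cong[of _ _ exp]) (simp add: algebra_simps)
      finally show ?thesis .
    qed
    ultimately have "norm (?F (c + h) + - ?F c + h * ?G) \<le> h\<^sup>2 * K * (\<Sum>\<^sub>\<infinity>i\<in>A. \<bar>a i\<bar> * exp (- (c/2) * l i))"
      using norm_infsum_le by blast
    thus ?thesis by (simp add: M_def mult_ac)
  qed
  have "(\<lambda>h. (?F (c + h) - ?F c) / h) \<midarrow>0\<rightarrow> - ?G"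
  proof (rule LIM_zero_cancel, rule tendsto_0_le[where f = "\<lambda>h. h" and K = M])
    show "(\<lambda>h::real. h) \<midarrow>0\<rightarrow> 0" by (rule tendsto_ident_at)
    have "\<forall>\<^sub>F h in at 0. \<bar>h\<bar> \<le> c / 4 \<and> h \<noteq> (0::real)"
      unfolding eventually_at using c by (intro exI[of _ "c/4"]) (auto simp: dist_real_def)
    thus "\<forall>\<^sub>F h in at 0. norm ((?F (c + h) - ?F c) / h - - ?G) \<le> norm h * M"
    proof eventually_elim
      case (elim h)
      have "(?F (c + h) - ?F c) / h - - ?G = (?F (c + h) - ?F c + h * ?G) / h" using elim by (simp add: field_simps)
      hence "norm ((?F (c + h) - ?F c) / h - - ?G) = \<bar>?F (c + h) - ?F c + h * ?G\<bar> / \<bar>h\<bar>" by simp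
      also have "\<dots> \<le> M * h\<^sup>2 / \<bar>h\<bar>" using bound[of h] elim by (intro divide_right_mono) auto
      also have "\<dots> = norm h * M" using elim by (simp add: power2_eq_square abs_if)
      finally show ?case .
    qed
  qed
  thus "(?F has_real_derivative - ?G) (at c)" unfolding DERIV_def .
qed

definition gauss_d :: "real \<Rightarrow> real \<Rightarrow> real" where
  "gauss_d c x = (\<Sum>\<^sub>\<infinity>n::int. (real_of_int n + x)\<^sup>2 * exp (- c * (real_of_int n + x)\<^sup>2))"

lemma gauss_deriv:
  assumes c: "c > 0"
  shows "((\<lambda>c. gauss c x) has_real_derivative - gauss_d c x) (at c)"
    and "((\<lambda>n. (real_of_int n + x)\<^sup>2 * exp (- c * (real_of_int n + x)\<^sup>2)) has_sum gauss_d c x) UNIV"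
proof -
  have sm: "(\<lambda>n. \<bar>1\<bar> * exp (- c * (real_of_int n + x)\<^sup>2)) summable_on UNIV" if "c > 0" for c
    using has_sum_imp_summable[OF has_sum_gauss[OF that]] by simp
  have D: "(\<lambda>n. 1 * (real_of_int n + x)\<^sup>2 * exp (- c * (real_of_int n + x)\<^sup>2)) summable_on UNIV"
   "((\<lambda>c. \<Sum>\<^sub>\<infinity>n. 1 * exp (- c * (real_of_int n + x)\<^sup>2)) has_real_derivative - (\<Sum>\<^sub>\<infinity>n. 1 * (real_of_int n + x)\<^sup>2 * exp (- c * (real_of_int n + x)\<^sup>2))) (at c)"
    by (rule dirichlet_deriv[OF sm _ c]; simp)+
  show "((\<lambda>c. gauss c x) has_real_derivative - gauss_d c x) (at c)" using D(2) by (simp add: gauss_def gauss_d_def)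
  show "((\<lambda>n. (real_of_int n + x)\<^sup>2 * exp (- c * (real_of_int n + x)\<^sup>2)) has_sum gauss_d c x) UNIV"
    unfolding gauss_d_def using D(1) by (intro has_sum_infsum) simp
qed

lemma gauss_pos: assumes "c > 0" shows "gauss c 0 > 0" "gauss c (1/2) > 0"
  using gauss0_bounds(1)[OF assms] gauss_half_bounds(1)[OF assms] by (auto intro: less_le_trans[rotated])

lemma mult_exp_le: "x * exp (- c * x) \<le> exp (- (c - 1) * x)" for x c :: real
proof -
  have "x \<le> exp x" using exp_ge_add_one_self[of x] by linarith
  hence "x * exp (- c * x) \<le> exp x * exp (- c * x)" by (intro mult_right_mono) auto
  also have "exp x * exp (- c * x) = exp (- (c - 1) * x)"
    unfolding exp_add[symmetric] by (rule arg_cong[of _ _ exp]) (simp add: algebra_simps)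
  finally show ?thesis .
qed

lemma gauss_d0_bounds:
  assumes c: "c > 1"
  shows "0 \<le> gauss_d c 0" "gauss_d c 0 \<le> 2 * exp (- (c - 1)) / (1 - exp (- (c - 1)))"
proof -
  have c0: "c > 0" "c - 1 > 0" using c by auto
  show "0 \<le> gauss_d c 0" by (rule has_sum_nonneg[OF gauss_deriv(2)[OF c0(1)]]) simp
  have "((\<lambda>n. exp (- (c - 1) * (real_of_int n + 0)\<^sup>2) + (if n = 0 then -1 else 0)) has_sum (gauss (c - 1) 0 + -1)) UNIV"
    by (intro has_sum_add has_sum_gauss c0 has_sum_finite_neutralI[of "{0}"]) auto
  from has_sum_mono[OF gauss_deriv(2)[OF c0(1), of 0] this]
  have "gauss_d c 0 \<le> gauss (c - 1) 0 + -1"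
    using mult_exp_le by (force simp del: mult_minus_left)
  thus "gauss_d c 0 \<le> 2 * exp (- (c - 1)) / (1 - exp (- (c - 1)))" using gauss0_bounds(2)[OF c0(2)] by simp
qed

text \<open>Since (n + 1/2)^2 = n(n+1) + 1/4, subtracting a quarter of the Gaussian sum removes the
  dominant terms n = 0 and n = -1. The rest is compared with the sum at c - 1, deprived of the same
  two terms; hence the -2.\<close>

lemma gauss_d_half_bounds:
  assumes c: "c > 1"
  shows "0 \<le> gauss_d c (1/2) - gauss c (1/2) / 4" "gauss_d c (1/2) - gauss c (1/2) / 4 \<le> exp (- c / 4) * (2 / (1 - exp (- (c - 1))) - 2)"
proof -
  have c0: "c > 0" "c - 1 > 0" using c by auto
  let ?e = "\<lambda>n::int. (real_of_int n + 1/2)\<^sup>2"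
  have "((\<lambda>n. ?e n * exp (- c * ?e n) + - (1/4 * exp (- c * ?e n))) has_sum (gauss_d c (1/2) + - (1/4 * gauss c (1/2)))) UNIV"
    by (intro has_sum_add has_sum_uminusI has_sum_cmult_right gauss_deriv(2) has_sum_gauss c0)
  moreover have e: "?e n = real_of_int (n * (n + 1)) + 1/4" for n by (simp add: power2_eq_square algebra_simps)
  ultimately have h: "((\<lambda>n. real_of_int (n * (n + 1)) * exp (- c * ?e n)) has_sum (gauss_d c (1/2) - gauss c (1/2) / 4)) UNIV"
    by (simp add: algebra_simps)
  have nn: "n * (n + 1) \<ge> 0" for n :: int by (cases "n \<ge> 0") (auto intro: mult_nonneg_nonneg mult_nonpos_nonpos)
  show "0 \<le> gauss_d c (1/2) - gauss c (1/2) / 4"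
  proof (rule has_sum_nonneg[OF h])
    show "0 \<le> real_of_int (n * (n + 1)) * exp (- c * ?e n)" for n
      using nn[of n] by (intro mult_nonneg_nonneg) (simp_all only: of_int_0_le_iff exp_ge_zero)
  qed
  have "((\<lambda>n. exp ((c - 1) / 4) * exp (- (c - 1) * ?e n) + (if n = 0 then -1 else if n = -1 then -1 else 0)) has_sum (exp ((c - 1) / 4) * gauss (c - 1) (1/2) + -2)) UNIV"
    by (intro has_sum_add has_sum_cmult_right has_sum_gauss c0 has_sum_finite_neutralI[of "{0,-1}"]) auto
  from has_sum_cmult_right[OF this, of "exp (- c / 4)"]
  have g: "((\<lambda>n. exp (- c / 4) * (exp ((c - 1) / 4) * exp (- (c - 1) * ?e n) + (if n = 0 then -1 else if n = -1 then -1 else 0))) has_sum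
     (exp (- c / 4) * (exp ((c - 1) / 4) * gauss (c - 1) (1/2) + -2))) UNIV" .
  have "gauss_d c (1/2) - gauss c (1/2) / 4 \<le> exp (- c / 4) * (exp ((c - 1) / 4) * gauss (c - 1) (1/2) + -2)"
  proof (rule has_sum_mono[OF h g])
    fix n :: int
    let ?y = "real_of_int (n * (n + 1))"
    have 1: "exp (- c * ?e n) = exp (- c / 4) * exp (- c * ?y)"
      unfolding e exp_add[symmetric] by (rule arg_cong[of _ _ exp]) (simp add: algebra_simps)
    have 2: "exp ((c - 1) / 4) * exp (- (c - 1) * ?e n) = exp (- (c - 1) * ?y)"
      unfolding e exp_add[symmetric] by (rule arg_cong[of _ _ exp]) (simp add: algebra_simps diff_divide_distrib)
    have "?y * exp (- c * ?y) \<le> exp (- (c - 1) * ?y) + (if n = 0 then -1 else if n = -1 then -1 else 0)"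
    proof (cases "n = 0 \<or> n = -1")
      case False
      thus ?thesis using mult_exp_le[of ?y c] by simp
    qed auto
    hence "exp (- c / 4) * (?y * exp (- c * ?y)) \<le> exp (- c / 4) * (exp (- (c - 1) * ?y) + (if n = 0 then -1 else if n = -1 then -1 else 0))"
      by (intro mult_left_mono) auto
    thus "?y * exp (- c * ?e n) \<le> exp (- c / 4) * (exp ((c - 1) / 4) * exp (- (c - 1) * ?e n) + (if n = 0 then -1 else if n = -1 then -1 else 0))"
      unfolding 1 2 by (simp only: mult_ac)
  qed
  also have "\<dots> \<le> exp (- c / 4) * (2 / (1 - exp (- (c - 1))) - 2)"
  proof (intro mult_left_mono)
    have "exp ((c - 1) / 4) * gauss (c - 1) (1/2) \<le> exp ((c - 1) / 4) * (2 * exp (- (c - 1) / 4) * (1 / (1 - exp (- (c - 1)))))"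
      by (intro mult_left_mono gauss_half_bounds c0) simp
    also have "\<dots> = 2 / (1 - exp (- (c - 1))) * (exp ((c - 1) / 4) * exp (- (c - 1) / 4))" by (simp add: mult_ac)
    also have "exp ((c - 1) / 4) * exp (- (c - 1) / 4) = 1"
      unfolding exp_add[symmetric] minus_divide_left[symmetric] by simp
    finally show "exp ((c - 1) / 4) * gauss (c - 1) (1/2) + -2 \<le> 2 / (1 - exp (- (c - 1))) - 2" by simp
  qed simp
  finally show "gauss_d c (1/2) - gauss c (1/2) / 4 \<le> exp (- c / 4) * (2 / (1 - exp (- (c - 1))) - 2)" .
qed

lemma km_eq_gauss: "t > 0 \<Longrightarrow> km t = (gauss (pi * t) (1/2) / gauss (pi * t) 0)\<^sup>2"
  by (simp add: km_def S_eq_gauss power_divide)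

text \<open>The logarithmic derivative of \<open>km\<close>: k is the square of theta_2/theta_3, and
  \<open>gauss_d\<close> is minus the derivative of \<open>gauss\<close> in c = pi t.\<close>

definition Dk :: "real \<Rightarrow> real" where
  "Dk t = 2 * pi * (gauss_d (pi * t) 0 / gauss (pi * t) 0 - gauss_d (pi * t) (1/2) / gauss (pi * t) (1/2))"

lemma km_deriv_Dk:
  assumes t: "t > 0"
  shows "(km has_real_derivative (km t * Dk t)) (at t)"
proof -
  have a: "pi * t > 0" using t by simp
  note p = gauss_pos[OF a]
  have T: "((\<lambda>t. gauss (pi * t) x) has_real_derivative (- gauss_d (pi * t) x * pi)) (at t)" for x
    by (rule DERIV_chain2[where f = "\<lambda>c. gauss c x" and g = "\<lambda>t. pi * t" and x = t, OF gauss_deriv(1)[OF a]])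
      (auto intro!: derivative_eq_intros)
  have "((\<lambda>t. (gauss (pi * t) (1/2) / gauss (pi * t) 0)\<^sup>2) has_real_derivative (km t * Dk t)) (at t)"
  proof (rule DERIV_cong)
    let ?q = "gauss (pi * t) (1/2) / gauss (pi * t) 0"
    let ?d = "((- gauss_d (pi * t) (1/2) * pi) * gauss (pi * t) 0 - gauss (pi * t) (1/2) * (- gauss_d (pi * t) 0 * pi)) / (gauss (pi * t) 0 * gauss (pi * t) 0)"
    have "((\<lambda>t. gauss (pi * t) (1/2) / gauss (pi * t) 0) has_real_derivative ?d) (at t)"
      by (rule DERIV_divide[OF T T]) (use p in simp)
    from DERIV_power[OF this, of 2]
    show "((\<lambda>t. (gauss (pi * t) (1/2) / gauss (pi * t) 0)\<^sup>2) has_real_derivative (2 * (?d * ?q))) (at t)" by simp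
    show "2 * (?d * ?q) = km t * Dk t"
      unfolding km_eq_gauss[OF t] Dk_def using p by (simp add: field_simps power2_eq_square)
  qed
  thus ?thesis
    by (rule has_field_derivative_transform_within_open[where S = "{0<..}"]) (use t km_eq_gauss in auto)
qed

text \<open>The theta_3 part decays, while theta_2 behaves like 2 exp(-pi t/4), so its part tends to
  1/4. This corresponds to k being asymptotic to 4 exp(-pi t/2).\<close>

lemma Dk_tendsto: "(Dk \<longlongrightarrow> - (pi / 2)) at_top"
proof -
  have ev: "\<forall>\<^sub>F t in at_top. pi * t > 1"
    using eventually_gt_at_top[of "1/pi"] by eventually_elim (simp add: field_simps)
  have 1: "((\<lambda>t. gauss_d (pi * t) 0 / gauss (pi * t) 0) \<longlongrightarrow> 0) at_top"
  proof (rule tendsto_sandwich)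
    show "\<forall>\<^sub>F t in at_top. 0 \<le> gauss_d (pi * t) 0 / gauss (pi * t) 0" using ev
      by eventually_elim (auto intro!: divide_nonneg_pos gauss_d0_bounds gauss_pos)
    show "\<forall>\<^sub>F t in at_top. gauss_d (pi * t) 0 / gauss (pi * t) 0 \<le> 2 * exp (- (pi * t - 1)) / (1 - exp (- (pi * t - 1)))" using ev
    proof eventually_elim
      case (elim t)
      have "gauss_d (pi * t) 0 / gauss (pi * t) 0 \<le> gauss_d (pi * t) 0 / 1"
        using gauss0_bounds(1)[of "pi * t"] gauss_d0_bounds(1)[OF elim] elim by (intro divide_left_mono) auto
      thus ?case using gauss_d0_bounds(2)[OF elim] by simp
    qed
    show "((\<lambda>t. 2 * exp (- (pi * t - 1)) / (1 - exp (- (pi * t - 1)))) \<longlongrightarrow> 0) at_top" by real_asymp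
  qed simp
  have 2: "((\<lambda>t. (gauss_d (pi * t) (1/2) - gauss (pi * t) (1/2) / 4) / gauss (pi * t) (1/2)) \<longlongrightarrow> 0) at_top"
  proof (rule tendsto_sandwich)
    show "\<forall>\<^sub>F t in at_top. 0 \<le> (gauss_d (pi * t) (1/2) - gauss (pi * t) (1/2) / 4) / gauss (pi * t) (1/2)" using ev
    proof eventually_elim
      case (elim t)
      show ?case by (rule divide_nonneg_pos[OF gauss_d_half_bounds(1)[OF elim] gauss_pos(2)]) (use elim in simp)
    qed
    show "\<forall>\<^sub>F t in at_top. (gauss_d (pi * t) (1/2) - gauss (pi * t) (1/2) / 4) / gauss (pi * t) (1/2) \<le> (2 / (1 - exp (- (pi * t - 1))) - 2) / 2" using ev
    proof eventually_elim
      case (elim t)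
      let ?X = "2 / (1 - exp (- (pi * t - 1))) - 2"
      have e: "exp (- (pi * t) / 4) * ?X \<ge> 0" using gauss_d_half_bounds[OF elim] by linarith
      have "(gauss_d (pi * t) (1/2) - gauss (pi * t) (1/2) / 4) / gauss (pi * t) (1/2) \<le> exp (- (pi * t) / 4) * ?X / (2 * exp (- (pi * t) / 4))"
        by (rule frac_le[OF e gauss_d_half_bounds(2)[OF elim] _ gauss_half_bounds(1)]) (use elim in auto)
      thus ?case by simp
    qed
    show "((\<lambda>t. (2 / (1 - exp (- (pi * t - 1))) - 2) / 2) \<longlongrightarrow> 0) at_top" by real_asymp
  qed simp
  have "((\<lambda>t. 2 * pi * (gauss_d (pi * t) 0 / gauss (pi * t) 0 - ((gauss_d (pi * t) (1/2) - gauss (pi * t) (1/2) / 4) / gauss (pi * t) (1/2) + 1/4))) \<longlongrightarrow> 2 * pi * (0 - (0 + 1/4))) at_top"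
    by (intro tendsto_intros 1 2)
  moreover have "\<forall>\<^sub>F t in at_top. 2 * pi * (gauss_d (pi * t) 0 / gauss (pi * t) 0 - ((gauss_d (pi * t) (1/2) - gauss (pi * t) (1/2) / 4) / gauss (pi * t) (1/2) + 1/4)) = Dk t"
    using ev
  proof eventually_elim
    case (elim t)
    have "gauss (pi * t) (1/2) \<noteq> 0" using gauss_pos(2)[of "pi * t"] elim by simp
    thus ?case unfolding Dk_def by (simp add: diff_divide_distrib)
  qed
  ultimately have "(Dk \<longlongrightarrow> 2 * pi * (0 - (0 + 1/4))) at_top" by (rule Lim_transform_eventually)
  thus ?thesis by simp
qed

text \<open>Logarithmic differentiation of k(t)^2 = 4x/(1 + x)^2 with x = k(2t). The factor 2 of the
  square cancels that of the inner derivative.\<close>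

lemma Dk_double: assumes t: "t > 0" shows "Dk t = Dk (2 * t) * (1 - km (2 * t)) / (1 + km (2 * t))"
proof -
  have t2: "2 * t > 0" using t by simp
  let ?k = "km (2 * t)" and ?D = "Dk (2 * t)"
  have k: "?k > 0" "km t > 0" using km_kc(1)[OF t2] km_kc(1)[OF t] by auto
  have d2: "((\<lambda>t. km (2 * t)) has_real_derivative (?k * ?D * 2)) (at t)"
    by (rule DERIV_chain2[where f = km and g = "\<lambda>t. 2 * t" and x = t, OF km_deriv_Dk[OF t2]]) (auto intro!: derivative_eq_intros)
  have A: "((\<lambda>t. km t ^ 2) has_real_derivative (2 * km t ^ 2 * Dk t)) (at t)"
    using DERIV_power[OF km_deriv_Dk[OF t], of 2] by (simp add: power2_eq_square mult_ac)
  have "((\<lambda>t. 4 * km (2 * t) / (1 + km (2 * t)) ^ 2) has_real_derivative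
     ((4 * (?k * ?D * 2) * (1 + ?k) ^ 2 - 4 * ?k * (2 * ((?k * ?D * 2) * (1 + ?k)))) / ((1 + ?k) ^ 2 * (1 + ?k) ^ 2))) (at t)"
  proof (rule DERIV_divide)
    show "((\<lambda>t. 4 * km (2 * t)) has_real_derivative (4 * (?k * ?D * 2))) (at t)" by (rule DERIV_cmult[OF d2])
    have "((\<lambda>t. 1 + km (2 * t)) has_real_derivative (0 + ?k * ?D * 2)) (at t)" by (intro DERIV_add d2 DERIV_const)
    from DERIV_power[OF this, of 2] show "((\<lambda>t. (1 + km (2 * t)) ^ 2) has_real_derivative (2 * ((?k * ?D * 2) * (1 + ?k)))) (at t)" by simp
  qed (use k in simp)
  hence "((\<lambda>t. km t ^ 2) has_real_derivative
     ((4 * (?k * ?D * 2) * (1 + ?k) ^ 2 - 4 * ?k * (2 * ((?k * ?D * 2) * (1 + ?k)))) / ((1 + ?k) ^ 2 * (1 + ?k) ^ 2))) (at t)"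
    by (rule has_field_derivative_transform_within_open[where S = "{0<..}"]) (use t km_kc(6) in auto)
  from DERIV_unique[OF A this]
  have "2 * km t ^ 2 * Dk t = (4 * (?k * ?D * 2) * (1 + ?k) ^ 2 - 4 * ?k * (2 * ((?k * ?D * 2) * (1 + ?k)))) / ((1 + ?k) ^ 2 * (1 + ?k) ^ 2)" .
  also have "\<dots> = 2 * (4 * ?k / (1 + ?k) ^ 2) * (?D * (1 - ?k) / (1 + ?k))"
  proof -
    have "4 * (?k * ?D * 2) * (1 + ?k) ^ 2 - 4 * ?k * (2 * ((?k * ?D * 2) * (1 + ?k))) = (1 + ?k) * (2 * (4 * ?k) * (?D * (1 - ?k)))"
      by (simp add: power2_eq_square algebra_simps)
    thus ?thesis using k by (simp add: power2_eq_square mult_ac)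
  qed
  also have "\<dots> = 2 * km t ^ 2 * (?D * (1 - ?k) / (1 + ?k))" unfolding km_kc(6)[OF t] ..
  finally have "2 * km t ^ 2 * Dk t = 2 * km t ^ 2 * (?D * (1 - ?k) / (1 + ?k))" .
  thus ?thesis by (rule mult_left_cancel[THEN iffD1, rotated]) (use k in simp)
qed

lemma S4_tendsto: "(S4 \<longlongrightarrow> 1) at_top"
proof -
  have f: "filterlim (\<lambda>t::real. 2 * t) at_top at_top" by real_asymp
  have "((\<lambda>t. S3 (2 * t) - S2 (2 * t)) \<longlongrightarrow> 1 - 0) at_top"
    by (intro tendsto_diff filterlim_compose[OF S3_tendsto f] filterlim_compose[OF S2_tendsto f])
  thus ?thesis by (simp add: S4_def[abs_def])
qed

text \<open>The factor (1 - x)/(1 + x) of \<open>Dk_double\<close>, x = k(2t), equals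
  S4(t)^2/S4(2t)^2. The quotient is therefore doubling invariant, and S4 tends to 1.\<close>

lemma Dk_eq: assumes "t > 0" shows "Dk t = - (pi / 2) * S4 t ^ 2"
proof -
  have "Dk t / S4 t ^ 2 = - (pi / 2)"
  proof (rule doubling_invariant_at_top[where h = "\<lambda>t. Dk t / S4 t ^ 2"])
    fix t :: real assume t: "t > 0"
    have t2: "2 * t > 0" using t by simp
    note p = S_pos[OF t2] S4_pos[OF t2] S4_pos[OF t]
    have "S4 (2 * t) ^ 2 = (S3 (2 * t) - S2 (2 * t)) * (S3 (2 * t) + S2 (2 * t))"
      unfolding S_double(4)[OF t, symmetric] S_double(1,3)[OF t] by (rule mult.commute)
    also have "\<dots> = S4 t * (S3 (2 * t) + S2 (2 * t))" by (simp add: S4_def)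
    finally have e: "S4 (2 * t) ^ 2 = S4 t * (S3 (2 * t) + S2 (2 * t))" .
    have f: "(1 - km (2 * t)) / (1 + km (2 * t)) = S4 t / (S3 (2 * t) + S2 (2 * t))"
    proof -
      have "1 - km (2 * t) = (S3 (2 * t) - S2 (2 * t)) / S3 (2 * t)" "1 + km (2 * t) = (S3 (2 * t) + S2 (2 * t)) / S3 (2 * t)"
        using p by (simp_all add: km_def diff_divide_distrib add_divide_distrib)
      thus ?thesis using p by (simp add: S4_def)
    qed
    have "Dk t / S4 t ^ 2 = Dk (2 * t) * ((1 - km (2 * t)) / (1 + km (2 * t))) / S4 t ^ 2"
      unfolding Dk_double[OF t] by simp
    also have "\<dots> = Dk (2 * t) / S4 (2 * t) ^ 2" unfolding f e using p by (simp add: power2_eq_square)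
    finally show "Dk (2 * t) / S4 (2 * t) ^ 2 = Dk t / S4 t ^ 2" ..
  next
    from tendsto_divide[OF Dk_tendsto tendsto_power[OF S4_tendsto, of 2]]
    show "((\<lambda>t. Dk t / S4 t ^ 2) \<longlongrightarrow> - (pi / 2)) at_top" by simp
  qed (rule assms)
  thus ?thesis using S4_pos[OF assms] by (simp add: field_simps)
qed

lemma km_deriv: "t > 0 \<Longrightarrow> (km has_real_derivative (- (pi / 2) * km t * S4 t ^ 2)) (at t)"
  using km_deriv_Dk[of t] unfolding Dk_eq[of t] by (simp add: Dk_eq mult_ac)

section \<open>The Lambert-type series of artanh k\<close>

text \<open>Obtained by integrating the Lambert series of theta_2^4 in t: the coefficient 2m + 1 is
  divided by the exponent (2m + 1)(2n + 1), which leaves 1/(2n + 1).\<close>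

definition Lam :: "real \<Rightarrow> real" where
  "Lam t = (\<Sum>\<^sub>\<infinity>(m::nat,n::nat). 4 / (2 * real n + 1) * exp (- (pi * t / 2) * ((2 * real m + 1) * (2 * real n + 1))))"

lemma Lam_double_sum:
  assumes c: "c > 0"
  shows "((\<lambda>(m,n). 4 * (2 * real m + 1) * exp (- c * ((2 * real m + 1) * (2 * real n + 1)))) has_sum (Psech c (1/2) ^ 2 / 4)) (UNIV \<times> UNIV)"
proof -
  have "((\<lambda>m. 4 * (2 * real m + 1) * (csch ((2 * real m + 1) * c) / 2)) has_sum (Psech c (1/2) ^ 2 / 4)) UNIV"
  proof -
    have e: "1/4 * (8 * (2 * real m + 1) * csch ((2 * real m + 1) * c)) = 4 * (2 * real m + 1) * (csch ((2 * real m + 1) * c) / 2)" for m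
      by simp
    show ?thesis using has_sum_cmult_right[OF Psech_half_square[OF c], of "1/4"] unfolding e by simp
  qed
  moreover have inner: "((\<lambda>n. 4 * (2 * real m + 1) * exp (- c * ((2 * real m + 1) * (2 * real n + 1)))) has_sum
      4 * (2 * real m + 1) * (csch ((2 * real m + 1) * c) / 2)) UNIV" for m
    using has_sum_cmult_right[OF csch_has_sum[of "(2 * real m + 1) * c"], of "4 * (2 * real m + 1)"] c by (simp add: mult_ac)
  ultimately show ?thesis
    by (intro has_sum_SigmaI summable_on_SigmaI[where g = "\<lambda>m. 4 * (2 * real m + 1) * (csch ((2 * real m + 1) * c) / 2)"])
      (auto intro: has_sum_imp_summable)
qed

text \<open>Differentiation multiplies by the exponent and restores the Lambert series of theta_2^4
  at t/2, which Landen's relation turns into S2(t) S3(t). The upper bound compares coefficients with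
  that same series; it serves for the limit at infinity.\<close>

lemma Lam_facts:
  assumes t: "t > 0"
  shows "((\<lambda>(m,n). 4 / (2 * real n + 1) * exp (- (pi * t / 2) * ((2 * real m + 1) * (2 * real n + 1)))) has_sum Lam t) (UNIV \<times> UNIV)"
    "(Lam has_real_derivative - (pi / 2) * S2 t * S3 t) (at t)"
    "((\<lambda>n. 2 / (2 * real n + 1) * csch ((2 * real n + 1) * (pi * t / 2))) has_sum Lam t) UNIV"
    "0 \<le> Lam t" "Lam t \<le> S2 (t / 2) ^ 2 / 4"
proof -
  let ?a = "\<lambda>p. case p of (m::nat,n::nat) \<Rightarrow> 4 / (2 * real n + 1)"
  let ?l = "\<lambda>p. case p of (m::nat,n::nat) \<Rightarrow> (2 * real m + 1) * (2 * real n + 1)"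
  have le: "4 / (2 * real n + 1) \<le> 4 * (2 * real m + 1)" for n m :: nat
  proof -
    have "4 / (2 * real n + 1) \<le> 4" by (simp add: divide_le_eq)
    thus ?thesis by simp
  qed
  have sm: "(\<lambda>p. \<bar>?a p\<bar> * exp (- c * ?l p)) summable_on UNIV \<times> UNIV" if c: "c > 0" for c
    by (rule summable_on_comparison_test[OF has_sum_imp_summable[OF Lam_double_sum[OF c]]])
      (use le in \<open>auto intro!: mult_right_mono\<close>)
  have c: "pi * t / 2 > 0" using t by simp
  have D: "(\<lambda>p. ?a p * ?l p * exp (- (pi * t / 2) * ?l p)) summable_on UNIV \<times> UNIV"
    "((\<lambda>c. \<Sum>\<^sub>\<infinity>p\<in>UNIV\<times>UNIV. ?a p * exp (- c * ?l p)) has_real_derivative - (\<Sum>\<^sub>\<infinity>p\<in>UNIV\<times>UNIV. ?a p * ?l p * exp (- (pi * t / 2) * ?l p))) (at (pi * t / 2))"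
    by (rule dirichlet_deriv[OF sm _ c]; auto)+
  have L: "Lam t = (\<Sum>\<^sub>\<infinity>p\<in>UNIV\<times>UNIV. ?a p * exp (- (pi * t / 2) * ?l p))" for t
    unfolding Lam_def by (simp add: case_prod_unfold)
  have "(\<lambda>p. ?a p * exp (- (pi * t / 2) * ?l p)) summable_on UNIV \<times> UNIV"
    using sm[OF c] by (simp add: case_prod_unfold)
  hence "((\<lambda>p. ?a p * exp (- (pi * t / 2) * ?l p)) has_sum Lam t) (UNIV \<times> UNIV)" unfolding L by (rule has_sum_infsum)
  thus h: "((\<lambda>(m,n). 4 / (2 * real n + 1) * exp (- (pi * t / 2) * ((2 * real m + 1) * (2 * real n + 1)))) has_sum Lam t) (UNIV \<times> UNIV)"
    by (simp add: case_prod_unfold)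
  have S: "Psech (pi * t / 2) (1/2) = S2 (t / 2)" by (simp add: S2_def)
  have "(\<Sum>\<^sub>\<infinity>p\<in>UNIV\<times>UNIV. ?a p * ?l p * exp (- (pi * t / 2) * ?l p)) = S2 (t / 2) ^ 2 / 4"
  proof (rule infsumI)
    have "?a p * ?l p * exp (- (pi * t / 2) * ?l p) = (case p of (m,n) \<Rightarrow> 4 * (2 * real m + 1) * exp (- (pi * t / 2) * ((2 * real m + 1) * (2 * real n + 1))))" for p
    proof (cases p)
      case (Pair m n)
      have "2 * real n + 1 \<noteq> 0" by (simp add: add_eq_0_iff)
      thus ?thesis using Pair by simp
    qed
    thus "((\<lambda>p. ?a p * ?l p * exp (- (pi * t / 2) * ?l p)) has_sum S2 (t / 2) ^ 2 / 4) (UNIV \<times> UNIV)"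
      using Lam_double_sum[OF c] unfolding S by simp
  qed
  also have "S2 (t / 2) ^ 2 / 4 = S2 t * S3 t" using S_double(2)[of "t / 2"] t by simp
  finally have "((\<lambda>c. \<Sum>\<^sub>\<infinity>p\<in>UNIV\<times>UNIV. ?a p * exp (- c * ?l p)) has_real_derivative - (S2 t * S3 t)) (at (pi * t / 2))"
    using D(2) by (simp only:)
  from DERIV_chain2[where g = "\<lambda>t. pi * t / 2" and x = t, OF this, of "pi / 2"]
  have "((\<lambda>t. \<Sum>\<^sub>\<infinity>p\<in>UNIV\<times>UNIV. ?a p * exp (- (pi * t / 2) * ?l p)) has_real_derivative - (S2 t * S3 t) * (pi / 2)) (at t)"
    by (rule meta_mp) (auto intro!: derivative_eq_intros)
  thus "(Lam has_real_derivative - (pi / 2) * S2 t * S3 t) (at t)" unfolding L[abs_def, symmetric] by (simp add: mult_ac)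
  have "((\<lambda>(n,m). 4 / (2 * real n + 1) * exp (- (pi * t / 2) * ((2 * real m + 1) * (2 * real n + 1)))) has_sum Lam t) (UNIV \<times> UNIV)"
    using h by (subst (asm) has_sum_swap) simp
  thus "((\<lambda>n. 2 / (2 * real n + 1) * csch ((2 * real n + 1) * (pi * t / 2))) has_sum Lam t) UNIV"
  proof (rule has_sum_SigmaD)
    show "((\<lambda>m. case (n, m) of (n, m) \<Rightarrow> 4 / (2 * real n + 1) * exp (- (pi * t / 2) * ((2 * real m + 1) * (2 * real n + 1)))) has_sum
      2 / (2 * real n + 1) * csch ((2 * real n + 1) * (pi * t / 2))) UNIV" for n
    proof -
      have e: "4 / (2 * real n + 1) * (csch ((2 * real n + 1) * (pi * t / 2)) / 2) = 2 / (2 * real n + 1) * csch ((2 * real n + 1) * (pi * t / 2))"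
        unfolding times_divide_times_eq using mult_divide_mult_cancel_left[of 2 "2 * csch ((2 * real n + 1) * (pi * t / 2))" "2 * real n + 1"]
        by (simp add: mult_ac)
      have e2: "- ((2 * real m + 1) * ((2 * real n + 1) * (pi * t / 2))) = - (pi * t / 2) * ((2 * real m + 1) * (2 * real n + 1))" for m
        by (simp add: mult_ac)
      have "(2 * real n + 1) * (pi * t / 2) > 0" using t by simp
      from has_sum_cmult_right[OF csch_has_sum[OF this], of "4 / (2 * real n + 1)"] show ?thesis unfolding e e2 prod.case .
    qed
  qed
  show "0 \<le> Lam t" by (rule has_sum_nonneg[OF h]) auto
  show "Lam t \<le> S2 (t / 2) ^ 2 / 4"
  proof (rule has_sum_mono[OF h Lam_double_sum[OF c, unfolded S]])
    fix p :: "nat \<times> nat"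
    show "(case p of (m, n) \<Rightarrow> 4 / (2 * real n + 1) * exp (- (pi * t / 2) * ((2 * real m + 1) * (2 * real n + 1))))
      \<le> (case p of (m, n) \<Rightarrow> 4 * (2 * real m + 1) * exp (- (pi * t / 2) * ((2 * real m + 1) * (2 * real n + 1))))"
      by (cases p) (simp only: prod.case, intro mult_right_mono le, simp)
  qed
qed

text \<open>By \<open>km_deriv\<close> and 1 - k^2 = kc^2 the derivative of artanh k is -(pi/2) S2
  S3, the same as that of \<open>Lam\<close>; both functions vanish at infinity.\<close>

lemma artanh_km: assumes t: "t > 0" shows "artanh (km t) = Lam t"
proof -
  have d: "((\<lambda>t. artanh (km t) - Lam t) has_real_derivative 0) (at t)" if t: "t > 0" for t
  proof -
    have k: "\<bar>km t\<bar> < 1" using km_kc(1,4)[OF t] by simp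
    have "((\<lambda>t. artanh (km t)) has_real_derivative (1 / (1 - km t ^ 2) * (- (pi / 2) * km t * S4 t ^ 2))) (at t)"
      by (rule DERIV_chain2[OF artanh_real_has_field_derivative[OF k] km_deriv[OF t]])
    moreover have "1 / (1 - km t ^ 2) * (- (pi / 2) * km t * S4 t ^ 2) = - (pi / 2) * S2 t * S3 t"
    proof -
      have "1 - km t ^ 2 = kc t ^ 2" using km_kc(3)[OF t] by simp
      thus ?thesis using S_pos[OF t] S4_pos[OF t] by (simp add: km_def kc_def power_divide power2_eq_square)
    qed
    ultimately have "((\<lambda>t. artanh (km t)) has_real_derivative - (pi / 2) * S2 t * S3 t) (at t)" by (rule DERIV_cong)
    hence "((\<lambda>t. artanh (km t) - Lam t) has_real_derivative (- (pi / 2) * S2 t * S3 t - (- (pi / 2) * S2 t * S3 t))) (at t)"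
      by (intro DERIV_diff Lam_facts(2) t)
    thus ?thesis by simp
  qed
  have "\<exists>c. \<forall>t\<in>{0<..}. artanh (km t) - Lam t = c"
    by (rule has_field_derivative_zero_constant) (auto intro: has_field_derivative_at_within[OF d])
  then obtain c where c: "\<And>t. t > 0 \<Longrightarrow> artanh (km t) - Lam t = c" by auto
  have "((\<lambda>t. artanh (km t)) \<longlongrightarrow> artanh 0) at_top"
    by (rule isCont_tendsto_compose[OF _ km_tendsto]) (auto intro!: continuous_intros)
  moreover have "(Lam \<longlongrightarrow> 0) at_top"
  proof (rule tendsto_sandwich[where f = "\<lambda>_. 0" and h = "\<lambda>t. S2 (t / 2) ^ 2 / 4"])
    have f: "filterlim (\<lambda>t::real. t / 2) at_top at_top" by real_asymp
    show "((\<lambda>t. S2 (t / 2) ^ 2 / 4) \<longlongrightarrow> 0) at_top"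
      using tendsto_divide[OF tendsto_power[OF filterlim_compose[OF S2_tendsto f], of 2] tendsto_const, of 4] by simp
    show "\<forall>\<^sub>F t in at_top. 0 \<le> Lam t" "\<forall>\<^sub>F t in at_top. Lam t \<le> S2 (t / 2) ^ 2 / 4"
      by (rule eventually_mono[OF eventually_gt_at_top[of 0]]; erule Lam_facts)+
  qed simp
  ultimately have "((\<lambda>t. artanh (km t) - Lam t) \<longlongrightarrow> artanh 0 - 0) at_top" by (rule tendsto_diff)
  moreover have "((\<lambda>t. artanh (km t) - Lam t) \<longlongrightarrow> c) at_top"
    by (rule tendsto_eventually) (use eventually_gt_at_top[of 0] in \<open>eventually_elim, simp add: c\<close>)
  ultimately have "artanh 0 - 0 = c" by (rule tendsto_unique[OF trivial_limit_at_top_linorder])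
  with c[OF t] show ?thesis by simp
qed

section \<open>The cusp form as a lattice sum\<close>

lemma has_sum_fibers:
  fixes f :: "'i \<Rightarrow> 'c::{topological_comm_monoid_add,t3_space}" and e :: "'i \<Rightarrow> 'k"
  assumes "(f has_sum S) UNIV" and "\<And>k. (f has_sum B k) {i. e i = k}"
  shows "(B has_sum S) UNIV"
proof -
  have "((\<lambda>(k,i). f i) has_sum S) (Sigma UNIV (\<lambda>k. {i. e i = k}))"
    using assms(1) by (subst has_sum_reindex_bij_witness[where i = "\<lambda>i. (e i, i)" and j = snd and T = UNIV and h = f and s' = S]) auto
  thus ?thesis by (rule has_sum_SigmaD) (use assms(2) in simp)
qed

definition fiber_coeff :: "('i \<Rightarrow> real) \<Rightarrow> ('i \<Rightarrow> nat) \<Rightarrow> nat \<Rightarrow> real" where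
  "fiber_coeff a e k = (\<Sum>\<^sub>\<infinity>i\<in>{i. e i = k}. a i)"

text \<open>Passes from a series over an arbitrary index set to a power series in q. Summability for
  all c > 0 means absolute convergence in the unit disk; terms with equal exponent are collected in
  \<open>fiber_coeff\<close>.\<close>

lemma exponent_family:
  fixes a :: "'i \<Rightarrow> real" and e :: "'i \<Rightarrow> nat"
  assumes sm: "\<And>c. c > 0 \<Longrightarrow> (\<lambda>i. \<bar>a i\<bar> * exp (- c * real (e i))) summable_on UNIV"
  shows "(a has_sum fiber_coeff a e k) {i. e i = k}"
    and "norm q < 1 \<Longrightarrow> (\<lambda>i. complex_of_real (a i) * q ^ e i) summable_on UNIV"
    and "norm q < 1 \<Longrightarrow> (\<lambda>k. complex_of_real (fiber_coeff a e k) * q ^ k) sums (\<Sum>\<^sub>\<infinity>i. complex_of_real (a i) * q ^ e i)"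
    and "(\<lambda>q. \<Sum>\<^sub>\<infinity>i. complex_of_real (a i) * q ^ e i) holomorphic_on ball 0 1"
    and "(\<lambda>q. \<Sum>\<^sub>\<infinity>i. complex_of_real (a i) * q ^ e i) has_fps_expansion Abs_fps (\<lambda>k. complex_of_real (fiber_coeff a e k))"
proof -
  show A: "(a has_sum fiber_coeff a e k) {i. e i = k}" for k
    unfolding fiber_coeff_def
  proof (rule has_sum_infsum)
    have "(\<lambda>i. \<bar>a i\<bar> * exp (- 1 * real (e i))) summable_on {i. e i = k}"
      using summable_on_subset_banach[OF sm[of 1]] by simp
    hence "(\<lambda>i. exp (real k) * (\<bar>a i\<bar> * exp (- 1 * real (e i)))) summable_on {i. e i = k}"
      by (rule summable_on_cmult_right)
    hence "(\<lambda>i. norm (a i)) summable_on {i. e i = k}"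
      by (rule summable_on_cong[THEN iffD1, rotated]) (auto simp: exp_minus)
    thus "a summable_on {i. e i = k}" by (rule abs_summable_summable)
  qed
  have s: "(\<lambda>i. complex_of_real (a i) * q ^ e i) summable_on UNIV" if q: "norm q < 1" for q
  proof (rule abs_summable_summable, rule Infinite_Sum.abs_summable_on_comparison_test')
    \<comment> \<open>The lower bound 1/2 keeps ln r meaningful when q = 0.\<close>
    define r where "r = max (norm q) (1/2)"
    have r: "0 < r" "r < 1" "norm q \<le> r" using q by (auto simp: r_def)
    show "(\<lambda>i. \<bar>a i\<bar> * exp (- (- ln r) * real (e i))) summable_on UNIV" by (rule sm) (use r in simp)
    show "norm (complex_of_real (a i) * q ^ e i) \<le> \<bar>a i\<bar> * exp (- (- ln r) * real (e i))" for i
    proof -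
      have "norm q ^ e i \<le> r ^ e i" using r by (intro power_mono) auto
      also have "r ^ e i = exp (- (- ln r) * real (e i))" using r by (simp add: exp_of_nat2_mult)
      finally show ?thesis by (auto simp: norm_mult norm_power intro!: mult_left_mono)
    qed
  qed
  let ?F = "Abs_fps (\<lambda>k. complex_of_real (fiber_coeff a e k))"
  let ?G = "\<lambda>q. \<Sum>\<^sub>\<infinity>i. complex_of_real (a i) * q ^ e i"
  have sums: "(\<lambda>k. complex_of_real (fiber_coeff a e k) * q ^ k) sums ?G q" if q: "norm q < 1" for q
  proof (rule has_sum_imp_sums, rule has_sum_fibers[OF has_sum_infsum[OF s[OF q]]])
    fix k
    have "((\<lambda>i. complex_of_real (a i) * q ^ k) has_sum (complex_of_real (fiber_coeff a e k) * q ^ k)) {i. e i = k}"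
      by (intro has_sum_cmult_left has_sum_of_real A)
    thus "((\<lambda>i. complex_of_real (a i) * q ^ e i) has_sum complex_of_real (fiber_coeff a e k) * q ^ k) {i. e i = k}"
      by (rule has_sum_cong[THEN iffD1, rotated]) auto
  qed
  show "norm q < 1 \<Longrightarrow> (\<lambda>i. complex_of_real (a i) * q ^ e i) summable_on UNIV" by (rule s)
  show "norm q < 1 \<Longrightarrow> (\<lambda>k. complex_of_real (fiber_coeff a e k) * q ^ k) sums ?G q" by (rule sums)
  have cr: "fps_conv_radius ?F \<ge> 1"
    unfolding fps_conv_radius_def
    by (rule conv_radius_geI_ex') (use sums in \<open>auto simp: sums_iff\<close>)
  have ev: "eval_fps ?F q = ?G q" if "norm q < 1" for q
    using sums[OF that] by (simp add: eval_fps_def sums_iff)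
  have "eval_fps ?F holomorphic_on ball 0 1"
  proof (rule holomorphic_on_eval_fps)
    have "ereal (norm z) < fps_conv_radius ?F" if "norm z < 1" for z :: complex
    proof -
      have "ereal (norm z) < 1" using that by simp
      thus ?thesis using cr by (rule less_le_trans)
    qed
    thus "ball (0::complex) 1 \<subseteq> eball 0 (fps_conv_radius ?F)" by (auto simp: in_eball_iff)
  qed
  thus "?G holomorphic_on ball 0 1" by (rule holomorphic_transform) (use ev in simp)
  show "?G has_fps_expansion ?F"
    unfolding has_fps_expansion_def
  proof
    show "0 < fps_conv_radius ?F" using cr by (rule less_le_trans[rotated]) simp
    have "\<forall>\<^sub>F q in nhds 0. q \<in> ball (0::complex) 1" by (rule eventually_nhds_in_open) auto
    thus "\<forall>\<^sub>F q in nhds 0. eval_fps ?F q = ?G q" by eventually_elim (use ev in simp)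
  qed
qed

text \<open>Exponents and coefficients of $q^{-1/4}\theta_2(q)$, of $\theta_4(q^2)$ and of the lattice series,
  where \<open>p\<close> encodes $x = 2\,\mathrm{fst}\,p + 1$ and $y = 2\,\mathrm{snd}\,p$.\<close>

definition e2 :: "int \<Rightarrow> nat" where "e2 n = nat (n\<^sup>2 + n)"
definition e4 :: "int \<Rightarrow> nat" where "e4 n = 2 * nat (n\<^sup>2)"
definition a4 :: "int \<Rightarrow> real" where "a4 n = (if even n then 1 else -1)"
definition eL :: "int \<times> int \<Rightarrow> nat" where "eL p = nat ((2 * fst p + 1)\<^sup>2 + (2 * snd p)\<^sup>2)"
definition aL :: "int \<times> int \<Rightarrow> real" where "aL p = ((2 * fst p + 1)\<^sup>2 - (2 * snd p)\<^sup>2) / 2"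

lemma real_e2: "real (e2 n) = (real_of_int n + 1/2)\<^sup>2 - 1/4"
proof -
  have "n\<^sup>2 + n = n * (n + 1)" by (simp add: power2_eq_square algebra_simps)
  also have "\<dots> \<ge> 0" by (cases "n \<ge> 0") (auto intro: mult_nonneg_nonneg mult_nonpos_nonpos)
  finally have "real (e2 n) = real_of_int (n\<^sup>2 + n)" by (simp add: e2_def)
  thus ?thesis by (simp add: power2_eq_square algebra_simps)
qed

lemma real_e4: "real (e4 n) = 2 * (real_of_int n + 0)\<^sup>2" by (simp add: e4_def)

lemma real_eL: "real (eL (p,q)) = 4 * ((real_of_int p + 1/2)\<^sup>2 + (real_of_int q + 0)\<^sup>2)"
proof -
  have "real (eL (p,q)) = real_of_int ((2 * p + 1)\<^sup>2 + (2 * q)\<^sup>2)" by (simp add: eL_def)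
  thus ?thesis by (simp add: power2_eq_square algebra_simps)
qed

lemma aL_eq: "aL (p,q) = 2 * ((real_of_int p + 1/2)\<^sup>2 - (real_of_int q + 0)\<^sup>2)"
  by (simp add: aL_def power2_eq_square algebra_simps diff_divide_distrib)

lemma exp_eL: "exp (- c * real (eL (p,q))) = exp (- (4 * c) * (real_of_int p + 1/2)\<^sup>2) * exp (- (4 * c) * (real_of_int q + 0)\<^sup>2)"
  unfolding real_eL exp_add[symmetric] by (rule arg_cong[of _ _ exp]) (simp add: algebra_simps)

lemma summable_e2: "c > 0 \<Longrightarrow> (\<lambda>i. \<bar>1\<bar> * exp (- c * real (e2 i))) summable_on UNIV"
proof -
  assume c: "c > 0"
  have "exp (- c * real (e2 i)) = exp (c / 4) * exp (- c * (real_of_int i + 1/2)\<^sup>2)" for i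
    unfolding real_e2 exp_add[symmetric] by (rule arg_cong[of _ _ exp]) (simp add: algebra_simps)
  thus ?thesis using summable_on_cmult_right[OF has_sum_imp_summable[OF has_sum_gauss[OF c, of "1/2"]], of "exp (c / 4)"] by simp
qed

lemma summable_e4: "c > 0 \<Longrightarrow> (\<lambda>i. \<bar>a4 i\<bar> * exp (- c * real (e4 i))) summable_on UNIV"
proof -
  assume c: "c > 0"
  have "\<bar>a4 i\<bar> * exp (- c * real (e4 i)) = exp (- (2 * c) * (real_of_int i + 0)\<^sup>2)" for i
    unfolding real_e4 by (simp add: a4_def)
  thus ?thesis using has_sum_imp_summable[OF has_sum_gauss[of "2 * c" 0]] c by simp
qed

text \<open>The exponent is 4(p + 1/2)^2 + 4 q^2, so the sum factors into one-dimensional sums at d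
  = 4c; the weight x^2 - y^2 replaces one Gaussian sum at a time by its derivative.\<close>

lemma has_sum_lattice:
  assumes c: "c > 0"
  defines "d \<equiv> 4 * c"
  shows "((\<lambda>p. aL p * exp (- c * real (eL p))) has_sum (2 * (gauss_d d (1/2) * gauss d 0 - gauss d (1/2) * gauss_d d 0))) UNIV"
    and "(\<lambda>p. \<bar>aL p\<bar> * exp (- c * real (eL p))) summable_on UNIV"
proof -
  have d: "d > 0" using c by (simp add: d_def)
  let ?x = "\<lambda>p::int. (real_of_int p + 1/2)\<^sup>2" and ?y = "\<lambda>q::int. (real_of_int q + 0)\<^sup>2"
  let ?e = "\<lambda>z::real. exp (- d * z)"
  have 1: "((\<lambda>(p,q). (?x p * ?e (?x p)) * ?e (?y q)) has_sum (gauss_d d (1/2) * gauss d 0)) (UNIV \<times> UNIV)"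
    by (rule has_sum_prod_real[OF gauss_deriv(2)[OF d] has_sum_gauss[OF d]])
  have 2: "((\<lambda>(p,q). ?e (?x p) * (?y q * ?e (?y q))) has_sum (gauss d (1/2) * gauss_d d 0)) (UNIV \<times> UNIV)"
    by (rule has_sum_prod_real[OF has_sum_gauss[OF d] gauss_deriv(2)[OF d]])
  let ?f1 = "\<lambda>(p,q). (?x p * ?e (?x p)) * ?e (?y q)" and ?f2 = "\<lambda>(p,q). ?e (?x p) * (?y q * ?e (?y q))"
  have "((\<lambda>p. 2 * (?f1 p + - ?f2 p)) has_sum (2 * (gauss_d d (1/2) * gauss d 0 + - (gauss d (1/2) * gauss_d d 0)))) (UNIV \<times> UNIV)"
    by (intro has_sum_cmult_right has_sum_add has_sum_uminusI 1 2)
  moreover have "2 * (?f1 p + - ?f2 p) = aL p * exp (- c * real (eL p))" for p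
    by (cases p) (simp only: prod.case exp_eL aL_eq d_def[symmetric], simp add: algebra_simps)
  ultimately show "((\<lambda>p. aL p * exp (- c * real (eL p))) has_sum (2 * (gauss_d d (1/2) * gauss d 0 - gauss d (1/2) * gauss_d d 0))) UNIV"
    by simp
  have "(\<lambda>p. 2 * (?f1 p + ?f2 p)) summable_on UNIV \<times> UNIV"
    by (intro summable_on_cmult_right summable_on_add has_sum_imp_summable[OF 1] has_sum_imp_summable[OF 2])
  hence "(\<lambda>p. 2 * (?f1 p + ?f2 p)) summable_on UNIV" by simp
  thus "(\<lambda>p. \<bar>aL p\<bar> * exp (- c * real (eL p))) summable_on UNIV"
  proof (rule summable_on_comparison_test)
    fix r :: "int \<times> int"
    obtain p q where r: "r = (p,q)" by (cases r)
    have "\<bar>?x p - ?y q\<bar> \<le> ?x p + ?y q" by (rule abs_leI) auto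
    hence "\<bar>aL r\<bar> \<le> 2 * (?x p + ?y q)" by (simp add: r aL_eq)
    hence "\<bar>aL r\<bar> * (?e (?x p) * ?e (?y q)) \<le> 2 * (?x p + ?y q) * (?e (?x p) * ?e (?y q))" by (intro mult_right_mono) auto
    thus "\<bar>aL r\<bar> * exp (- c * real (eL r)) \<le> 2 * (?f1 r + ?f2 r)"
      by (simp only: r prod.case exp_eL d_def[symmetric], simp add: algebra_simps)
  qed auto
qed

text \<open>The left-hand side is the Wronskian of $\theta_2$ and $\theta_3$ at $4t$, hence given by $(\log k)'$.\<close>

lemma lattice_eq_theta_product:
  assumes t: "t > 0"
  shows "((\<lambda>p. aL p * exp (- (pi * t) * real (eL p))) has_sum (S2 t ^ 2 * S4 (2 * t) / 16)) UNIV"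
proof -
  let ?d = "4 * (pi * t)"
  have c: "pi * t > 0" "?d > 0" "4 * t > 0" "2 * t > 0" using t by auto
  have d: "?d = pi * (4 * t)" by simp
  note p = gauss_pos[OF c(2)]
  have "2 * pi * (gauss_d ?d 0 / gauss ?d 0 - gauss_d ?d (1/2) / gauss ?d (1/2)) = - (pi / 2) * S4 (4 * t) ^ 2"
    using Dk_eq[OF c(3)] unfolding Dk_def d .
  moreover have "pi * (2 * (gauss_d ?d (1/2) / gauss ?d (1/2) - gauss_d ?d 0 / gauss ?d 0)) = - (2 * pi * (gauss_d ?d 0 / gauss ?d 0 - gauss_d ?d (1/2) / gauss ?d (1/2)))"
    by (simp add: right_diff_distrib mult_ac)
  ultimately have "pi * (2 * (gauss_d ?d (1/2) / gauss ?d (1/2) - gauss_d ?d 0 / gauss ?d 0)) = pi * (S4 (4 * t) ^ 2 / 2)"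
    by simp
  hence e: "2 * (gauss_d ?d (1/2) / gauss ?d (1/2) - gauss_d ?d 0 / gauss ?d 0) = S4 (4 * t) ^ 2 / 2"
    by (rule mult_left_cancel[THEN iffD1, rotated]) simp
  have "2 * (gauss_d ?d (1/2) * gauss ?d 0 - gauss ?d (1/2) * gauss_d ?d 0) =
    2 * (gauss_d ?d (1/2) / gauss ?d (1/2) - gauss_d ?d 0 / gauss ?d 0) * (gauss ?d 0 * gauss ?d (1/2))"
    using p by (simp add: field_simps)
  also have "\<dots> = S4 (4 * t) ^ 2 / 2 * (gauss ?d 0 * gauss ?d (1/2))" unfolding e ..
  also have "gauss ?d 0 * gauss ?d (1/2) = S2 (2 * t) / 2"
  proof -
    have "2 * pi * t > 0" using t by simp
    from gauss_double(3)[OF this] show ?thesis unfolding S_eq_gauss(2)[OF c(4)] by (simp add: mult_ac)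
  qed
  also have "S4 (4 * t) ^ 2 = S3 (2 * t) * S4 (2 * t)" using S_double(4)[OF c(4)] by simp
  also have "S3 (2 * t) * S4 (2 * t) / 2 * (S2 (2 * t) / 2) = S2 t ^ 2 * S4 (2 * t) / 16"
    unfolding S_double(2)[OF t] by simp
  finally have E: "2 * (gauss_d ?d (1/2) * gauss ?d 0 - gauss ?d (1/2) * gauss_d ?d 0) = S2 t ^ 2 * S4 (2 * t) / 16" .
  show ?thesis using has_sum_lattice(1)[OF c(1)] unfolding E .
qed

definition T2 :: "complex \<Rightarrow> complex" where "T2 q = (\<Sum>\<^sub>\<infinity>n. complex_of_real 1 * q ^ e2 n)"
definition T4 :: "complex \<Rightarrow> complex" where "T4 q = (\<Sum>\<^sub>\<infinity>n. complex_of_real (a4 n) * q ^ e4 n)"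
definition TL :: "complex \<Rightarrow> complex" where "TL q = (\<Sum>\<^sub>\<infinity>p. complex_of_real (aL p) * q ^ eL p)"

lemma T_holomorphic: "T2 holomorphic_on ball 0 1" "T4 holomorphic_on ball 0 1" "TL holomorphic_on ball 0 1"
  unfolding T2_def[abs_def] T4_def[abs_def] TL_def[abs_def]
  by (rule exponent_family(4); erule summable_e2 summable_e4 has_sum_lattice(2))+

lemma infsum_of_real_complex: "(f has_sum S) A \<Longrightarrow> (\<Sum>\<^sub>\<infinity>x\<in>A. complex_of_real (f x)) = complex_of_real S"
  by (rule infsumI) (rule has_sum_of_real)

lemma exp_power_real: "complex_of_real (exp (- c)) ^ k = complex_of_real (exp (- c * real k))"
  by (simp only: of_real_power[symmetric] exp_of_nat2_mult)

lemma T_real: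
  assumes t: "t > 0"
  defines "q \<equiv> complex_of_real (exp (- (pi * t)))"
  shows "T2 q = complex_of_real (exp (pi * t / 4) * gauss (pi * t) (1/2))"
    "T4 q = complex_of_real (gauss4 (2 * (pi * t)))"
    "TL q = complex_of_real (S2 t ^ 2 * S4 (2 * t) / 16)"
proof -
  have c: "pi * t > 0" "2 * (pi * t) > 0" using t by auto
  have "complex_of_real 1 * q ^ e2 n = complex_of_real (exp (pi * t / 4) * exp (- (pi * t) * (real_of_int n + 1/2)\<^sup>2))" for n
    unfolding q_def exp_power_real real_e2 exp_add[symmetric] of_real_1 mult_1
    by (rule arg_cong[of _ _ "\<lambda>x. complex_of_real (exp x)"]) (simp add: algebra_simps)
  thus "T2 q = complex_of_real (exp (pi * t / 4) * gauss (pi * t) (1/2))"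
    unfolding T2_def by (simp only: infsum_of_real_complex[OF has_sum_cmult_right[OF has_sum_gauss[OF c(1)]]])
  have "complex_of_real (a4 n) * q ^ e4 n = complex_of_real ((if even n then 1 else -1) * exp (- (2 * (pi * t)) * (real_of_int n)\<^sup>2))" for n
    unfolding q_def exp_power_real real_e4 of_real_mult[symmetric] a4_def
    by (rule arg_cong[of _ _ complex_of_real]) simp
  thus "T4 q = complex_of_real (gauss4 (2 * (pi * t)))"
    unfolding T4_def by (simp only: infsum_of_real_complex[OF has_sum_gauss4[OF c(2)]])
  show "TL q = complex_of_real (S2 t ^ 2 * S4 (2 * t) / 16)"
    unfolding TL_def q_def exp_power_real of_real_mult[symmetric]
    by (rule infsum_of_real_complex[OF lattice_eq_theta_product[OF t]])
qed

text \<open>The branch of q^(1/4) disappears in the fourth power, which makes g a power series in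
  q.\<close>

lemma powr_quarter: "q \<noteq> 0 \<Longrightarrow> (q powr complex_of_real (1/4)) ^ 4 = (q::complex)"
proof -
  assume q: "q \<noteq> 0"
  have "(q powr complex_of_real (1/4)) ^ 4 = q powr (of_nat 4 * complex_of_real (1/4))"
    using q by (simp add: powr_power mult.commute)
  thus ?thesis using q by simp
qed

lemma theta2_eq:
  assumes q: "q \<noteq> 0"
  shows "theta2 q = q powr complex_of_real (1/4) * T2 q"
proof -
  have "q powr complex_of_real ((real_of_int n + 1/2)\<^sup>2) = q powr complex_of_real (1/4) * q ^ e2 n" for n
  proof -
    have "(real_of_int n + 1/2)\<^sup>2 = 1/4 + real (e2 n)" by (simp add: real_e2)
    hence "q powr complex_of_real ((real_of_int n + 1/2)\<^sup>2) = q powr (complex_of_real (1/4) + of_nat (e2 n))" by simp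
    also have "\<dots> = q powr complex_of_real (1/4) * q powr of_nat (e2 n)" by (rule powr_add)
    also have "q powr of_nat (e2 n) = q ^ e2 n" using q by (simp add: powr_nat)
    finally show ?thesis .
  qed
  thus ?thesis unfolding theta2_def T2_def by (simp add: infsum_cmult_right')
qed

lemma theta4_eq: "theta4 (q\<^sup>2) = T4 q"
proof -
  have "(-1) powi n * (q\<^sup>2) ^ nat (n\<^sup>2) = complex_of_real (a4 n) * q ^ e4 n" for n :: int
  proof -
    have "(-1::complex) powi n = complex_of_real (a4 n)" by (simp add: a4_def power_int_minus_left)
    thus ?thesis by (simp add: e4_def power_mult)
  qed
  thus ?thesis by (simp add: theta4_def T4_def)
qed

lemma g_eq: "g q = q / 16 * T2 q ^ 4 * T4 q ^ 2"
proof (cases "q = 0")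
  case True
  \<comment> \<open>At q = 0 every summand \<open>0 powr _\<close> is 0, in agreement with the
    explicit factor q.\<close>
  have "theta2 0 = 0" by (simp add: theta2_def)
  thus ?thesis by (simp add: g_def True)
next
  case False
  show ?thesis unfolding g_def theta4_eq theta2_eq[OF False] power_mult_distrib powr_quarter[OF False] by simp
qed

text \<open>The theta identities are available for q = exp(-pi t), that is on (0,1). This set
  accumulates at 0, inside the disk of holomorphy of both expressions.\<close>

lemma g_eq_TL: assumes "norm q < 1" shows "g q = TL q"
proof -
  let ?h = "\<lambda>q. q / 16 * T2 q ^ 4 * T4 q ^ 2 - TL q"
  have "?h q = 0"
  proof (rule analytic_continuation[where f = ?h and S = "ball 0 1" and U = "complex_of_real ` {0<..<1}" and \<xi> = 0])
    show "?h holomorphic_on ball 0 1" by (intro holomorphic_intros T_holomorphic) simp_all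
    show "complex_of_real ` {0<..<1} \<subseteq> ball 0 1" by auto
    show "0 islimpt complex_of_real ` {0<..<1}"
      unfolding islimpt_approachable
    proof (intro allI impI)
      fix e :: real assume e: "e > 0"
      obtain x where "0 < x" "x < min e 1" using dense[of 0 "min e 1"] e by auto
      thus "\<exists>x'\<in>complex_of_real ` {0<..<1}. x' \<noteq> 0 \<and> dist x' 0 < e"
        by (intro bexI[of _ "complex_of_real x"]) auto
    qed
    fix z assume "z \<in> complex_of_real ` {0<..<1}"
    then obtain x where x: "z = complex_of_real x" "0 < x" "x < 1" by auto
    define t where "t = - ln x / pi"
    have t: "t > 0" using x by (auto simp: t_def intro!: divide_neg_pos)
    have z: "z = complex_of_real (exp (- (pi * t)))" using x by (simp add: t_def)
    have t2: "2 * t > 0" using t by simp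
    have "z / 16 * T2 z ^ 4 * T4 z ^ 2 = complex_of_real (exp (- (pi * t)) / 16 * (exp (pi * t / 4) * gauss (pi * t) (1/2)) ^ 4 * gauss4 (2 * (pi * t)) ^ 2)"
      unfolding z T_real[OF t] by simp
    also have "exp (- (pi * t)) / 16 * (exp (pi * t / 4) * gauss (pi * t) (1/2)) ^ 4 * gauss4 (2 * (pi * t)) ^ 2 = S2 t ^ 2 * S4 (2 * t) / 16"
    proof -
      have "exp (pi * t / 4) ^ 4 = exp (pi * t)" by (simp flip: exp_of_nat_mult)
      moreover have "exp (- (pi * t)) * exp (pi * t) = 1" by (simp flip: exp_add)
      moreover have "gauss (pi * t) (1/2) ^ 4 = S2 t ^ 2" unfolding S_eq_gauss(2)[OF t] by simp
      moreover have "gauss4 (2 * (pi * t)) ^ 2 = S4 (2 * t)" unfolding S_eq_gauss(3)[OF t2] by (simp add: mult_ac)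
      ultimately show ?thesis by (simp add: power_mult_distrib)
    qed
    finally show "?h z = 0" unfolding z T_real(3)[OF t] by simp
  qed (use assms in auto)
  thus ?thesis by (simp add: g_eq)
qed

lemma b_eq: "b k = complex_of_real (fiber_coeff aL eL k)"
proof -
  have "TL has_fps_expansion Abs_fps (\<lambda>k. complex_of_real (fiber_coeff aL eL k))"
    unfolding TL_def[abs_def] by (rule exponent_family(5)) (erule has_sum_lattice(2))
  moreover have "\<forall>\<^sub>F q in nhds 0. TL q = g q"
  proof -
    have "\<forall>\<^sub>F q in nhds 0. q \<in> ball (0::complex) 1" by (rule eventually_nhds_in_open) auto
    thus ?thesis by eventually_elim (simp add: g_eq_TL)
  qed
  ultimately have "g has_fps_expansion Abs_fps (\<lambda>k. complex_of_real (fiber_coeff aL eL k))"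
    by (metis has_fps_expansion_cong)
  from fps_nth_fps_expansion[OF this, of k] show ?thesis by (simp add: b_def)
qed

section \<open>Absolute convergence of the lattice sum at s = 3\<close>

lemma summable_inverse_square_int: "(\<lambda>n::int. 1 / (1 + \<bar>real_of_int n\<bar>)\<^sup>2) summable_on UNIV"
proof -
  have s: "(\<lambda>n. 1 / (1 + real n)\<^sup>2) summable_on UNIV"
    by (rule summable_nonneg_imp_summable_on) (use inverse_squares_sums in \<open>auto simp: sums_iff add.commute\<close>)
  have s2: "(\<lambda>n. 1 / (2 + real n)\<^sup>2) summable_on UNIV"
    by (rule summable_on_comparison_test[OF s]) (auto intro!: divide_left_mono power_mono)
  have "((\<lambda>n::int. 1 / (1 + \<bar>real_of_int n\<bar>)\<^sup>2) has_sum (infsum (\<lambda>n. 1 / (1 + real n)\<^sup>2) UNIV + infsum (\<lambda>n. 1 / (2 + real n)\<^sup>2) UNIV)) UNIV"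
  proof (rule has_sum_int_split)
    show "((\<lambda>n. 1 / (1 + \<bar>real_of_int (int n)\<bar>)\<^sup>2) has_sum infsum (\<lambda>n. 1 / (1 + real n)\<^sup>2) UNIV) UNIV"
      using has_sum_infsum[OF s] by simp
    have "1 + \<bar>real_of_int (-1 - int n)\<bar> = 2 + real n" for n by simp
    thus "((\<lambda>n. 1 / (1 + \<bar>real_of_int (-1 - int n)\<bar>)\<^sup>2) has_sum infsum (\<lambda>n. 1 / (2 + real n)\<^sup>2) UNIV) UNIV"
      using has_sum_infsum[OF s2] by (simp only:)
  qed
  thus ?thesis by (rule has_sum_imp_summable)
qed

text \<open>A lower bound in product form lets the lattice sum be dominated by a product of two
  one-dimensional sums. It comes from X^2 + 4Y^2 >= 4XY with X = |2p + 1| >= 1 and Y = |q|; the case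
  q = 0 is separate.\<close>

lemma eL_ge: "real (eL (p,q)) \<ge> (1 + \<bar>real_of_int p\<bar>) * (1 + \<bar>real_of_int q\<bar>) / 2" "real (eL (p,q)) \<ge> 1"
proof -
  let ?X = "\<bar>2 * real_of_int p + 1\<bar>" and ?Y = "\<bar>real_of_int q\<bar>"
  have e: "real (eL (p,q)) = ?X * ?X + 4 * (?Y * ?Y)" unfolding real_eL by (simp add: power2_eq_square algebra_simps)
  have X1: "?X \<ge> 1"
  proof -
    have "2 * p + 1 \<noteq> 0" by presburger
    hence "\<bar>2 * p + 1\<bar> \<ge> 1" by linarith
    hence "real_of_int \<bar>2 * p + 1\<bar> \<ge> 1" by linarith
    thus ?thesis by simp
  qed
  have X2: "?X \<ge> (1 + \<bar>real_of_int p\<bar>) / 2"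
  proof -
    consider "p \<ge> 0" | "p \<le> -1" by linarith
    thus ?thesis
    proof cases
      case 1
      hence "real_of_int p \<ge> 0" by simp
      thus ?thesis by simp
    next
      case 2
      hence "real_of_int p \<le> -1" by linarith
      thus ?thesis by (simp add: abs_if)
    qed
  qed
  have XX: "?X * ?X \<ge> ?X * 1" using X1 by (intro mult_left_mono) auto
  show "real (eL (p,q)) \<ge> 1" unfolding e using XX X1 by (smt (verit) zero_le_square)
  have "?X * (1 + ?Y) \<le> ?X * ?X + 4 * (?Y * ?Y)"
  proof (cases "q = 0")
    case True thus ?thesis using XX by simp
  next
    case False
    hence Y1: "?Y \<ge> 1" by linarith
    have "(?X - 2 * ?Y) * (?X - 2 * ?Y) \<ge> 0" by simp
    hence "?X * ?X + 4 * (?Y * ?Y) \<ge> 4 * (?X * ?Y)" by (simp add: algebra_simps)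
    moreover have "?X * ?Y \<ge> ?X * 1" using Y1 X1 by (intro mult_left_mono) auto
    ultimately show ?thesis using X1 by (simp add: distrib_left)
  qed
  moreover have "(1 + \<bar>real_of_int p\<bar>) / 2 * (1 + ?Y) \<le> ?X * (1 + ?Y)" using X2 by (intro mult_right_mono) auto
  ultimately show "real (eL (p,q)) \<ge> (1 + \<bar>real_of_int p\<bar>) * (1 + \<bar>real_of_int q\<bar>) / 2" unfolding e by simp
qed

text \<open>The numerator is bounded by the norm N = x^2 + y^2, so the terms are of size 1/N^2,
  which is summable in the plane.\<close>

lemma summable_lattice_cubes: "(\<lambda>p. \<bar>aL p\<bar> / real (eL p) ^ 3) summable_on UNIV"
proof -
  obtain S where S: "((\<lambda>n::int. 1 / (1 + \<bar>real_of_int n\<bar>)\<^sup>2) has_sum S) UNIV"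
    using summable_inverse_square_int by (auto simp: summable_on_def)
  have "(\<lambda>r. 2 * (case r of (p,q) \<Rightarrow> 1 / (1 + \<bar>real_of_int p\<bar>)\<^sup>2 * (1 / (1 + \<bar>real_of_int q\<bar>)\<^sup>2))) summable_on UNIV \<times> UNIV"
    by (rule summable_on_cmult_right[OF has_sum_imp_summable[OF has_sum_prod_real[OF S S]]])
  hence "(\<lambda>r. 2 * (case r of (p,q) \<Rightarrow> 1 / (1 + \<bar>real_of_int p\<bar>)\<^sup>2 * (1 / (1 + \<bar>real_of_int q\<bar>)\<^sup>2))) summable_on UNIV" by simp
  thus ?thesis
  proof (rule summable_on_comparison_test)
    fix r :: "int \<times> int"
    obtain p q where r: "r = (p,q)" by (cases r)
    define N where "N = real (eL r)"
    define M where "M = (1 + \<bar>real_of_int p\<bar>) * (1 + \<bar>real_of_int q\<bar>)"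
    have M: "M > 0" by (auto simp: M_def intro!: mult_pos_pos add_pos_nonneg)
    have N: "N \<ge> 1" "N \<ge> M / 2" using eL_ge[of p q] by (auto simp: N_def M_def r)
    have "\<bar>(real_of_int p + 1/2)\<^sup>2 - (real_of_int q + 0)\<^sup>2\<bar> \<le> (real_of_int p + 1/2)\<^sup>2 + (real_of_int q + 0)\<^sup>2" by (rule abs_leI) auto
    hence "2 * \<bar>(real_of_int p + 1/2)\<^sup>2 - (real_of_int q + 0)\<^sup>2\<bar> \<le> 2 * ((real_of_int p + 1/2)\<^sup>2 + (real_of_int q + 0)\<^sup>2)"
      by (rule mult_left_mono) simp
    also have "\<dots> = N / 2" unfolding N_def r real_eL by simp
    finally have a: "\<bar>aL r\<bar> \<le> N / 2" unfolding r aL_eq abs_mult abs_numeral .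
    have "\<bar>aL r\<bar> / N ^ 3 \<le> (N / 2) / N ^ 3" using N by (intro divide_right_mono a) auto
    also have "\<dots> = 1 / (2 * N\<^sup>2)" using N by (simp add: power3_eq_cube power2_eq_square)
    also have "\<dots> \<le> 1 / (2 * (M / 2)\<^sup>2)" using N M by (intro divide_left_mono mult_left_mono power_mono mult_pos_pos) auto
    also have "\<dots> = 2 * (1 / M\<^sup>2)" by (simp add: power_divide)
    finally show "\<bar>aL r\<bar> / real (eL r) ^ 3 \<le> 2 * (case r of (p,q) \<Rightarrow> 1 / (1 + \<bar>real_of_int p\<bar>)\<^sup>2 * (1 / (1 + \<bar>real_of_int q\<bar>)\<^sup>2))"
      by (simp add: r N_def M_def power_mult_distrib)
  qed auto
qed

lemma L_g_3_lattice:
  assumes "((\<lambda>p. aL p / real (eL p) ^ 3) has_sum S) UNIV"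
  shows "L_g_3 = complex_of_real S"
proof -
  have "((\<lambda>k. fiber_coeff aL eL k / real k ^ 3) has_sum S) UNIV"
  proof (rule has_sum_fibers[OF assms])
    fix k
    have "(aL has_sum fiber_coeff aL eL k) {i. eL i = k}" by (rule exponent_family(1)) (erule has_sum_lattice(2))
    hence "((\<lambda>i. aL i / real k ^ 3) has_sum (fiber_coeff aL eL k / real k ^ 3)) {i. eL i = k}" by (rule has_sum_divide_const)
    thus "((\<lambda>p. aL p / real (eL p) ^ 3) has_sum fiber_coeff aL eL k / real k ^ 3) {i. eL i = k}"
      by (rule has_sum_cong[THEN iffD1, rotated]) auto
  qed
  hence "(\<lambda>k. fiber_coeff aL eL k / real k ^ 3) sums S" by (rule has_sum_imp_sums)
  \<comment> \<open>The index k = 0 contributes 0, because division by zero gives 0.\<close>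
  hence "(\<lambda>k. fiber_coeff aL eL (Suc k) / real (Suc k) ^ 3) sums S" by (subst sums_Suc_iff) simp
  hence "(\<lambda>k. complex_of_real (fiber_coeff aL eL (Suc k) / real (Suc k) ^ 3)) sums complex_of_real S" by (rule sums_of_real)
  moreover have "complex_of_real (fiber_coeff aL eL (Suc k) / real (Suc k) ^ 3) = b (Suc k) / of_nat (Suc k) ^ 3" for k
    by (simp add: b_eq)
  ultimately show ?thesis unfolding L_g_3_def by (simp only: sums_iff)
qed

section \<open>The Rogers--Zudilin substitution\<close>

text \<open>A family over a countable type is extended by zero along \<open>to_nat\<close>, so that
  theorems on series over the naturals apply to sums over pairs.\<close>

lemma has_sum_to_nat_iff:
  fixes f :: "'i::countable \<Rightarrow> real"
  shows "((\<lambda>n. if n \<in> range (to_nat :: 'i \<Rightarrow> nat) then f (from_nat n) else 0) has_sum s) UNIV \<longleftrightarrow> (f has_sum s) UNIV"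
proof -
  let ?h = "\<lambda>n. if n \<in> range (to_nat :: 'i \<Rightarrow> nat) then f (from_nat n) else 0"
  have "(?h has_sum s) UNIV \<longleftrightarrow> (?h has_sum s) (range (to_nat :: 'i \<Rightarrow> nat))"
    by (rule has_sum_cong_neutral) auto
  also have "\<dots> \<longleftrightarrow> (f has_sum s) UNIV"
    by (subst has_sum_reindex) (auto simp: o_def)
  finally show ?thesis .
qed

text \<open>Integrability of the sum is a conclusion here, drawn from the integrals of absolute
  values; this is how \<open>W\<close> is seen to be integrable.\<close>

lemma integral_has_sum:
  fixes f :: "'i::countable \<Rightarrow> real \<Rightarrow> real"
  assumes fi: "\<And>i. f i absolutely_integrable_on S"
    and sm: "(\<lambda>i. integral S (\<lambda>x. \<bar>f i x\<bar>)) summable_on UNIV"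
    and F: "\<And>x. x \<in> S \<Longrightarrow> ((\<lambda>i. f i x) has_sum F x) UNIV"
  shows "F absolutely_integrable_on S" "((\<lambda>i. integral S (f i)) has_sum integral S F) UNIV"
proof -
  let ?R = "range (to_nat :: 'i \<Rightarrow> nat)"
  define h where "h = (\<lambda>n x. if n \<in> ?R then indicator S x *\<^sub>R f (from_nat n) x else 0)"
  have int: "integrable lebesgue (h n)" for n
    using fi[of "from_nat n"] unfolding h_def set_integrable_def by (cases "n \<in> ?R") simp_all
  have Fh: "((\<lambda>n. h n x) has_sum (indicator S x *\<^sub>R F x)) UNIV" for x
  proof -
    have "((\<lambda>i. indicator S x *\<^sub>R f i x) has_sum (indicator S x *\<^sub>R F x)) UNIV"
      using F[of x] by (cases "x \<in> S") simp_all
    thus ?thesis unfolding h_def by (rule has_sum_to_nat_iff[of "\<lambda>i. indicator S x *\<^sub>R f i x", THEN iffD2])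
  qed
  have sn: "summable (\<lambda>n. norm (h n x))" for x
    by (rule summable_on_imp_summable[OF summable_on_iff_abs_summable_on_real[THEN iffD1, OF has_sum_imp_summable[OF Fh]]])
  have In: "(\<integral>x. norm (h n x) \<partial>lebesgue) = (if n \<in> ?R then integral S (\<lambda>x. \<bar>f (from_nat n) x\<bar>) else 0)" for n
  proof (cases "n \<in> ?R")
    case True
    have "(\<integral>x. norm (h n x) \<partial>lebesgue) = (LINT x:S|lebesgue. \<bar>f (from_nat n) x\<bar>)"
      unfolding set_lebesgue_integral_def using True by (intro Bochner_Integration.integral_cong) (auto simp: h_def indicator_def)
    also have "\<dots> = integral S (\<lambda>x. \<bar>f (from_nat n) x\<bar>)"
      by (rule set_lebesgue_integral_eq_integral(2)[OF set_integrable_abs[OF fi]])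
    finally show ?thesis using True by simp
  qed (simp add: h_def)
  have I: "(\<integral>x. h n x \<partial>lebesgue) = (if n \<in> ?R then integral S (f (from_nat n)) else 0)" for n
  proof (cases "n \<in> ?R")
    case True
    have "(\<integral>x. h n x \<partial>lebesgue) = (LINT x:S|lebesgue. f (from_nat n) x)"
      unfolding set_lebesgue_integral_def using True by (intro Bochner_Integration.integral_cong) (auto simp: h_def)
    also have "\<dots> = integral S (f (from_nat n))"
      by (rule set_lebesgue_integral_eq_integral(2)[OF fi])
    finally show ?thesis using True by simp
  qed (simp add: h_def)
  have sI: "summable (\<lambda>n. \<integral>x. norm (h n x) \<partial>lebesgue)"
  proof -
    obtain s where "((\<lambda>i. integral S (\<lambda>x. \<bar>f i x\<bar>)) has_sum s) UNIV" using sm by (auto simp: summable_on_def)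
    hence "((\<lambda>n. \<integral>x. norm (h n x) \<partial>lebesgue) has_sum s) UNIV" unfolding In
      by (rule has_sum_to_nat_iff[of "\<lambda>i. integral S (\<lambda>x. \<bar>f i x\<bar>)", THEN iffD2])
    thus ?thesis by (intro summable_on_imp_summable has_sum_imp_summable)
  qed
  have AE: "AE x in lebesgue. summable (\<lambda>n. norm (h n x))" using sn by simp
  have suminf: "(\<Sum>n. h n x) = indicator S x *\<^sub>R F x" for x
    using has_sum_imp_sums[OF Fh] by (simp add: sums_iff)
  from integrable_suminf[OF int AE sI] show Fi: "F absolutely_integrable_on S"
    unfolding suminf set_integrable_def .
  have F_int: "(\<integral>x. indicator S x *\<^sub>R F x \<partial>lebesgue) = integral S F"
    using set_lebesgue_integral_eq_integral(2)[OF Fi] unfolding set_lebesgue_integral_def .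
  have ss: "(\<lambda>n. \<integral>x. h n x \<partial>lebesgue) sums integral S F"
    using sums_integral[OF int AE sI] unfolding suminf F_int .
  have "summable (\<lambda>n. norm (\<integral>x. h n x \<partial>lebesgue))"
  proof (rule summable_comparison_test'[OF sI])
    show "norm (norm (\<integral>x. h n x \<partial>lebesgue)) \<le> (\<integral>x. norm (h n x) \<partial>lebesgue)" for n
      unfolding real_norm_def abs_idempotent by (rule integral_abs_bound)
  qed
  from norm_summable_imp_has_sum[OF this ss] have "((\<lambda>n. \<integral>x. h n x \<partial>lebesgue) has_sum integral S F) UNIV" .
  thus "((\<lambda>i. integral S (f i)) has_sum integral S F) UNIV"
    unfolding I by (rule has_sum_to_nat_iff[of "\<lambda>i. integral S (f i)", THEN iffD1])
qed

text \<open>For nonnegative terms the roles are reversed: the integral of F bounds all finite sums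
  of integrals, which gives the summability.\<close>

lemma integral_has_sum_nonneg:
  fixes f :: "'i::countable \<Rightarrow> real \<Rightarrow> real"
  assumes fi: "\<And>i. f i absolutely_integrable_on S" and nn: "\<And>i x. x \<in> S \<Longrightarrow> f i x \<ge> 0"
    and Fi: "F absolutely_integrable_on S"
    and F: "\<And>x. x \<in> S \<Longrightarrow> ((\<lambda>i. f i x) has_sum F x) UNIV"
  shows "((\<lambda>i. integral S (f i)) has_sum integral S F) UNIV"
proof (rule integral_has_sum(2)[OF fi _ F])
  have e: "integral S (\<lambda>x. \<bar>f i x\<bar>) = integral S (f i)" for i
    by (rule Henstock_Kurzweil_Integration.integral_cong) (use nn in simp)
  have int: "f i integrable_on S" "F integrable_on S" for i
    using set_lebesgue_integral_eq_integral(1)[OF fi] set_lebesgue_integral_eq_integral(1)[OF Fi] by auto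
  show "(\<lambda>i. integral S (\<lambda>x. \<bar>f i x\<bar>)) summable_on UNIV"
    unfolding e
  proof (rule nonneg_bdd_above_summable_on)
    show "0 \<le> integral S (f i)" for i by (rule integral_nonneg[OF int(1)]) (use nn in simp)
    show "bdd_above (sum (\<lambda>i. integral S (f i)) ` {X. X \<subseteq> UNIV \<and> finite X})"
    proof (rule bdd_aboveI2)
      fix X :: "'i set" assume "X \<in> {X. X \<subseteq> UNIV \<and> finite X}"
      hence X: "finite X" by simp
      have "(\<Sum>i\<in>X. integral S (f i)) = integral S (\<lambda>x. \<Sum>i\<in>X. f i x)"
        by (rule integral_sum[symmetric]) (use X int in auto)
      also have "\<dots> \<le> integral S F"
        by (rule integral_le) (use X int nn finite_sum_le_has_sum[OF F X] in \<open>auto intro: integrable_sum\<close>)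
      finally show "(\<Sum>i\<in>X. integral S (f i)) \<le> integral S F" .
    qed
  qed
qed

lemma has_integral_FTC_Ioi:
  fixes f G :: "real \<Rightarrow> real"
  assumes m: "f \<in> borel_measurable borel" and d: "\<And>x. 0 \<le> x \<Longrightarrow> DERIV G x :> f x"
    and nn: "\<And>x. 0 \<le> x \<Longrightarrow> 0 \<le> f x" and lim: "(G \<longlongrightarrow> T) at_top"
  shows "(f has_integral (T - G 0)) {0<..}" "f absolutely_integrable_on {0<..}"
proof -
  have "(\<integral>\<^sup>+x. ennreal (f x) * indicator {0..} x \<partial>lborel) = T - G 0"
    by (rule nn_integral_FTC_atLeast[OF m d nn lim])
  moreover have "(\<integral>\<^sup>+x. ennreal (f x) * indicator {0..} x \<partial>lborel) = (\<integral>\<^sup>+x. ennreal (indicator {0..} x * f x) \<partial>lborel)"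
    by (intro nn_integral_cong) (auto simp: indicator_def)
  moreover have "T - G 0 \<ge> 0"
  proof -
    have "\<forall>\<^sub>F x in at_top. G 0 \<le> G x"
      using eventually_ge_at_top[of 0]
    proof eventually_elim
      case (elim x)
      show ?case by (rule DERIV_nonneg_imp_nondecreasing[OF elim]) (use d nn in blast)
    qed
    from tendsto_lowerbound[OF lim this] show ?thesis by simp
  qed
  ultimately have "((\<lambda>x. indicator {0..} x * f x) has_integral (T - G 0)) UNIV"
    by (intro nn_integral_has_integral) (use m nn in \<open>auto simp: indicator_def\<close>)
  also have "(\<lambda>x. indicator {0..} x * f x) = (\<lambda>x. if x \<in> {0..} then f x else 0)" by (auto simp: indicator_def)
  finally have "(f has_integral (T - G 0)) {0..}" by (subst (asm) has_integral_restrict_UNIV)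
  thus h: "(f has_integral (T - G 0)) {0<..}"
  proof (rule has_integral_spike_set_eq[THEN iffD1, rotated 2])
    show "negligible {x \<in> {0..} - {0<..}. f x \<noteq> 0}" by (rule negligible_subset[of "{0}"]) auto
    show "negligible {x \<in> {0<..} - {0..}. f x \<noteq> 0}" by (rule negligible_subset[of "{0}"]) auto
  qed
  show "f absolutely_integrable_on {0<..}"
    by (rule nonnegative_absolutely_integrable_1) (use h nn in \<open>auto simp: integrable_on_def\<close>)
qed

lemma absolutely_integrable_dominated:
  fixes f w :: "real \<Rightarrow> real"
  assumes "continuous_on {0<..} f" "w absolutely_integrable_on {0<..}" "\<And>x. x > 0 \<Longrightarrow> \<bar>f x\<bar> \<le> w x"
  shows "f absolutely_integrable_on {0<..}"
proof (rule set_integrable_bound[OF assms(2)])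
  have "f \<in> borel_measurable (lebesgue_on {0<..})"
    by (rule continuous_imp_measurable_on_sets_lebesgue[OF assms(1)]) simp
  thus "set_borel_measurable lebesgue {0<..} f"
    unfolding set_borel_measurable_def by (subst (asm) borel_measurable_restrict_space_iff) auto
  show "AE x in lebesgue. x \<in> {0<..} \<longrightarrow> norm (f x) \<le> norm (w x)"
    using assms(3) by (intro AE_I2 impI) (metis abs_ge_self greaterThan_iff order_trans real_norm_def)
qed

lemma integral_square_exp:
  assumes c: "(c::real) > 0"
  shows "((\<lambda>t. t\<^sup>2 * exp (- c * t)) has_integral (2 / c ^ 3)) {0<..}" "(\<lambda>t. t\<^sup>2 * exp (- c * t)) absolutely_integrable_on {0<..}"
proof -
  \<comment> \<open>Coefficients of the antiderivative -(A t^2 + B t + D) exp(-ct); its derivative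
    is t^2 exp(-ct) when cA = 1, cB = 2A and cD = B.\<close>
  define A B D where "A = 1 / c" and "B = 2 / c\<^sup>2" and "D = 2 / c ^ 3"
  have r: "c * A = 1" "c * B = 2 * A" "c * D = B"
    using c by (simp_all add: A_def B_def D_def power2_eq_square power3_eq_cube)
  let ?G = "\<lambda>t::real. - (A * t\<^sup>2 + B * t + D) * exp (- c * t)"
  have d: "DERIV ?G t :> t\<^sup>2 * exp (- c * t)" for t
  proof -
    have "DERIV (\<lambda>t. - (A * t\<^sup>2 + B * t + D)) t :> - (2 * A * t + B)"
      by (auto intro!: derivative_eq_intros)
    moreover have "DERIV (\<lambda>t. exp (- c * t)) t :> exp (- c * t) * (- c)" by (auto intro!: derivative_eq_intros)
    ultimately have "DERIV ?G t :> - (2 * A * t + B) * exp (- c * t) + exp (- c * t) * (- c) * - (A * t\<^sup>2 + B * t + D)"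
      by (rule DERIV_mult)
    moreover have "- (2 * A * t + B) * E + E * (- c) * - (A * t\<^sup>2 + B * t + D)
      = ((c * A) * t\<^sup>2 + (c * B) * t + c * D - (2 * A * t + B)) * E" for E by (simp add: algebra_simps)
    ultimately show ?thesis unfolding r by simp
  qed
  have lim: "(?G \<longlongrightarrow> 0) at_top" using c by real_asymp
  have m: "(\<lambda>t. t\<^sup>2 * exp (- c * t)) \<in> borel_measurable borel" by measurable
  show "((\<lambda>t. t\<^sup>2 * exp (- c * t)) has_integral (2 / c ^ 3)) {0<..}"
    using has_integral_FTC_Ioi(1)[OF m d _ lim] by (simp add: D_def)
  show "(\<lambda>t. t\<^sup>2 * exp (- c * t)) absolutely_integrable_on {0<..}"
    by (rule has_integral_FTC_Ioi(2)[OF m d _ lim]) simp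
qed

lemma majorant_integrable: "(\<lambda>t::real. 2 / (1 + t\<^sup>2)) absolutely_integrable_on {0<..}"
proof (rule has_integral_FTC_Ioi(2))
  show "(\<lambda>t::real. 2 / (1 + t\<^sup>2)) \<in> borel_measurable borel" by measurable
  show "DERIV (\<lambda>t. 2 * arctan t) x :> 2 / (1 + x\<^sup>2)" for x :: real
    by (auto intro!: derivative_eq_intros simp: divide_inverse)
  show "((\<lambda>t::real. 2 * arctan t) \<longlongrightarrow> 2 * (pi / 2)) at_top"
    by (intro tendsto_intros tendsto_arctan_at_top)
qed auto

section \<open>Termwise integration and the exchange of indices\<close>

definition W :: "real \<Rightarrow> real" where "W t = Lam t * S2 t ^ 2 * S4 t"

text \<open>The Mellin transform at s = 3: a lattice term of norm N integrates to 2/(pi N)^3 times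
  its coefficient, whence the factor pi^3/2.\<close>

lemma L_g_3_integral_theta:
  assumes I: "integral {0<..} (\<lambda>t. t\<^sup>2 * (S2 t ^ 2 * S4 (2 * t) / 16)) = I"
  shows "L_g_3 = complex_of_real (pi ^ 3 / 2 * I)"
proof (rule L_g_3_lattice)
  let ?f = "\<lambda>p t. aL p * (t\<^sup>2 * exp (- (pi * real (eL p)) * t))"
  have N: "real (eL p) \<ge> 1" for p using eL_ge(2)[of "fst p" "snd p"] by simp
  have c: "pi * real (eL p) > 0" for p using N[of p] by simp
  have i: "integral {0<..} (?f p) = aL p * (2 / (pi * real (eL p)) ^ 3)" for p
    by (rule integral_unique[OF has_integral_mult_right[OF integral_square_exp(1)[OF c]]])
  have ia: "integral {0<..} (\<lambda>t. \<bar>?f p t\<bar>) = \<bar>aL p\<bar> * (2 / (pi * real (eL p)) ^ 3)" for p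
  proof -
    have "(\<lambda>t. \<bar>?f p t\<bar>) = (\<lambda>t. \<bar>aL p\<bar> * (t\<^sup>2 * exp (- (pi * real (eL p)) * t)))" by (auto simp: abs_mult)
    thus ?thesis by (simp only: integral_unique[OF has_integral_mult_right[OF integral_square_exp(1)[OF c]]])
  qed
  have "((\<lambda>p. integral {0<..} (?f p)) has_sum integral {0<..} (\<lambda>t. t\<^sup>2 * (S2 t ^ 2 * S4 (2 * t) / 16))) UNIV"
  proof (rule integral_has_sum(2))
    show "?f p absolutely_integrable_on {0<..}" for p
      by (rule set_integrable_mult_right[OF integral_square_exp(2)[OF c]])
    have "(\<lambda>p. 2 / pi ^ 3 * (\<bar>aL p\<bar> / real (eL p) ^ 3)) summable_on UNIV"
      by (rule summable_on_cmult_right[OF summable_lattice_cubes])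
    thus "(\<lambda>p. integral {0<..} (\<lambda>t. \<bar>?f p t\<bar>)) summable_on UNIV"
      unfolding ia by (simp add: power_mult_distrib mult_ac)
    fix t :: real assume "t \<in> {0<..}"
    hence t: "t > 0" by simp
    have "((\<lambda>p. t\<^sup>2 * (aL p * exp (- (pi * t) * real (eL p)))) has_sum (t\<^sup>2 * (S2 t ^ 2 * S4 (2 * t) / 16))) UNIV"
      by (rule has_sum_cmult_right[OF lattice_eq_theta_product[OF t]])
    thus "((\<lambda>p. ?f p t) has_sum (t\<^sup>2 * (S2 t ^ 2 * S4 (2 * t) / 16))) UNIV" by (simp add: mult_ac)
  qed
  from has_sum_cmult_right[OF this, of "pi ^ 3 / 2"]
  have "((\<lambda>p. pi ^ 3 / 2 * (aL p * (2 / (pi * real (eL p)) ^ 3))) has_sum (pi ^ 3 / 2 * I)) UNIV"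
    unfolding i I .
  thus "((\<lambda>p. aL p / real (eL p) ^ 3) has_sum (pi ^ 3 / 2 * I)) UNIV"
    by (simp add: power_mult_distrib)
qed

text \<open>A single term of the sinh series bounds sinh from below. The free choice of the odd k
  yields decay of any desired order.\<close>

lemma csch_le_power:
  assumes "0 < z" "z \<le> y" "odd k"
  shows "csch y \<le> fact k / z ^ k"
proof -
  have y: "y > 0" using assms by linarith
  let ?f = "\<lambda>n. if even n then 0 else y ^ n /\<^sub>R fact n"
  have "sum ?f {k} \<le> (\<Sum>n. ?f n)"
    by (rule sum_le_suminf) (use sinh_converges[of y] y in \<open>auto simp: sums_iff\<close>)
  hence "y ^ k / fact k \<le> sinh y" using sinh_converges[of y] assms(3) by (simp add: sums_iff divide_inverse mult.commute)
  moreover have "z ^ k / fact k \<le> y ^ k / fact k" using assms by (intro divide_right_mono power_mono) auto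
  ultimately have "z ^ k / fact k \<le> sinh y" by linarith
  hence "inverse (sinh y) \<le> inverse (z ^ k / fact k)" using assms by (intro le_imp_inverse_le) auto
  thus ?thesis by (simp add: csch_def)
qed

text \<open>A term of 2 t^2 g(exp(-pi t)). The first csch comes from theta_2^4 at t, the second from
  theta_2^2 at 1/(2t), into which the inversion turns theta_4^2 at 2t. A component i of p encodes
  the odd index 2i + 1.\<close>

definition RZ :: "nat \<times> nat \<Rightarrow> real \<Rightarrow> real" where
  "RZ p t = t * (2 * real (fst p) + 1) * (-1) ^ snd p * csch ((2 * real (fst p) + 1) * (pi * t)) * csch ((2 * real (snd p) + 1) * (pi / (4 * t)))"

text \<open>Both csch are replaced by inverse powers chosen by range: exponents 3 and 5 leave t^3
  for t <= 1, exponents 7 and 3 leave t^(-3) for t >= 1, each with at least quadratic decay in both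
  odd indices. The constant 241920 is 7! * 3! * 2^3, the larger of the two.\<close>

lemma RZ_bound:
  assumes t: "t > 0"
  shows "\<bar>RZ p t\<bar> \<le> 241920 * (1 / (2 * real (fst p) + 1)\<^sup>2 * (1 / (2 * real (snd p) + 1)\<^sup>2)) * (2 / (1 + t\<^sup>2))"
proof -
  define m n where "m = 2 * real (fst p) + 1" and "n = 2 * real (snd p) + 1"
  have m: "m \<ge> 1" and n: "n \<ge> 1" by (auto simp: m_def n_def)
  \<comment> \<open>The factors pi are removed from the arguments by bounding them below, by 1 here
    and by 2 in the next fact.\<close>
  have mt: "0 < m * t" "m * t \<le> m * (pi * t)" using m t pi_gt3 by (auto intro!: mult_left_mono)
  have nt: "0 < n / (2 * t)" "n / (2 * t) \<le> n * (pi / (4 * t))"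
  proof -
    have "n / (2 * t) = n * (2 / (4 * t))" by simp
    also have "\<dots> \<le> n * (pi / (4 * t))" using n t pi_gt3 by (intro mult_left_mono divide_right_mono) auto
    finally show "n / (2 * t) \<le> n * (pi / (4 * t))" .
  qed (use n t in simp)
  have pos: "csch (m * (pi * t)) > 0" "csch (n * (pi / (4 * t))) > 0" using m n t by (auto intro!: csch_pos)
  have RZ: "\<bar>RZ p t\<bar> = t * m * (csch (m * (pi * t)) * csch (n * (pi / (4 * t))))"
    using pos m t by (simp add: RZ_def abs_mult flip: m_def n_def)
  have bd: "\<bar>RZ p t\<bar> \<le> t * m * (fact k / (m * t) ^ k * (fact l / (n / (2 * t)) ^ l))" if "odd k" "odd l" for k l
    unfolding RZ using pos m n t
    by (intro mult_left_mono mult_mono csch_le_power[OF mt that(1)] csch_le_power[OF nt that(2)]) auto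
  have le: "1 / (m ^ (2 + i) * n ^ (2 + j)) \<le> 1 / m\<^sup>2 * (1 / n\<^sup>2)" for i j
  proof -
    have "m\<^sup>2 * n\<^sup>2 \<le> m ^ (2 + i) * n ^ (2 + j)"
      using m n by (intro mult_mono power_increasing) auto
    thus ?thesis using m n by (simp add: frac_le)
  qed
  have "\<bar>RZ p t\<bar> \<le> 241920 * (1 / m\<^sup>2 * (1 / n\<^sup>2)) * (2 / (1 + t\<^sup>2))"
  proof (cases "t \<le> 1")
    case True
    have t2: "t\<^sup>2 \<le> 1" using True t by (simp add: power_le_one)
    have "t * m * (fact 3 / (m * t) ^ 3 * (fact 5 / (n / (2 * t)) ^ 5)) = 23040 * t ^ 3 * (1 / (m ^ (2 + 0) * n ^ (2 + 3)))"
      using m n t by (simp add: fact_numeral field_simps eval_nat_numeral)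
    hence "\<bar>RZ p t\<bar> \<le> 23040 * t ^ 3 * (1 / (m ^ (2 + 0) * n ^ (2 + 3)))" using bd[of 3 5] by simp
    also have "\<dots> \<le> (241920 * (2 / (1 + t\<^sup>2))) * (1 / m\<^sup>2 * (1 / n\<^sup>2))"
    proof (rule mult_mono[OF _ le])
      have "t ^ 3 \<le> 1" using True t by (simp add: power_le_one)
      moreover have "1 \<le> 2 / (1 + t\<^sup>2)" using t2 by (simp add: le_divide_eq add_pos_nonneg)
      ultimately show "23040 * t ^ 3 \<le> 241920 * (2 / (1 + t\<^sup>2))" by linarith
    qed (use m n t in auto)
    finally show ?thesis by (simp only: mult_ac)
  next
    case False
    hence t1: "t \<ge> 1" by simp
    have "t * m * (fact 7 / (m * t) ^ 7 * (fact 3 / (n / (2 * t)) ^ 3)) = 241920 * (1 / t ^ 3) * (1 / (m ^ (2 + 4) * n ^ (2 + 1)))"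
      using m n t by (simp add: fact_numeral field_simps eval_nat_numeral)
    hence "\<bar>RZ p t\<bar> \<le> 241920 * (1 / t ^ 3) * (1 / (m ^ (2 + 4) * n ^ (2 + 1)))" using bd[of 7 3] by simp
    also have "\<dots> \<le> (241920 * (2 / (1 + t\<^sup>2))) * (1 / m\<^sup>2 * (1 / n\<^sup>2))"
    proof (rule mult_mono[OF mult_left_mono le])
      have "t\<^sup>2 \<le> t ^ 3" "1 \<le> t\<^sup>2" using t1 by (auto intro: power_increasing)
      hence "1 + t\<^sup>2 \<le> 2 * t ^ 3" by linarith
      thus "1 / t ^ 3 \<le> 2 / (1 + t\<^sup>2)" using t by (simp add: divide_le_eq le_divide_eq add_pos_nonneg mult.commute field_simps)
    qed (use m n t in auto)
    finally show ?thesis by (simp only: mult_ac)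
  qed
  thus ?thesis unfolding m_def n_def .
qed

lemma RZ_integrable: "RZ p absolutely_integrable_on {0<..}"
proof (rule absolutely_integrable_dominated[OF _ _ RZ_bound])
  have "sinh ((2 * real (fst p) + 1) * (pi * t)) \<noteq> 0" "sinh ((2 * real (snd p) + 1) * (pi / (4 * t))) \<noteq> 0" if "t > 0" for t
    using that by (auto simp: add_eq_0_iff)
  thus "continuous_on {0<..} (RZ p)"
    unfolding RZ_def[abs_def] csch_def by (intro continuous_intros) auto
  show "(\<lambda>t. 241920 * (1 / (2 * real (fst p) + 1)\<^sup>2 * (1 / (2 * real (snd p) + 1)\<^sup>2)) * (2 / (1 + t\<^sup>2))) absolutely_integrable_on {0<..}"
    by (rule set_integrable_mult_right[OF majorant_integrable])
qed

lemma RZ_summable: "(\<lambda>p. integral {0<..} (\<lambda>t. \<bar>RZ p t\<bar>)) summable_on UNIV"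
proof -
  define J where "J = integral {0<..} (\<lambda>t::real. 2 / (1 + t\<^sup>2))"
  have "(\<lambda>n. 1 / (2 * real n + 1)\<^sup>2) summable_on UNIV"
  proof (rule summable_on_comparison_test)
    show "(\<lambda>n. 1 / (1 + real n)\<^sup>2) summable_on UNIV"
      by (rule summable_nonneg_imp_summable_on) (use inverse_squares_sums in \<open>auto simp: sums_iff add.commute\<close>)
    show "1 / (2 * real n + 1)\<^sup>2 \<le> 1 / (1 + real n)\<^sup>2" for n by (intro divide_left_mono power_mono) auto
  qed simp
  then obtain s where s: "((\<lambda>n. 1 / (2 * real n + 1)\<^sup>2) has_sum s) UNIV" by (auto simp: summable_on_def)
  have "(\<lambda>p. 241920 * J * (case p of (m,n) \<Rightarrow> 1 / (2 * real m + 1)\<^sup>2 * (1 / (2 * real n + 1)\<^sup>2))) summable_on UNIV \<times> UNIV"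
    by (rule summable_on_cmult_right[OF has_sum_imp_summable[OF has_sum_prod_real[OF s s]]])
  hence "(\<lambda>p. 241920 * J * (case p of (m,n) \<Rightarrow> 1 / (2 * real m + 1)\<^sup>2 * (1 / (2 * real n + 1)\<^sup>2))) summable_on UNIV" by simp
  thus ?thesis
  proof (rule summable_on_comparison_test)
    fix p :: "nat \<times> nat"
    let ?K = "241920 * (1 / (2 * real (fst p) + 1)\<^sup>2 * (1 / (2 * real (snd p) + 1)\<^sup>2))"
    have i: "(\<lambda>t. \<bar>RZ p t\<bar>) integrable_on {0<..}"
      by (rule set_lebesgue_integral_eq_integral(1)[OF set_integrable_abs[OF RZ_integrable]])
    have "integral {0<..} (\<lambda>t. \<bar>RZ p t\<bar>) \<le> integral {0<..} (\<lambda>t. ?K * (2 / (1 + t\<^sup>2)))"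
      by (rule integral_le[OF i set_lebesgue_integral_eq_integral(1)[OF set_integrable_mult_right[OF majorant_integrable]]])
        (use RZ_bound in simp)
    also have "\<dots> = ?K * J" unfolding J_def by (rule integral_mult_right)
    finally show "integral {0<..} (\<lambda>t. \<bar>RZ p t\<bar>) \<le> 241920 * J * (case p of (m,n) \<Rightarrow> 1 / (2 * real m + 1)\<^sup>2 * (1 / (2 * real n + 1)\<^sup>2))"
      by (simp add: case_prod_unfold mult_ac)
    show "0 \<le> integral {0<..} (\<lambda>t. \<bar>RZ p t\<bar>)" by (rule integral_nonneg[OF i]) simp
  qed
qed

text \<open>The inversion at 2t writes theta_2^2 at 1/(2t) as 2t S4(2t). This absorbs one factor of
  t^2; the other stays in \<open>RZ\<close>.\<close>

lemma RZ_has_sum: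
  assumes t: "t > 0"
  shows "((\<lambda>p. RZ p t) has_sum (2 * (t\<^sup>2 * (S2 t ^ 2 * S4 (2 * t) / 16)))) UNIV"
proof -
  have a: "pi * t > 0" "pi / (2 * t) > 0" "2 * t > 0" using t by auto
  have S: "Psech (pi / (2 * t)) (1/2) = 2 * t * S4 (2 * t)" "Psech (pi * t) (1/2) = S2 t"
    using S_inversion(2)[OF a(3)] by (simp_all add: S2_def)
  from has_sum_prod_real[OF Psech_half_square[OF a(1)] Psech_half_lambert(1)[OF a(2)]]
  have "((\<lambda>(m,n). 8 * (2 * real m + 1) * csch ((2 * real m + 1) * (pi * t)) * (2 * (-1) ^ n * csch ((2 * real n + 1) * (pi / (2 * t) / 2))))
    has_sum (S2 t ^ 2 * (2 * t * S4 (2 * t)))) (UNIV \<times> UNIV)" unfolding S .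
  from has_sum_cmult_right[OF this, of "t / 16"]
  have "((\<lambda>p. t / 16 * (case p of (m,n) \<Rightarrow> 8 * (2 * real m + 1) * csch ((2 * real m + 1) * (pi * t)) * (2 * (-1) ^ n * csch ((2 * real n + 1) * (pi / (2 * t) / 2)))))
    has_sum (t / 16 * (S2 t ^ 2 * (2 * t * S4 (2 * t))))) UNIV" by simp
  moreover have "t / 16 * (case p of (m,n) \<Rightarrow> 8 * (2 * real m + 1) * csch ((2 * real m + 1) * (pi * t)) * (2 * (-1) ^ n * csch ((2 * real n + 1) * (pi / (2 * t) / 2)))) = RZ p t" for p
    by (cases p) (simp add: RZ_def)
  moreover have "t / 16 * (S2 t ^ 2 * (2 * t * S4 (2 * t))) = 2 * (t\<^sup>2 * (S2 t ^ 2 * S4 (2 * t) / 16))"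
    by (simp add: power2_eq_square)
  ultimately show ?thesis by (simp only:)
qed

text \<open>The constant $c$ is chosen so that the two indices trade places in the arguments of \<open>csch\<close>.\<close>

definition RZ_swap :: "nat \<times> nat \<Rightarrow> real \<Rightarrow> real" where
  "RZ_swap p u = (let c = (2 * real (snd p) + 1) / (2 * (2 * real (fst p) + 1)) in c / u\<^sup>2 * RZ p (c / u))"

text \<open>For odd m and n the coefficient is now n^2/(4 m u^3), up to sign. The factor 1/m goes
  with the series of \<open>Lam\<close> at u, the alternating n^2 with that of theta_2^2 theta_4^4
  at 1/u, which the inversion turns into u^3 S4 S2^2 at u.\<close>

lemma RZ_swap_has_sum:
  assumes u: "u > 0"
  shows "((\<lambda>p. RZ_swap p u) has_sum (W u / 16)) UNIV"
proof -
  have a: "pi * (1 / u) > 0" using u by auto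
  have S': "Psech (pi * (1 / u)) 0 ^ 2 - Psech (pi * (1 / u)) (1/2) ^ 2 = (u * S2 u) ^ 2"
    using S_inversion[OF u] S_double(5)[of "1 / u"] u by (simp add: S2_def S3_def)
  have S: "Psech (pi * (1 / u)) (1/2) = u * S4 u" using S_inversion[OF u] by (simp add: S2_def)
  from has_sum_prod_real[OF Lam_facts(3)[OF u] Psech_half_lambert(2)[OF a]]
  have "((\<lambda>(m,n). 2 / (2 * real m + 1) * csch ((2 * real m + 1) * (pi * u / 2)) * (2 * (-1) ^ n * (2 * real n + 1)\<^sup>2 * csch ((2 * real n + 1) * (pi * (1 / u) / 2))))
    has_sum (Lam u * (u * S4 u * (u * S2 u) ^ 2))) (UNIV \<times> UNIV)" unfolding S' unfolding S .
  from has_sum_cmult_right[OF this, of "1 / (16 * u ^ 3)"]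
  have "((\<lambda>p. 1 / (16 * u ^ 3) * (case p of (m,n) \<Rightarrow> 2 / (2 * real m + 1) * csch ((2 * real m + 1) * (pi * u / 2)) * (2 * (-1) ^ n * (2 * real n + 1)\<^sup>2 * csch ((2 * real n + 1) * (pi * (1 / u) / 2)))))
    has_sum (1 / (16 * u ^ 3) * (Lam u * (u * S4 u * (u * S2 u) ^ 2)))) UNIV" by simp
  moreover have "1 / (16 * u ^ 3) * (case p of (m,n) \<Rightarrow> 2 / (2 * real m + 1) * csch ((2 * real m + 1) * (pi * u / 2)) * (2 * (-1) ^ n * (2 * real n + 1)\<^sup>2 * csch ((2 * real n + 1) * (pi * (1 / u) / 2)))) = RZ_swap p u" for p
  proof -
    obtain i j where p: "p = (i,j)" by (cases p)
    define m n where "m = 2 * real i + 1" and "n = 2 * real j + 1"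
    have m: "m > 0" "n > 0" by (auto simp: m_def n_def)
    have e: "m * (pi * (n / (2 * m) / u)) = n * (pi * (1 / u) / 2)" "n * (pi / (4 * (n / (2 * m) / u))) = m * (pi * u / 2)"
      using m u by (simp_all add: field_simps)
    have "RZ_swap p u = n / (2 * m) / u\<^sup>2 * (n / (2 * m) / u * m * (-1) ^ j * csch (n * (pi * (1 / u) / 2)) * csch (m * (pi * u / 2)))"
      unfolding RZ_swap_def RZ_def p fst_conv snd_conv Let_def m_def[symmetric] n_def[symmetric] e ..
    also have "\<dots> = 1 / (16 * u ^ 3) * (2 / m * csch (m * (pi * u / 2)) * (2 * (-1) ^ j * n\<^sup>2 * csch (n * (pi * (1 / u) / 2))))"
      using m u by (simp add: power2_eq_square power3_eq_cube mult_ac)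
    finally show ?thesis unfolding p prod.case m_def n_def ..
  qed
  moreover have "1 / (16 * u ^ 3) * (Lam u * (u * S4 u * (u * S2 u) ^ 2)) = W u / 16"
    using u by (simp add: W_def power2_eq_square power3_eq_cube)
  ultimately show ?thesis by (simp only:)
qed

lemma substitution_reciprocal:
  fixes f :: "real \<Rightarrow> real"
  assumes c: "c > 0" and f: "f absolutely_integrable_on {0<..}"
  shows "(\<lambda>u. c / u\<^sup>2 * f (c / u)) absolutely_integrable_on {0<..}"
    "integral {0<..} (\<lambda>u. c / u\<^sup>2 * f (c / u)) = integral {0<..} f"
proof -
  have im: "(\<lambda>u. c / u) ` {0<..} = {0<..}"
  proof safe
    fix x :: real assume "x > 0"
    thus "x \<in> (\<lambda>u. c / u) ` {0<..}" using c by (intro image_eqI[of _ _ "c / x"]) auto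
  qed (use c in auto)
  have "(\<lambda>u. \<bar>- c / u\<^sup>2\<bar> * f (c / u)) absolutely_integrable_on {0<..} \<and>
    integral {0<..} (\<lambda>u. \<bar>- c / u\<^sup>2\<bar> * f (c / u)) = integral {0<..} f
    \<longleftrightarrow> f absolutely_integrable_on (\<lambda>u. c / u) ` {0<..} \<and> integral ((\<lambda>u. c / u) ` {0<..}) f = integral {0<..} f"
  proof (rule has_absolute_integral_change_of_variables_1')
    show "{0::real<..} \<in> sets lebesgue" by simp
    show "((\<lambda>u. c / u) has_real_derivative - c / x\<^sup>2) (at x within {0<..})" if "x \<in> {0<..}" for x
      using that by (auto intro!: derivative_eq_intros simp: power2_eq_square)
    show "inj_on (\<lambda>u. c / u) {0<..}" using c by (auto simp: inj_on_def field_simps)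
  qed
  moreover have "\<bar>- c / u\<^sup>2\<bar> = c / u\<^sup>2" for u using c by simp
  ultimately show "(\<lambda>u. c / u\<^sup>2 * f (c / u)) absolutely_integrable_on {0<..}"
    "integral {0<..} (\<lambda>u. c / u\<^sup>2 * f (c / u)) = integral {0<..} f"
    using f unfolding im by (simp_all only: simp_thms)
qed

text \<open>Both families are integrated term by term, and the substitution makes corresponding
  integrals agree, also those of absolute values; so \<open>RZ_summable\<close> serves both. The
  factor 32 is 2 * 16, from the normalisations of the two sums.\<close>

lemma W_integral:
  "W absolutely_integrable_on {0<..}"
  "integral {0<..} (\<lambda>t. t\<^sup>2 * (S2 t ^ 2 * S4 (2 * t) / 16)) = integral {0<..} W / 32"
proof -
  let ?c = "\<lambda>p::nat\<times>nat. (2 * real (snd p) + 1) / (2 * (2 * real (fst p) + 1))"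
  have c: "?c p > 0" for p by simp
  have RZ_swap: "RZ_swap p = (\<lambda>u. ?c p / u\<^sup>2 * RZ p (?c p / u))" for p by (simp add: RZ_swap_def[abs_def] Let_def)
  have Hta: "(\<lambda>u. \<bar>RZ_swap p u\<bar>) = (\<lambda>u. ?c p / u\<^sup>2 * \<bar>RZ p (?c p / u)\<bar>)" for p
    unfolding RZ_swap using c[of p] by (simp add: abs_mult)
  have 1: "RZ_swap p absolutely_integrable_on {0<..}" for p
    unfolding RZ_swap by (rule substitution_reciprocal(1)[OF c RZ_integrable])
  have 2: "integral {0<..} (RZ_swap p) = integral {0<..} (RZ p)" for p
    unfolding RZ_swap by (rule substitution_reciprocal(2)[OF c RZ_integrable])
  have 3: "integral {0<..} (\<lambda>u. \<bar>RZ_swap p u\<bar>) = integral {0<..} (\<lambda>t. \<bar>RZ p t\<bar>)" for p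
    unfolding Hta by (rule substitution_reciprocal(2)[OF c set_integrable_abs[OF RZ_integrable]])
  have sm: "(\<lambda>p. integral {0<..} (\<lambda>u. \<bar>RZ_swap p u\<bar>)) summable_on UNIV" unfolding 3 by (rule RZ_summable)
  have A: "(\<lambda>u. W u / 16) absolutely_integrable_on {0<..}" "((\<lambda>p. integral {0<..} (RZ_swap p)) has_sum integral {0<..} (\<lambda>u. W u / 16)) UNIV"
    by (rule integral_has_sum[OF 1 sm]; use RZ_swap_has_sum in simp)+
  have "((\<lambda>p. integral {0<..} (RZ p)) has_sum integral {0<..} (\<lambda>t. 2 * (t\<^sup>2 * (S2 t ^ 2 * S4 (2 * t) / 16)))) UNIV"
    by (rule integral_has_sum(2)[OF RZ_integrable RZ_summable]) (use RZ_has_sum in simp)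
  with A(2) have "integral {0<..} (\<lambda>t. 2 * (t\<^sup>2 * (S2 t ^ 2 * S4 (2 * t) / 16))) = integral {0<..} (\<lambda>u. W u / 16)"
    unfolding 2 by (rule has_sum_unique[rotated])
  thus "integral {0<..} (\<lambda>t. t\<^sup>2 * (S2 t ^ 2 * S4 (2 * t) / 16)) = integral {0<..} W / 32"
    unfolding integral_mult_right integral_divide by simp
  from set_integrable_mult_right[OF A(1), of 16] show "W absolutely_integrable_on {0<..}" by simp
qed

lemma L_g_3_eq_W: "L_g_3 = complex_of_real (pi ^ 3 / 64 * integral {0<..} W)"
  using L_g_3_integral_theta[OF W_integral(2)] by simp

section \<open>The double hypergeometric series\<close>

lemma km_at_0: "(km \<longlongrightarrow> 1) (at_right 0)"
proof -
  have "((\<lambda>t. sqrt (1 - kc t ^ 2)) \<longlongrightarrow> sqrt (1 - 0 ^ 2)) (at_right 0)"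
    by (rule tendsto_real_sqrt[OF tendsto_diff[OF tendsto_const tendsto_power[OF kc_at_0]]])
  moreover have "\<forall>\<^sub>F t in at_right 0. sqrt (1 - kc t ^ 2) = km t"
    unfolding eventually_at_right_field
  proof (intro exI[of _ 1] conjI allI impI)
    fix t :: real assume "0 < t" "t < 1"
    have "1 - kc t ^ 2 = km t ^ 2" using km_kc(3)[OF \<open>0 < t\<close>] by linarith
    thus "sqrt (1 - kc t ^ 2) = km t" using km_kc(1)[OF \<open>0 < t\<close>] by (simp only: real_sqrt_abs abs_of_pos)
  qed simp
  ultimately have "(km \<longlongrightarrow> sqrt (1 - 0 ^ 2)) (at_right 0)" by (rule Lim_transform_eventually)
  thus ?thesis by simp
qed

text \<open>The angle p with cos p = k. Its differential supplies the factor 1/kc of the integrand,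
  and powers of k become the moments of \<open>wallis_cos\<close>.\<close>

definition am :: "real \<Rightarrow> real" where "am t = arccos (km t)"

lemma am_deriv:
  assumes t: "t > 0"
  shows "(am has_real_derivative (pi / 2 * km t * S4 t ^ 2 / kc t)) (at t)"
proof -
  note k = km_kc(1-5)[OF t]
  have "(arccos has_real_derivative inverse (- sqrt (1 - (km t)\<^sup>2))) (at (km t))"
    by (rule DERIV_arccos) (use k(1,4) in simp_all)
  from DERIV_chain2[where f = arccos and g = km and x = t, OF this km_deriv[OF t]]
  have "((\<lambda>t. arccos (km t)) has_real_derivative inverse (- sqrt (1 - (km t)\<^sup>2)) * (- (pi / 2) * km t * S4 t ^ 2)) (at t)" .
  moreover have "sqrt (1 - (km t)\<^sup>2) = kc t"
  proof -
    have "1 - (km t)\<^sup>2 = (kc t)\<^sup>2" using k(3) by linarith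
    thus ?thesis using k(2) by (simp only: real_sqrt_abs abs_of_pos)
  qed
  ultimately have "((\<lambda>t. arccos (km t)) has_real_derivative inverse (- kc t) * (- (pi / 2) * km t * S4 t ^ 2)) (at t)"
    by (simp only:)
  moreover have "inverse (- kc t) * (- (pi / 2) * km t * S4 t ^ 2) = pi / 2 * km t * S4 t ^ 2 / kc t"
    unfolding inverse_minus_eq divide_inverse minus_mult_minus by (simp add: mult_ac)
  ultimately show ?thesis unfolding am_def[abs_def] by (simp only:)
qed

text \<open>As t runs from 0 to infinity, k decreases from 1 to 0. Injectivity comes from the
  positive derivative of \<open>am\<close>, surjectivity from connectedness of the image of
  \<open>km\<close> and its two limits.\<close>

lemma am_image: "inj_on am {0<..}" "am ` {0<..} = {0<..<pi/2}"
proof -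
  have inc: "am s < am t" if "0 < s" "s < t" for s t
  proof (rule DERIV_pos_imp_increasing[OF that(2)])
    fix x assume "s \<le> x" "x \<le> t"
    hence x: "x > 0" using that by linarith
    show "\<exists>y. DERIV am x :> y \<and> y > 0"
      by (rule exI, rule conjI[OF am_deriv[OF x]]) (use km_kc(1,2)[OF x] S4_pos[OF x] in simp)
  qed
  show "inj_on am {0<..}"
    by (rule linorder_inj_onI') (use inc in force)
  have cont: "continuous_on {0<..} km"
    by (intro continuous_at_imp_continuous_on ballI DERIV_isCont[OF km_deriv]) simp
  show "am ` {0<..} = {0<..<pi/2}"
  proof safe
    fix t :: real assume t: "t > 0"
    have "arccos 1 < arccos (km t)" by (rule arccos_less_arccos) (use km_kc(1,4)[OF t] in simp_all)
    moreover have "arccos (km t) < arccos 0" by (rule arccos_less_arccos) (use km_kc(1,4)[OF t] in simp_all)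
    ultimately show "am t \<in> {0<..<pi/2}" unfolding am_def greaterThanLessThan_iff arccos_1 arccos_0 by (rule conjI)
  next
    fix p :: real assume p: "p \<in> {0<..<pi/2}"
    have c: "0 < cos p" "cos p < 1" using p cos_gt_zero_pi[of p] cos_monotone_0_pi[of 0 p] by auto
    have "\<forall>\<^sub>F t in at_right 0. km t > cos p" by (rule order_tendstoD(1)[OF km_at_0 c(2)])
    then obtain d where d: "d > 0" "\<And>t. 0 < t \<Longrightarrow> t < d \<Longrightarrow> km t > cos p" unfolding eventually_at_right_field by auto
    hence 1: "d / 2 > 0" "km (d / 2) > cos p" by auto
    have "\<forall>\<^sub>F t in at_top. km t < cos p \<and> t > 0"
      by (intro eventually_conj order_tendstoD(2)[OF km_tendsto c(1)] eventually_gt_at_top)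
    then obtain s where s: "s > 0" "km s < cos p" using eventually_happens by force
    have conn: "connected (km ` {0<..})" by (rule connected_continuous_image[OF cont]) simp
    have im: "km s \<in> km ` {0<..}" "km (d / 2) \<in> km ` {0<..}" using 1 s by auto
    have "cos p \<in> km ` {0<..}"
      by (rule connectedD_interval[OF conn im]) (use 1 s in simp_all)
    then obtain t where t: "t > 0" "cos p = km t" by auto
    hence "am t = p" using p by (simp add: am_def flip: t(2)) (simp add: arccos_cos)
    with t show "p \<in> am ` {0<..}" by auto
  qed
qed

lemma wallis_km:
  "(\<lambda>t. pi / 2 * km t * S4 t ^ 2 / kc t * km t ^ (2 * n)) absolutely_integrable_on {0<..}"
  "integral {0<..} (\<lambda>t. pi / 2 * km t * S4 t ^ 2 / kc t * km t ^ (2 * n)) = pi / 2 * cb n"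
proof -
  let ?d = "\<lambda>t. pi / 2 * km t * S4 t ^ 2 / kc t"
  let ?f = "\<lambda>p::real. cos p ^ (2 * n)"
  have I: "(?f has_integral (pi / 2 * cb n)) {0<..<pi/2}"
    using wallis_cos[of n] by (simp add: has_integral_Icc_iff_Ioo)
  hence "?f absolutely_integrable_on {0<..<pi/2}"
    by (intro nonnegative_absolutely_integrable_1) (auto simp: integrable_on_def power_mult)
  with integral_unique[OF I]
  have "?f absolutely_integrable_on am ` {0<..} \<and> integral (am ` {0<..}) ?f = pi / 2 * cb n"
    by (simp add: am_image)
  moreover have "(\<lambda>t. \<bar>?d t\<bar> * ?f (am t)) absolutely_integrable_on {0<..} \<and> integral {0<..} (\<lambda>t. \<bar>?d t\<bar> * ?f (am t)) = pi / 2 * cb n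
    \<longleftrightarrow> ?f absolutely_integrable_on am ` {0<..} \<and> integral (am ` {0<..}) ?f = pi / 2 * cb n"
  proof (rule has_absolute_integral_change_of_variables_1')
    show "{0::real<..} \<in> sets lebesgue" by simp
    show "(am has_real_derivative ?d t) (at t within {0<..})" if "t \<in> {0<..}" for t
      by (rule has_field_derivative_at_within[OF am_deriv]) (use that in simp)
  qed (rule am_image(1))
  ultimately have *: "(\<lambda>t. \<bar>?d t\<bar> * ?f (am t)) absolutely_integrable_on {0<..}" "integral {0<..} (\<lambda>t. \<bar>?d t\<bar> * ?f (am t)) = pi / 2 * cb n"
    by auto
  have e: "\<bar>?d t\<bar> * ?f (am t) = ?d t * km t ^ (2 * n)" if "t \<in> {0<..}" for t
  proof -
    have t: "t > 0" using that by simp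
    note k = km_kc(1-5)[OF t]
    have "?d t > 0" using k(1,2) S4_pos[OF t] by simp
    moreover have "cos (am t) = km t" unfolding am_def by (rule cos_arccos) (use k(1,4) in simp_all)
    ultimately show ?thesis by (simp only: abs_of_pos)
  qed
  show "(\<lambda>t. ?d t * km t ^ (2 * n)) absolutely_integrable_on {0<..}"
    using *(1) e by (subst (asm) set_integrable_cong[OF refl refl e]) auto
  show "integral {0<..} (\<lambda>t. ?d t * km t ^ (2 * n)) = pi / 2 * cb n"
    unfolding *(2)[symmetric] by (rule Henstock_Kurzweil_Integration.integral_cong) (rule e[symmetric])
qed

lemma artanh_has_sum:
  assumes x: "0 < x" "x < 1"
  shows "((\<lambda>m. x ^ (2 * m + 1) / (2 * real m + 1)) has_sum artanh x) UNIV"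
proof -
  \<comment> \<open>Chosen so that (y - 1)/(y + 1) = x, the variable of the series for ln y.\<close>
  let ?y = "(1 + x) / (1 - x)"
  have y: "?y > 0" using x by simp
  have "?y - 1 = 2 * x / (1 - x)" "?y + 1 = 2 / (1 - x)" using x by (simp_all add: field_simps)
  hence e: "(?y - 1) / (?y + 1) = x" using x by simp
  have "(\<lambda>m. 1 / 2 * (2 * x ^ (2 * m + 1) / real (2 * m + 1))) sums (1 / 2 * ln ?y)"
    using sums_mult[OF ln_series_quadratic[OF y], of "1/2"] unfolding e .
  hence "(\<lambda>m. x ^ (2 * m + 1) / (2 * real m + 1)) sums artanh x" by (simp add: artanh_def add.commute)
  thus ?thesis by (rule sums_nonneg_imp_has_sum) (use x in auto)
qed

text \<open>A term of 2W, arranged as a constant times the integrand of \<open>wallis_km\<close>.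
  The exponent collects 2m + 1 from artanh, 2n from ell and 2 from theta_2^4, less the one factor k
  kept in the density.\<close>

definition KdF_term :: "nat \<times> nat \<Rightarrow> real \<Rightarrow> real" where
  "KdF_term p t = 4 / pi * (cb (snd p) ^ 2 / (2 * real (fst p) + 1)) * (pi / 2 * km t * S4 t ^ 2 / kc t * km t ^ (2 * (fst p + snd p + 1)))"

text \<open>By S3 = S4/kc the product theta_2^4 theta_4^2 becomes k^2 S3 S4^2/kc; then artanh k and
  S3 = ell(k^2) are expanded in powers of k.\<close>

lemma KdF_term_has_sum:
  assumes t: "t > 0"
  shows "((\<lambda>p. KdF_term p t) has_sum (2 * W t)) UNIV"
proof -
  note k = km_kc(1-5)[OF t]
  have k2: "0 \<le> km t ^ 2" "km t ^ 2 < 1" using k(1,4) by (auto simp: power_less_one_iff)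
  have "((\<lambda>n. cb n ^ 2 * (km t ^ 2) ^ n) has_sum S3 t) UNIV"
    using ell_sums[OF k2] unfolding S3_eq_ell[OF t, symmetric] by (rule sums_nonneg_imp_has_sum) simp
  from has_sum_prod_real[OF artanh_has_sum[OF k(1,4)] this]
  have "((\<lambda>(m,n). km t ^ (2 * m + 1) / (2 * real m + 1) * (cb n ^ 2 * (km t ^ 2) ^ n)) has_sum (Lam t * S3 t)) (UNIV \<times> UNIV)"
    unfolding artanh_km[OF t] .
  from has_sum_cmult_right[OF this, of "2 * km t ^ 2 * S4 t ^ 2 / kc t"]
  have "((\<lambda>p. 2 * km t ^ 2 * S4 t ^ 2 / kc t * (case p of (m,n) \<Rightarrow> km t ^ (2 * m + 1) / (2 * real m + 1) * (cb n ^ 2 * (km t ^ 2) ^ n))) has_sum (2 * km t ^ 2 * S4 t ^ 2 / kc t * (Lam t * S3 t))) UNIV"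
    by simp
  moreover have "2 * km t ^ 2 * S4 t ^ 2 / kc t * (case p of (m,n) \<Rightarrow> km t ^ (2 * m + 1) / (2 * real m + 1) * (cb n ^ 2 * (km t ^ 2) ^ n)) = KdF_term p t" for p
  proof -
    obtain m n where p: "p = (m,n)" by (cases p)
    have perm: "2 * (c / d) * (s / k * (K * (x * y))) = 2 * K * s / k * (x / d * (c * y))" for c d s k K x y :: real
      by (simp add: mult_ac)
    have perm': "4 / pi * c * (pi / 2 * x * s / k * y) = 2 * c * (s / k * (x * y))" for c s k x y :: real
      by (simp add: mult_ac)
    have e: "km t * km t ^ (2 * (m + n + 1)) = km t ^ 2 * (km t ^ (2 * m + 1) * (km t ^ 2) ^ n)"
      by (simp add: power_add power_mult distrib_left power2_eq_square)
    have "KdF_term p t = 2 * (cb n ^ 2 / (2 * real m + 1)) * (S4 t ^ 2 / kc t * (km t * km t ^ (2 * (m + n + 1))))"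
      unfolding KdF_term_def p fst_conv snd_conv by (rule perm')
    also have "\<dots> = 2 * km t ^ 2 * S4 t ^ 2 / kc t * (km t ^ (2 * m + 1) / (2 * real m + 1) * (cb n ^ 2 * (km t ^ 2) ^ n))"
      unfolding e by (rule perm)
    finally show ?thesis unfolding p prod.case ..
  qed
  moreover have "2 * km t ^ 2 * S4 t ^ 2 / kc t * (Lam t * S3 t) = 2 * W t"
    using S_pos[OF t] S4_pos[OF t] by (simp add: W_def km_def kc_def power_divide power2_eq_square)
  ultimately show ?thesis by simp
qed

text \<open>These turn the parameters of the double series into the Wallis number of index m + n + 1
  and the artanh coefficient 1/(2m + 1).\<close>

lemma pochhammer_quotients:
  "pochhammer (3/2) n / pochhammer 2 n = 2 * cb (Suc n)"
  "pochhammer (1/2) n / pochhammer (3/2) n = 1 / (2 * real n + 1)"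
proof -
  have 1: "pochhammer (1/2) (Suc n) = 1/2 * pochhammer (3/2 :: real) n" using pochhammer_rec[of "1/2::real" n] by simp
  have 2: "fact (Suc n) = pochhammer (2::real) n" using pochhammer_rec[of "1::real" n] by (simp only: pochhammer_fact) simp
  show "pochhammer (3/2) n / pochhammer 2 n = 2 * cb (Suc n)" unfolding cb_def 1 2 by simp
  have "pochhammer (1/2) n * (1/2 + real n) = 1/2 * pochhammer (3/2 :: real) n"
    using 1 by (simp add: pochhammer_Suc)
  moreover have "pochhammer (3/2 :: real) n > 0" by (rule pochhammer_pos) simp
  ultimately show "pochhammer (1/2) n / pochhammer (3/2) n = 1 / (2 * real n + 1)" by (simp add: field_simps)
qed

text \<open>The terms are nonnegative, so the integrability of \<open>W\<close> found by the
  substitution justifies termwise integration; each term integrates to a Wallis moment with its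
  coefficient.\<close>

lemma KdF_eq_W: "KdF [3/2] [2] [1/2, 1] [3/2] [1/2, 1/2] [1] 1 1 = 2 * integral {0<..} W"
proof -
  have int: "((\<lambda>p. integral {0<..} (KdF_term p)) has_sum integral {0<..} (\<lambda>t. 2 * W t)) UNIV"
  proof (rule integral_has_sum_nonneg)
    show "KdF_term p absolutely_integrable_on {0<..}" for p
      unfolding KdF_term_def[abs_def] by (rule set_integrable_mult_right[OF wallis_km(1)])
    show "0 \<le> KdF_term p t" if "t \<in> {0<..}" for p t
      using that km_kc(1,2)[of t] by (auto simp: KdF_term_def intro!: mult_nonneg_nonneg divide_nonneg_nonneg)
    show "(\<lambda>t. 2 * W t) absolutely_integrable_on {0<..}" by (rule set_integrable_mult_right[OF W_integral(1)])
  qed (use KdF_term_has_sum in simp)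
  have cancel: "4 / pi * (c / d) * (pi / 2 * y) = 2 * y * (1 / d) * c" for c d y :: real
    by (simp add: mult_ac)
  have "integral {0<..} (KdF_term p) = (case p of (m,n) \<Rightarrow> 2 * cb (Suc (m + n)) * (1 / (2 * real m + 1)) * cb n ^ 2)" for p
    unfolding KdF_term_def[abs_def] integral_mult_right wallis_km(2) cancel by (simp add: case_prod_unfold)
  with int have "(\<Sum>\<^sub>\<infinity>(m,n). 2 * cb (Suc (m + n)) * (1 / (2 * real m + 1)) * cb n ^ 2) = 2 * integral {0<..} W"
    by (simp add: infsumI)
  moreover have "(prod_list (map (\<lambda>a. pochhammer a (m+n)) [3/2]) * prod_list (map (\<lambda>a. pochhammer a m) [1/2, 1])
           * prod_list (map (\<lambda>a. pochhammer a n) [1/2, 1/2]))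
        / (prod_list (map (\<lambda>a. pochhammer a (m+n)) [2]) * prod_list (map (\<lambda>a. pochhammer a m) [3/2])
           * prod_list (map (\<lambda>a. pochhammer a n) [1]))
        * 1^m * 1^n / (fact m * fact n) = 2 * cb (Suc (m + n)) * (1 / (2 * real m + 1)) * cb n ^ 2" for m n
  proof -
    have "(pochhammer (3/2) (m+n) * (pochhammer (1/2) m * fact m) * (pochhammer (1/2) n * pochhammer (1/2) n))
        / (pochhammer 2 (m+n) * pochhammer (3/2) m * fact n) / (fact m * fact n)
      = (pochhammer (3/2) (m+n) / pochhammer 2 (m+n)) * (pochhammer (1/2) m / pochhammer (3/2) m) * cb n ^ 2"
      by (simp add: cb_def power2_eq_square)
    thus ?thesis unfolding pochhammer_quotients by (simp add: pochhammer_fact)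
  qed
  ultimately show ?thesis unfolding KdF_def by (simp only:)
qed

theorem theorem1:
  shows "L_g_3 = complex_of_real (pi^3 / 128 *
           KdF [3/2] [2] [1/2, 1] [3/2] [1/2, 1/2] [1] 1 1)"
  unfolding L_g_3_eq_W KdF_eq_W by simp

end
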